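(* Let $Z,T,Y,k_Y,(s_i)_{i\in\mathbb{N}}$ and the parametric model $\{k_{Y,\theta};\theta\in\Theta\}$ be as in the framework described in the context, and assume that the model satisfies the regularity condition (A), the Fourier condition (B) and the well-specification condition (C) given there, with true parameter $\theta_0$. Assume moreover that for all $\alpha>0$, \[ \liminf_{n\to\infty}\ \inf_{\theta\in\Theta,\ \|\theta-\theta_0\|\ge\alpha}\ \frac1n\sum_{i,j=1}^n\bigl(k_{Y,\theta}(s_i-s_j)-k_{Y,\theta_0}(s_i-s_j)\bigr)^2>0 . \] For $n\in\mathbb{N}$ let $y=(Y(s_1),\ldots,Y(s_n))^\top$, $R_\theta=(k_{Y,\theta}(s_i-s_j))_{i,j=1,\ldots,n}$, and let \[ \hat\theta_{\mathrm{ML}}\in\operatorname*{argmin}_{\theta\in\Theta}L_\theta,\qquad L_\theta=\frac1n\bigl(\log\det(R_\theta)+y^\top R_\theta^{-1}y\bigr). \] Then, as $n\to\infty$, $\hat\theta_{\mathrm{ML}}\to\theta_0$ in probability.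
   Context: $\mathbb{N}$ is the set of positive integers; $|x|=\max_i|x_i|$ and $\|x\|$ is the Euclidean norm. A function $k:\mathbb{R}^d\to\mathbb{R}$ is called a stationary covariance function if $(x_1,x_2)\mapsto k(x_1-x_2)$ is a covariance function. The Fourier transform of $h:\mathbb{R}^d\to\mathbb{R}$ is $\hat h(f)=(2\pi)^{-d}\int_{\mathbb{R}^d}h(t)e^{-\mathrm{i}f^\top t}\,dt$. A sequence $(x_i)_{i\in\mathbb{N}}$ in $\mathbb{R}^d$ is asymptotically well-separated if $\inf_{i\neq j}|x_i-x_j|>0$. A stationary covariance function $k$ on $\mathbb{R}^d$ is sub-exponential and asymptotically positive if: (i) there are constants $C<\infty$, $c>0$ with $|k(s)|\le C\exp(-c|s|)$ for all $s\in\mathbb{R}^d$; (ii) for any asymptotically well-separated sequence $(x_i)$, the smallest eigenvalue of $(k(x_i-x_j))_{i,j=1,\ldots,n}$ is bounded below by a strictly positive constant uniformly in $n\in\mathbb{N}$. A function $F:\mathbb{R}\to\mathbb{R}$ is sub-exponential and non-decreasing if it is non-constant, continuously differentiable, non-decreasing, and there is $C<\infty$ with $|F(t)|\le C\exp(C|t|)$ and $|F'(t)|\le C\exp(C|t|)$ for all $t\in\mathbb{R}$. Framework: $d\in\mathbb{N}$; $Z$ is a zero-mean Gaussian process on $\mathbb{R}^d$ with stationary covariance function $k_Z$ that is sub-exponential and asymptotically positive; $T:\mathbb{R}\to\mathbb{R}$ is a fixed sub-exponential and non-decreasing function; $Y(s)=T(Z(s))$ is assumed to have zero mean, and $k_Y$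 is its stationary covariance function; $(s_i)_{i\in\mathbb{N}}$ is an asymptotically well-separated sequence in $\mathbb{R}^d$; $\Theta\subset\mathbb{R}^p$ is compact and $\{k_{Y,\theta};\theta\in\Theta\}$ is a family of stationary covariance functions on $\mathbb{R}^d$. (A) For all $s\in\mathbb{R}^d$, $k_{Y,\theta}(s)$ is three times continuously differentiable with respect to $\theta$, and there are constants $C<\infty$, $c>0$ such that for all $s\in\mathbb{R}^d$: $\sup_{\theta\in\Theta}|k_{Y,\theta}(s)|\le C\exp(-c|s|)$ and \[ \sup_{\theta\in\Theta,\ \ell\in\{1,2,3\},\ i_1,\ldots,i_\ell\in\{1,\ldots,p\}}\left|\frac{\partial^\ell k_{Y,\theta}(s)}{\partial\theta_{i_1}\cdots\partial\theta_{i_\ell}}\right|\le\frac{C}{1+|s|^{d+c}} . \] (B) The Fourier transform $\hat k_{Y,\theta}(f)$ of $k_{Y,\theta}$ is jointly continuous in $(\theta,f)$ and strictly positive on $\Theta\times\mathbb{R}^d$. (C) There exists $\theta_0$ in the interior of $\Theta$ such that $k_Y=k_{Y,\theta_0}$.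
   Formalization: In (A), three-times continuous differentiability in θ and the bounds on the partial derivatives are assumed on an open neighbourhood of Θ independent of s, not only on Θ; with bounds on Θ alone the claim can fail for irregular disconnected Θ. *)

theory Defs
  imports
    "HOL-Probability.Probability"
    "Jordan_Normal_Form.Char_Poly"
    "Jordan_Normal_Form.Gauss_Jordan_Elimination"
begin

hide_const (open) Determinants.det

text \<open>
  Points of the domain have type \<open>real ^ 'd\<close> and parameters have type \<open>real ^ 'p\<close>. The maximum norm
  is \<open>infnorm\<close>, the Euclidean norm is \<open>norm\<close>. Sequences of points are indexed from \<open>0\<close>, so that
  the first \<open>n\<close> points are those with index below \<open>n\<close>. Matrices and vectors of varying size \<open>n\<close>
  are those of \<open>Jordan_Normal_Form\<close>.
\<close>

subsection \<open>Covariance functions\<close>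

definition covariance_function :: "('a \<Rightarrow> 'a \<Rightarrow> real) \<Rightarrow> bool" where
  "covariance_function K \<longleftrightarrow>
     (\<forall>x y. K x y = K y x) \<and>
     (\<forall>A c. finite A \<longrightarrow> 0 \<le> (\<Sum>x\<in>A. \<Sum>y\<in>A. c x * c y * K x y))"

definition stationary_covariance :: "(real ^ 'd \<Rightarrow> real) \<Rightarrow> bool" where
  "stationary_covariance k \<longleftrightarrow> covariance_function (\<lambda>x y. k (x - y))"

definition well_separated :: "(nat \<Rightarrow> real ^ 'd) \<Rightarrow> bool" where
  "well_separated x \<longleftrightarrow> 0 < (INF (i, j)\<in>{(i, j). i \<noteq> j}. infnorm (x i - x j))"

definition cov_matrix :: "(real ^ 'd \<Rightarrow> real) \<Rightarrow> (nat \<Rightarrow> real ^ 'd) \<Rightarrow> nat \<Rightarrow> real mat" where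
  "cov_matrix k x n = Matrix.mat n n (\<lambda>(i, j). k (x i - x j))"

text \<open>Only used for symmetric matrices of positive size, which do have a real eigenvalue.\<close>

definition smallest_eigenvalue :: "real mat \<Rightarrow> real" where
  "smallest_eigenvalue A = Min {l. eigenvalue A l}"

definition subexp_asymp_positive :: "(real ^ 'd \<Rightarrow> real) \<Rightarrow> bool" where
  "subexp_asymp_positive k \<longleftrightarrow>
     stationary_covariance k \<and>
     (\<exists>C c. 0 < c \<and> (\<forall>s. \<bar>k s\<bar> \<le> C * exp (- c * infnorm s))) \<and>
     (\<forall>x. well_separated x \<longrightarrow>
        (\<exists>b>0. \<forall>n>0. b \<le> smallest_eigenvalue (cov_matrix k x n)))"

definition subexp_nondecreasing :: "(real \<Rightarrow> real) \<Rightarrow> bool" where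
  "subexp_nondecreasing F \<longleftrightarrow>
     (\<exists>t u. F t \<noteq> F u) \<and> F C1_differentiable_on UNIV \<and> mono F \<and>
     (\<exists>C. \<forall>t. \<bar>F t\<bar> \<le> C * exp (C * \<bar>t\<bar>) \<and> \<bar>deriv F t\<bar> \<le> C * exp (C * \<bar>t\<bar>))"


subsection \<open>Random processes\<close>

text \<open>Constants count as (degenerate) normal variables.\<close>

definition gaussian_variable :: "'w measure \<Rightarrow> ('w \<Rightarrow> real) \<Rightarrow> bool" where
  "gaussian_variable M X \<longleftrightarrow> X \<in> borel_measurable M \<and>
     (\<exists>\<mu>. (AE \<omega> in M. X \<omega> = \<mu>) \<or> (\<exists>\<sigma>>0. distributed M lborel X (normal_density \<mu> \<sigma>)))"

definition gaussian_process :: "'w measure \<Rightarrow> ('a \<Rightarrow> 'w \<Rightarrow> real) \<Rightarrow> bool" where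
  "gaussian_process M X \<longleftrightarrow>
     (\<forall>A c. finite A \<longrightarrow> gaussian_variable M (\<lambda>\<omega>. \<Sum>x\<in>A. c x * X x \<omega>))"

definition zero_mean_process :: "'w measure \<Rightarrow> ('a \<Rightarrow> 'w \<Rightarrow> real) \<Rightarrow> bool" where
  "zero_mean_process M X \<longleftrightarrow> (\<forall>x. integrable M (X x) \<and> integral\<^sup>L M (X x) = 0)"

definition covariance :: "'w measure \<Rightarrow> ('w \<Rightarrow> real) \<Rightarrow> ('w \<Rightarrow> real) \<Rightarrow> real" where
  "covariance M X Y =
     (\<integral>\<omega>. (X \<omega> - integral\<^sup>L M X) * (Y \<omega> - integral\<^sup>L M Y) \<partial>M)"

definition has_stationary_covariance ::
    "'w measure \<Rightarrow> (real ^ 'd \<Rightarrow> 'w \<Rightarrow> real) \<Rightarrow> (real ^ 'd \<Rightarrow> real) \<Rightarrow> bool" where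
  "has_stationary_covariance M X k \<longleftrightarrow>
     (\<forall>x. integrable M (\<lambda>\<omega>. (X x \<omega>)\<^sup>2)) \<and> (\<forall>x y. covariance M (X x) (X y) = k (x - y))"

definition tendsto_in_probability ::
    "'w measure \<Rightarrow> (nat \<Rightarrow> 'w \<Rightarrow> 'b::metric_space) \<Rightarrow> 'b \<Rightarrow> bool" where
  "tendsto_in_probability M X a \<longleftrightarrow>
     (\<forall>\<epsilon>>0. (\<lambda>n. measure M {\<omega> \<in> space M. \<epsilon> < dist (X n \<omega>) a}) \<longlonglongrightarrow> 0)"


subsection \<open>Conditions on the parametric family\<close>

definition partial_deriv :: "'p::finite \<Rightarrow> (real ^ 'p \<Rightarrow> real) \<Rightarrow> real ^ 'p \<Rightarrow> real" where
  "partial_deriv i g \<theta> = deriv (\<lambda>t. g (\<theta> + t *\<^sub>R axis i 1)) 0"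

definition iterated_partial ::
    "'p::finite list \<Rightarrow> (real ^ 'p \<Rightarrow> real) \<Rightarrow> real ^ 'p \<Rightarrow> real" where
  "iterated_partial is g = foldr partial_deriv is g"

text \<open>Meant for open sets.\<close>

fun times_cont_differentiable_on ::
    "nat \<Rightarrow> (real ^ 'p::finite \<Rightarrow> real) \<Rightarrow> (real ^ 'p) set \<Rightarrow> bool" where
  "times_cont_differentiable_on 0 g U \<longleftrightarrow> continuous_on U g"
| "times_cont_differentiable_on (Suc m) g U \<longleftrightarrow>
     g differentiable_on U \<and> (\<forall>i. times_cont_differentiable_on m (partial_deriv i g) U)"

text \<open>
  Since \<open>\<Theta>\<close> is compact, differentiability in \<open>\<theta>\<close> and the bounds on the derivatives are understood
  on some open neighbourhood \<open>U\<close> of \<open>\<Theta>\<close>, which does not depend on \<open>s\<close>. The values of \<open>K \<theta>\<close> for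
  \<open>\<theta>\<close> in \<open>U - \<Theta>\<close> are those of an arbitrary extension of the family and are not subject to any
  other condition. If the derivatives were bounded on \<open>\<Theta>\<close> only, then for a disconnected
  \<open>\<Theta>\<close> and kernels with a jump at the origin they would give no modulus of continuity in \<open>\<theta>\<close>
  that is uniform in \<open>s\<close>, and the maximum likelihood estimator can be inconsistent.
\<close>

definition regular_family :: "(real ^ 'p) set \<Rightarrow> (real ^ 'p \<Rightarrow> real ^ 'd \<Rightarrow> real) \<Rightarrow> bool" where
  "regular_family \<Theta> K \<longleftrightarrow>
     (\<exists>U C c. open U \<and> \<Theta> \<subseteq> U \<and> 0 < c \<and>
        (\<forall>s. times_cont_differentiable_on 3 (\<lambda>\<theta>. K \<theta> s) U) \<and>
        (\<forall>s. \<forall>\<theta>\<in>\<Theta>. \<bar>K \<theta> s\<bar> \<le> C * exp (- c * infnorm s)) \<and>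
        (\<forall>s. \<forall>\<theta>\<in>U. \<forall>is. length is \<in> {1, 2, 3} \<longrightarrow>
           \<bar>iterated_partial is (\<lambda>\<theta>. K \<theta> s) \<theta>\<bar>
             \<le> C / (1 + infnorm s powr (real CARD('d) + c))))"

definition fourier_transform :: "(real ^ 'd \<Rightarrow> real) \<Rightarrow> real ^ 'd \<Rightarrow> complex" where
  "fourier_transform h f =
     complex_of_real (1 / (2 * pi) ^ CARD('d)) *
     (\<integral>t. complex_of_real (h t) * exp (- (\<i> * complex_of_real (inner f t))) \<partial>lebesgue)"

text \<open>
  The Bochner integral of a non-integrable function is \<open>0\<close>, so strict positivity implies that
  each \<open>K \<theta>\<close> is integrable.
\<close>

definition positive_spectrum :: "(real ^ 'p) set \<Rightarrow> (real ^ 'p \<Rightarrow> real ^ 'd \<Rightarrow> real) \<Rightarrow> bool" where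
  "positive_spectrum \<Theta> K \<longleftrightarrow>
     continuous_on (\<Theta> \<times> UNIV) (\<lambda>(\<theta>, f). fourier_transform (K \<theta>) f) \<and>
     (\<forall>\<theta>\<in>\<Theta>. \<forall>f. fourier_transform (K \<theta>) f \<in> \<real> \<and> 0 < Re (fourier_transform (K \<theta>) f))"

text \<open>
  The infimum and the limit inferior are taken in the extended reals; the infimum over the
  empty set is \<open>\<infinity>\<close>.
\<close>

definition asymptotically_identifiable ::
    "(real ^ 'p) set \<Rightarrow> (real ^ 'p \<Rightarrow> real ^ 'd \<Rightarrow> real) \<Rightarrow> (nat \<Rightarrow> real ^ 'd) \<Rightarrow> real ^ 'p \<Rightarrow> bool" where
  "asymptotically_identifiable \<Theta> K s \<theta>0 \<longleftrightarrow>
     (\<forall>\<alpha>>0. 0 < liminf (\<lambda>n. INF \<theta>\<in>{\<theta> \<in> \<Theta>. \<alpha> \<le> norm (\<theta> - \<theta>0)}.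
        ereal (1 / real n * (\<Sum>i<n. \<Sum>j<n. (K \<theta> (s i - s j) - K \<theta>0 (s i - s j))\<^sup>2))))"


subsection \<open>The likelihood criterion\<close>

text \<open>
  \<open>mat_inverse\<close> returns \<open>Some\<close> of the inverse exactly for invertible matrices.
\<close>

definition ml_criterion ::
    "(real ^ 'p \<Rightarrow> real ^ 'd \<Rightarrow> real) \<Rightarrow> (nat \<Rightarrow> real ^ 'd) \<Rightarrow> nat \<Rightarrow> real Matrix.vec \<Rightarrow> real ^ 'p \<Rightarrow> real"
  where
  "ml_criterion K s n y \<theta> =
     (let R = cov_matrix (K \<theta>) s n
      in 1 / real n * (ln (Determinant.det R) + scalar_prod y (the (mat_inverse R) *\<^sub>v y)))"

end

theory Submission
  imports Defs "Jordan_Normal_Form.Schur_Decomposition"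
begin

text \<open>
  Write \<open>R\<^sub>\<theta>\<close> for the covariance matrix of the first \<open>n\<close> observations under \<open>\<theta>\<close>, and \<open>R\<^sub>0\<close> for the
  one under the true parameter. Then \<open>n (L\<^sub>\<theta> - L\<^sub>\<theta>\<^sub>0)\<close> is the sum of the deterministic quantity
  \<open>ln det R\<^sub>\<theta> - ln det R\<^sub>0 + tr (R\<^sub>\<theta>\<^sup>-\<^sup>1 R\<^sub>0) - n\<close> and of the fluctuations of \<open>y\<^sup>T R\<^sub>\<theta>\<^sup>-\<^sup>1 y\<close> and
  \<open>y\<^sup>T R\<^sub>0\<^sup>-\<^sup>1 y\<close> around their means \<open>tr (R\<^sub>\<theta>\<^sup>-\<^sup>1 R\<^sub>0)\<close> and \<open>n\<close>. The first part, twice a Gaussian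
  Kullback-Leibler divergence, dominates the squared Frobenius norm of \<open>R\<^sub>\<theta> - R\<^sub>0\<close>
  (\<open>gaussian_divergence_ge\<close>), which identifiability bounds below by a multiple of \<open>n\<close> away from
  \<open>\<theta>0\<close>. The fluctuations are of smaller order than \<open>n\<close>, uniformly in \<open>\<theta>\<close>. So with high probability
  no \<open>\<theta>\<close> far from \<open>\<theta>0\<close> can beat \<open>\<theta>0\<close>.

  Both parts require the eigenvalues of \<open>R\<^sub>\<theta>\<close> to lie between two positive constants, uniformly in \<open>n\<close>
  and \<open>\<theta>\<close>. The upper bound follows from exponential decay, because an exponential sum over separated
  points is bounded (\<open>separated_exp_sum_bounded\<close>). The lower bound comes from the spectral density
  (\<open>kernel_form_uniform_lower_bound\<close>). The kernels may jump at the origin, so their quadratic forms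
  are not given by Fourier inversion. But positive definiteness alone shows that
  \<open>t \<mapsto> \<Sum>i j. x\<^sub>i x\<^sub>j k (s\<^sub>i - s\<^sub>j + t)\<close> is maximal at \<open>0\<close>, and averaging this inequality against a Gaussian
  bounds the quadratic form below by an integral of the spectral density
  (\<open>spectral_representation_le\<close>). On a large ball that density is bounded below by compactness of
  \<open>\<Theta>\<close>, and a difference of two Gaussians supplies a test function below the indicator of the ball
  whose Fourier transform is nearly diagonal on separated points.

  The fluctuations concern \<open>Y = T \<circ> Z\<close>, which is not Gaussian. For trigonometric polynomials of a Gaussian
  vector all moments are explicit, and comparing them gives the Poincare inequality: the variance is
  at most the largest eigenvalue of the covariance times the mean squared gradient
  (\<open>gaussian_trig_poincare\<close>). If \<open>T\<close> is a trigonometric polynomial, the gradient of \<open>y\<^sup>T A y\<close> has mean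
  square of order \<open>n\<close>, hence the fluctuation has order \<open>sqrt n\<close>. A general \<open>T\<close> is approximated by
  trigonometric polynomials in the mean square of the law of \<open>Z\<close>; by stationarity one approximation
  serves all observations, and it changes \<open>y\<^sup>T A y\<close> by a small multiple of \<open>n\<close> in mean
  (\<open>quad_form_concentration\<close>). Uniformity in \<open>\<theta>\<close> follows by a finite net of \<open>\<Theta>\<close>, since \<open>R\<^sub>\<theta>\<close> is
  continuous in \<open>\<theta>\<close> in operator norm, uniformly in \<open>n\<close> (\<open>covariance_modulus\<close>).
\<close>

section \<open>Eigenvalues of products of positive semidefinite matrices\<close>

text \<open>
  Vectors are functions on \<open>nat\<close> of which only the entries below \<open>n\<close> count. They are paired with
  matrices of variable size, and this avoids conversions between the vectors of linear algebra
  and indexed families of random variables.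
\<close>

definition sqnorm :: "nat \<Rightarrow> (nat \<Rightarrow> real) \<Rightarrow> real" where
  "sqnorm n x = (\<Sum>i<n. (x i)\<^sup>2)"

definition matvec :: "nat \<Rightarrow> real mat \<Rightarrow> (nat \<Rightarrow> real) \<Rightarrow> nat \<Rightarrow> real" where
  "matvec n A x i = (\<Sum>j<n. A $$ (i, j) * x j)"

definition quad_form :: "nat \<Rightarrow> real mat \<Rightarrow> (nat \<Rightarrow> real) \<Rightarrow> real" where
  "quad_form n A x = (\<Sum>i<n. x i * matvec n A x i)"

definition mtrace :: "'a::comm_ring_1 mat \<Rightarrow> 'a" where
  "mtrace A = (\<Sum>i<dim_row A. A $$ (i, i))"

definition sym_mat :: "nat \<Rightarrow> real mat \<Rightarrow> bool" where
  "sym_mat n A \<longleftrightarrow> A \<in> carrier_mat n n \<and> (\<forall>i<n. \<forall>j<n. A $$ (i, j) = A $$ (j, i))"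

lemma index_mult_sum:
  assumes "A \<in> carrier_mat n n" "B \<in> carrier_mat n n" "i < n" "j < n"
  shows "(A * B) $$ (i, j) = (\<Sum>k<n. A $$ (i, k) * B $$ (k, j))"
  using assms by (auto simp: scalar_prod_def lessThan_atLeast0 intro!: sum.cong)

lemma mtrace_mult_comm:
  assumes "A \<in> carrier_mat n n" "B \<in> carrier_mat n n"
  shows "mtrace (A * B) = mtrace (B * A)"
proof -
  have "mtrace (A * B) = (\<Sum>i<n. \<Sum>k<n. A $$ (i, k) * B $$ (k, i))"
    unfolding mtrace_def using assms by (intro sum.cong index_mult_sum) auto
  also have "\<dots> = (\<Sum>k<n. \<Sum>i<n. A $$ (i, k) * B $$ (k, i))" by (rule sum.swap)
  also have "\<dots> = (\<Sum>k<n. \<Sum>i<n. B $$ (k, i) * A $$ (i, k))" by (simp add: mult.commute)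
  also have "\<dots> = mtrace (B * A)"
    unfolding mtrace_def using assms by (intro sum.cong index_mult_sum[symmetric]) auto
  finally show ?thesis .
qed

lemma mtrace_minus:
  assumes "A \<in> carrier_mat n n" "B \<in> carrier_mat n n"
  shows "mtrace (A - B) = mtrace A - mtrace B"
  using assms by (simp add: mtrace_def sum_subtractf)

lemma mtrace_smult:
  assumes "A \<in> carrier_mat n n"
  shows "mtrace (c \<cdot>\<^sub>m A) = c * mtrace A"
  using assms by (simp add: mtrace_def sum_distrib_left)

lemma mtrace_one: "mtrace (1\<^sub>m n :: 'a::comm_ring_1 mat) = of_nat n"
  by (simp add: mtrace_def)

lemma upper_triangular_square_diag:
  fixes B :: "'a::comm_ring_1 mat"
  assumes "B \<in> carrier_mat n n" "upper_triangular B" "i < n"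
  shows "(B * B) $$ (i, i) = (B $$ (i, i))\<^sup>2"
proof -
  have "(B * B) $$ (i, i) = (\<Sum>k<n. B $$ (i, k) * B $$ (k, i))"
    using assms by (intro index_mult_sum)
  also have "\<dots> = (\<Sum>k<n. if k = i then (B $$ (i, i))\<^sup>2 else 0)"
  proof (intro sum.cong refl)
    fix k assume k: "k \<in> {..<n}"
    have "k < i \<Longrightarrow> B $$ (i, k) = 0" using assms by auto
    moreover have "i < k \<Longrightarrow> B $$ (k, i) = 0" using assms k by auto
    ultimately show "B $$ (i, k) * B $$ (k, i) = (if k = i then (B $$ (i, i))\<^sup>2 else 0)"
      by (cases k i rule: linorder_cases) (auto simp: power2_eq_square)
  qed
  finally show ?thesis using assms by simp
qed

text \<open>
  Over the complex numbers a matrix is similar to an upper triangular one, and determinant, trace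
  and trace of the square can be read off its diagonal.
\<close>

lemma triangular_spectrum:
  fixes A :: "complex mat"
  assumes A: "A \<in> carrier_mat n n"
  obtains es where "length es = n" "\<And>e. e \<in> set es \<Longrightarrow> eigenvalue A e"
    "Determinant.det A = prod_list es" "mtrace A = sum_list es"
    "mtrace (A * A) = sum_list (map (\<lambda>e. e\<^sup>2) es)"
proof -
  from char_poly_factorized[OF A] obtain es where
    cp: "char_poly A = (\<Prod>a\<leftarrow>es. [:- a, 1:])" and len: "length es = n" by auto
  obtain B P Q where "schur_decomposition A es = (B, P, Q)" by (metis prod_cases3)
  from schur_decomposition[OF A cp this]
  have sim: "similar_mat_wit A B P Q" and ut: "upper_triangular B" and dg: "diag_mat B = es" by auto
  from similar_mat_witD2[OF A sim] have PQ: "P * Q = 1\<^sub>m n" "Q * P = 1\<^sub>m n" "A = P * B * Q"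
    and B: "B \<in> carrier_mat n n" and P: "P \<in> carrier_mat n n" and Q: "Q \<in> carrier_mat n n" by auto
  have tr: "mtrace (P * X * Q) = mtrace X" if X: "X \<in> carrier_mat n n" for X :: "complex mat"
  proof -
    have "mtrace (P * X * Q) = mtrace (Q * (P * X))"
      using P Q X by (intro mtrace_mult_comm[of _ n]) auto
    also have "Q * (P * X) = X"
      using P Q X PQ by (simp flip: assoc_mult_mat[of Q n n P n X n])
    finally show ?thesis .
  qed
  have AA: "A * A = P * (B * B) * Q"
  proof -
    have "A * A = P * B * (Q * (P * B * Q))"
      using PQ(3) P Q B by (simp add: assoc_mult_mat[of _ n n _ n _ n])
    also have "Q * (P * B * Q) = B * Q"
      using P Q B PQ(2) by (simp flip: assoc_mult_mat[of Q n n P n "B * Q" n] add: assoc_mult_mat[of P n n B n Q n])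
    finally show ?thesis using P Q B by (simp add: assoc_mult_mat[of _ n n _ n _ n])
  qed
  have es: "es = map (\<lambda>i. B $$ (i, i)) [0..<n]" using dg B by (auto simp: diag_mat_def)
  show ?thesis
  proof
    show "length es = n" by fact
    show "eigenvalue A e" if "e \<in> set es" for e
      using that cp linear_poly_root[of e es] by (simp add: eigenvalue_root_char_poly[OF A])
    show "Determinant.det A = prod_list es"
      using det_similar[of A B] sim det_upper_triangular[OF ut B] dg
      by (auto simp: similar_mat_def)
    show "mtrace A = sum_list es"
      using tr[OF B] PQ(3) B es by (simp add: mtrace_def interv_sum_list_conv_sum_set_nat lessThan_atLeast0)
    show "mtrace (A * A) = sum_list (map (\<lambda>e. e\<^sup>2) es)"
      using tr[of "B * B"] AA B es upper_triangular_square_diag[OF B ut]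
      by (simp add: mtrace_def interv_sum_list_conv_sum_set_nat lessThan_atLeast0 comp_def del: upper_triangularD)
  qed
qed

lemma quad_form_altdef: "quad_form n A x = (\<Sum>i<n. \<Sum>j<n. A $$ (i, j) * x i * x j)"
  by (simp add: quad_form_def matvec_def sum_distrib_left mult_ac)

lemma sqnorm_nonneg: "0 \<le> sqnorm n x"
  by (simp add: sqnorm_def sum_nonneg)

lemma sqnorm_eq_0_iff: "sqnorm n x = 0 \<longleftrightarrow> (\<forall>i<n. x i = 0)"
  by (auto simp: sqnorm_def sum_nonneg_eq_0_iff)

text \<open>
  For a real symmetric matrix the mixed terms between real and imaginary parts cancel.
\<close>

lemma hermitian_form:
  fixes z :: "nat \<Rightarrow> complex"
  assumes "sym_mat n S"
  shows "(\<Sum>i<n. cnj (z i) * (\<Sum>j<n. of_real (S $$ (i, j)) * z j)) =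
     of_real (quad_form n S (\<lambda>i. Re (z i)) + quad_form n S (\<lambda>i. Im (z i)))"
proof (rule complex_eqI)
  let ?a = "\<lambda>i. Re (z i)" and ?b = "\<lambda>i. Im (z i)"
  show "Re (\<Sum>i<n. cnj (z i) * (\<Sum>j<n. of_real (S $$ (i, j)) * z j)) =
     Re (of_real (quad_form n S ?a + quad_form n S ?b))"
    by (simp add: quad_form_def matvec_def sum.distrib)
  have "(\<Sum>i<n. ?a i * (\<Sum>j<n. S $$ (i, j) * ?b j)) = (\<Sum>i<n. ?b i * (\<Sum>j<n. S $$ (i, j) * ?a j))"
    (is "?l = ?r")
  proof -
    have "?l = (\<Sum>i<n. \<Sum>j<n. S $$ (i, j) * ?a i * ?b j)"
      by (simp add: sum_distrib_left mult_ac)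
    also have "\<dots> = (\<Sum>j<n. \<Sum>i<n. S $$ (i, j) * ?a i * ?b j)" by (rule sum.swap)
    also have "\<dots> = (\<Sum>j<n. \<Sum>i<n. S $$ (j, i) * ?a i * ?b j)"
      using assms by (intro sum.cong refl) (auto simp: sym_mat_def)
    also have "\<dots> = ?r" by (simp add: sum_distrib_left mult_ac)
    finally show ?thesis .
  qed
  then show "Im (\<Sum>i<n. cnj (z i) * (\<Sum>j<n. of_real (S $$ (i, j)) * z j)) =
     Im (of_real (quad_form n S ?a + quad_form n S ?b))"
    by (simp add: sum_subtractf)
qed

text \<open>
  A product \<open>P Q\<close> is not symmetric, yet its eigenvalues are real: if \<open>P Q v = e v\<close> and \<open>w = Q v\<close>, then
  \<open>w\<^sup>* P w = e v\<^sup>* Q v\<close>, so that \<open>e\<close> is a quotient of values of the two forms. This quotient also gives the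
  upper bound on \<open>e\<close>.
\<close>

lemma spectrum_of_psd_product:
  fixes P Q :: "real mat"
  assumes P: "sym_mat n P" and Q: "sym_mat n Q"
    and P0: "\<And>x. 0 \<le> quad_form n P x"
    and Q0: "\<And>x. q * sqnorm n x \<le> quad_form n Q x" "0 < q"
  obtains es :: "real list" where "length es = n" "\<And>e. e \<in> set es \<Longrightarrow> 0 \<le> e"
    "Determinant.det (P * Q) = prod_list es" "mtrace (P * Q) = sum_list es"
    "mtrace ((P * Q) * (P * Q)) = sum_list (map (\<lambda>e. e\<^sup>2) es)"
    "\<And>p L e. e \<in> set es \<Longrightarrow> 0 \<le> p \<Longrightarrow> (\<And>x. quad_form n P x \<le> p * sqnorm n x) \<Longrightarrow>
       (\<And>x. sqnorm n (matvec n Q x) \<le> L * sqnorm n x) \<Longrightarrow> e \<le> p * L / q"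
proof -
  let ?c = "map_mat complex_of_real"
  have Pc: "P \<in> carrier_mat n n" and Qc: "Q \<in> carrier_mat n n"
    using P Q by (auto simp: sym_mat_def)
  define A where "A = ?c (P * Q)"
  have A: "A \<in> carrier_mat n n" using Pc Qc by (auto simp: A_def)
  from triangular_spectrum[OF A] obtain es where
    es: "length es = n" "\<And>e. e \<in> set es \<Longrightarrow> eigenvalue A e"
    "Determinant.det A = prod_list es" "mtrace A = sum_list es"
    "mtrace (A * A) = sum_list (map (\<lambda>e. e\<^sup>2) es)" by metis
  have eig: "\<exists>v. (\<exists>i<n. v i \<noteq> (0::complex)) \<and> (\<forall>i<n. (\<Sum>j<n. of_real (P $$ (i, j)) *
       (\<Sum>k<n. of_real (Q $$ (j, k)) * v k)) = e * v i)" if e: "e \<in> set es" for e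
  proof -
    from es(2)[OF e] obtain v where v: "v \<in> carrier_vec n" "v \<noteq> 0\<^sub>v n" "A *\<^sub>v v = e \<cdot>\<^sub>v v"
      using A unfolding eigenvalue_def eigenvector_def by auto
    have "\<exists>i<n. v $ i \<noteq> 0" using v(1,2) by (metis carrier_vecD eq_vecI index_zero_vec(1) index_zero_vec(2))
    moreover have "(\<Sum>j<n. of_real (P $$ (i, j)) * (\<Sum>k<n. of_real (Q $$ (j, k)) * v $ k)) = e * v $ i"
      if i: "i < n" for i
    proof -
      have "e * v $ i = (A *\<^sub>v v) $ i" using v i by simp
      also have "\<dots> = (\<Sum>k<n. A $$ (i, k) * v $ k)"
        using A v(1) i by (auto simp: scalar_prod_def lessThan_atLeast0 intro!: sum.cong)
      also have "\<dots> = (\<Sum>k<n. \<Sum>j<n. of_real (P $$ (i, j)) * of_real (Q $$ (j, k)) * v $ k)"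
        using Pc Qc i by (intro sum.cong refl)
          (simp add: A_def index_mult_sum[of P n Q] sum_distrib_right del: index_mult_mat(1))
      also have "\<dots> = (\<Sum>j<n. \<Sum>k<n. of_real (P $$ (i, j)) * of_real (Q $$ (j, k)) * v $ k)"
        by (rule sum.swap)
      finally show ?thesis by (simp add: sum_distrib_left mult_ac)
    qed
    ultimately show ?thesis by (intro exI[of _ "\<lambda>i. v $ i"]) auto
  qed
  have main: "\<exists>r. e = of_real r \<and> 0 \<le> r \<and> (\<forall>p L. 0 \<le> p \<longrightarrow> (\<forall>x. quad_form n P x \<le> p * sqnorm n x) \<longrightarrow>
       (\<forall>x. sqnorm n (matvec n Q x) \<le> L * sqnorm n x) \<longrightarrow> r \<le> p * L / q)" if e: "e \<in> set es" for e
  proof -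
    from eig[OF e] obtain v where v0: "\<exists>i<n. v i \<noteq> (0::complex)"
      and v: "\<And>i. i < n \<Longrightarrow> (\<Sum>j<n. of_real (P $$ (i, j)) * (\<Sum>k<n. of_real (Q $$ (j, k)) * v k)) = e * v i"
      by blast
    let ?a = "\<lambda>i. Re (v i)" and ?b = "\<lambda>i. Im (v i)"
    define w where "w = (\<lambda>j. \<Sum>k<n. of_real (Q $$ (j, k)) * v k)"
    have Rw: "(\<lambda>i. Re (w i)) = matvec n Q ?a" "(\<lambda>i. Im (w i)) = matvec n Q ?b"
      by (auto simp: w_def matvec_def fun_eq_iff)
    define \<alpha> where "\<alpha> = quad_form n P (matvec n Q ?a) + quad_form n P (matvec n Q ?b)"
    define \<beta> where "\<beta> = quad_form n Q ?a + quad_form n Q ?b"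
    have "of_real \<alpha> = (\<Sum>i<n. cnj (w i) * (\<Sum>j<n. of_real (P $$ (i, j)) * w j))"
      unfolding hermitian_form[OF P] \<alpha>_def Rw by simp
    also have "\<dots> = (\<Sum>i<n. cnj (w i) * (e * v i))"
      using v by (intro sum.cong refl) (simp add: w_def)
    also have "\<dots> = e * cnj (\<Sum>i<n. cnj (v i) * w i)"
      by (simp add: sum_distrib_left mult_ac)
    also have "(\<Sum>i<n. cnj (v i) * w i) = of_real \<beta>"
      unfolding w_def hermitian_form[OF Q] \<beta>_def by simp
    finally have ab: "of_real \<alpha> = e * of_real \<beta>" by simp
    define N where "N = sqnorm n ?a + sqnorm n ?b"
    have Npos: "0 < N"
    proof -
      have "sqnorm n ?a \<noteq> 0 \<or> sqnorm n ?b \<noteq> 0"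
        using v0 by (auto simp: sqnorm_eq_0_iff complex_eq_iff)
      then show ?thesis using sqnorm_nonneg[of n ?a] sqnorm_nonneg[of n ?b] by (auto simp: N_def)
    qed
    have b: "q * N \<le> \<beta>" using Q0(1)[of ?a] Q0(1)[of ?b] by (simp add: \<beta>_def N_def algebra_simps)
    have bpos: "0 < \<beta>" using b Npos Q0(2) by (metis less_le_trans mult_pos_pos)
    have a: "0 \<le> \<alpha>" using P0 by (simp add: \<alpha>_def)
    have "e = of_real (\<alpha> / \<beta>)" using ab bpos by (simp add: field_simps)
    moreover have "\<alpha> / \<beta> \<le> p * L / q" if "0 \<le> p" "\<forall>x. quad_form n P x \<le> p * sqnorm n x"
       "\<forall>x. sqnorm n (matvec n Q x) \<le> L * sqnorm n x" for p L
    proof -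
      have "\<alpha> \<le> p * sqnorm n (matvec n Q ?a) + p * sqnorm n (matvec n Q ?b)"
        using that(2) by (auto simp: \<alpha>_def intro!: add_mono)
      also have "\<dots> \<le> p * (L * sqnorm n ?a) + p * (L * sqnorm n ?b)"
        using that by (intro add_mono mult_left_mono) auto
      also have "\<dots> = p * L * N" by (simp add: N_def algebra_simps)
      finally have al: "\<alpha> \<le> p * L * N" .
      then have "0 \<le> p * L * N" using a by linarith
      then have pL: "0 \<le> p * L" using Npos by (simp add: zero_le_mult_iff)
      have "\<alpha> / \<beta> \<le> (p * L * N) / (q * N)"
        using al b Npos Q0(2) a by (intro frac_le) (auto intro!: mult_nonneg_nonneg simp: \<open>0 \<le> p * L * N\<close>)
      then show ?thesis using Npos by simp
    qed
    ultimately show ?thesis using a bpos by (intro exI[of _ "\<alpha> / \<beta>"]) auto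
  qed
  define rs where "rs = map Re es"
  have esrs: "es = map complex_of_real rs"
  proof -
    have "map (complex_of_real \<circ> Re) es = es" using main by (intro map_idI) force
    then show ?thesis by (simp add: rs_def)
  qed
  have sumr: "sum_list (map complex_of_real xs) = of_real (sum_list xs)"
    "prod_list (map complex_of_real xs) = of_real (prod_list xs)" for xs
    by (induction xs) auto
  have trc: "mtrace (?c X) = of_real (mtrace X)" if "X \<in> carrier_mat n n" for X
    using that by (simp add: mtrace_def)
  show ?thesis
  proof
    show "length rs = n" using es(1) by (simp add: rs_def)
    show "0 \<le> e" if "e \<in> set rs" for e using that main by (force simp: rs_def)
    have "complex_of_real (Determinant.det (P * Q)) = of_real (prod_list rs)"
      using es(3) sumr(2)[of rs] esrs by (simp add: A_def of_real_hom.hom_det)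
    then show "Determinant.det (P * Q) = prod_list rs" by (simp only: of_real_eq_iff)
    have "complex_of_real (mtrace (P * Q)) = of_real (sum_list rs)"
      using es(4) sumr(1)[of rs] esrs trc[of "P * Q"] Pc Qc by (simp add: A_def)
    then show "mtrace (P * Q) = sum_list rs" by (simp only: of_real_eq_iff)
    have "complex_of_real (mtrace ((P * Q) * (P * Q))) = mtrace (A * A)"
    proof -
      have PQ: "P * Q \<in> carrier_mat n n" using Pc Qc by simp
      show ?thesis
        using trc[OF mult_carrier_mat[OF PQ PQ]] of_real_hom.mat_hom_mult[OF PQ PQ]
        unfolding A_def by metis
    qed
    also have "\<dots> = sum_list (map (\<lambda>e. e\<^sup>2) (map complex_of_real rs))" using es(5) esrs by simp
    also have "\<dots> = of_real (sum_list (map (\<lambda>e. e\<^sup>2) rs))"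
      unfolding sumr(1)[symmetric] by (simp add: comp_def)
    finally show "mtrace ((P * Q) * (P * Q)) = sum_list (map (\<lambda>e. e\<^sup>2) rs)"
      by (simp only: of_real_eq_iff)
    show "e \<le> p * L / q" if "e \<in> set rs" "0 \<le> p" "\<And>x. quad_form n P x \<le> p * sqnorm n x"
       "\<And>x. sqnorm n (matvec n Q x) \<le> L * sqnorm n x" for p L e
      using that main by (force simp: rs_def)
  qed
qed

section \<open>Gaussian divergence and Frobenius distance\<close>

lemma sym_mat_transpose: "sym_mat n A \<longleftrightarrow> A \<in> carrier_mat n n \<and> transpose_mat A = A"
proof
  assume "sym_mat n A"
  then show "A \<in> carrier_mat n n \<and> transpose_mat A = A"
    by (auto simp: sym_mat_def intro!: eq_matI)
next
  assume A: "A \<in> carrier_mat n n \<and> transpose_mat A = A"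
  have "A $$ (i, j) = A $$ (j, i)" if "i < n" "j < n" for i j
    using A that by (metis carrier_matD index_transpose_mat(1))
  then show "sym_mat n A" using A by (simp add: sym_mat_def)
qed

lemma matvec_mult:
  assumes "A \<in> carrier_mat n n" "B \<in> carrier_mat n n" "i < n"
  shows "matvec n (A * B) x i = matvec n A (matvec n B x) i"
proof -
  have "matvec n (A * B) x i = (\<Sum>j<n. \<Sum>k<n. A $$ (i, k) * B $$ (k, j) * x j)"
    unfolding matvec_def using assms
    by (intro sum.cong refl) (simp add: index_mult_sum[of A n B] sum_distrib_right del: index_mult_mat(1))
  also have "\<dots> = (\<Sum>k<n. \<Sum>j<n. A $$ (i, k) * B $$ (k, j) * x j)" by (rule sum.swap)
  finally show ?thesis by (simp add: matvec_def sum_distrib_left mult_ac)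
qed

lemma matvec_one: "i < n \<Longrightarrow> matvec n (1\<^sub>m n) x i = x i"
  by (simp add: matvec_def if_distrib[of "\<lambda>u. u * _"] cong: if_cong)

lemma sqnorm_cong: "(\<And>j. j < n \<Longrightarrow> x j = y j) \<Longrightarrow> sqnorm n x = sqnorm n y"
  by (simp add: sqnorm_def)

lemma inner_square_le:
  "(\<Sum>i<n. x i * y i)\<^sup>2 \<le> sqnorm n x * sqnorm n y"
  unfolding sqnorm_def by (rule Cauchy_Schwarz_ineq_sum)

lemma matvec_symmetric:
  assumes "sym_mat n A"
  shows "(\<Sum>i<n. x i * matvec n A y i) = (\<Sum>i<n. matvec n A x i * y i)"
proof -
  have "(\<Sum>i<n. x i * matvec n A y i) = (\<Sum>i<n. \<Sum>j<n. A $$ (i, j) * x i * y j)"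
    by (simp add: matvec_def sum_distrib_left mult_ac)
  also have "\<dots> = (\<Sum>j<n. \<Sum>i<n. A $$ (i, j) * x i * y j)" by (rule sum.swap)
  also have "\<dots> = (\<Sum>j<n. \<Sum>i<n. A $$ (j, i) * x i * y j)"
    using assms by (intro sum.cong refl) (auto simp: sym_mat_def)
  also have "\<dots> = (\<Sum>i<n. matvec n A x i * y i)"
    by (simp add: matvec_def sum_distrib_right)
  finally show ?thesis .
qed

lemma prod_list_nonneg: "(\<And>e. e \<in> set es \<Longrightarrow> 0 \<le> e) \<Longrightarrow> 0 \<le> prod_list (es :: real list)"
  by (induction es) auto

lemma prod_list_pos_imp:
  "(\<And>e. e \<in> set es \<Longrightarrow> 0 \<le> e) \<Longrightarrow> prod_list es \<noteq> 0 \<Longrightarrow> e \<in> set es \<Longrightarrow> 0 < (e :: real)"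
  by (induction es) (auto simp: less_le)

lemma quad_form_one: "quad_form n (1\<^sub>m n) x = sqnorm n x"
  by (simp add: quad_form_def sqnorm_def matvec_one power2_eq_square)

text \<open>
  All bounds on the inverse come from the substitution \<open>v = S x\<close>, that is \<open>x = R v\<close>, and from the
  Cauchy-Schwarz inequality.
\<close>

lemma spd_inverse:
  assumes R: "sym_mat n R" and b: "0 < b" and Rb: "\<And>x. b * sqnorm n x \<le> quad_form n R x"
  obtains S where "mat_inverse R = Some S" "sym_mat n S" "R * S = 1\<^sub>m n" "S * R = 1\<^sub>m n"
    "0 < Determinant.det R"
    "\<And>x. b\<^sup>2 * sqnorm n (matvec n S x) \<le> sqnorm n x"
    "\<And>x. 0 \<le> quad_form n S x"
    "\<And>x. quad_form n S x \<le> 1 / b * sqnorm n x"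
    "\<And>x L. 0 < L \<Longrightarrow> (\<And>x. sqnorm n (matvec n R x) \<le> L * sqnorm n x) \<Longrightarrow>
       b / L * sqnorm n x \<le> quad_form n S x"
proof -
  have Rc: "R \<in> carrier_mat n n" using R by (simp add: sym_mat_def)
  have det0: "Determinant.det R \<noteq> 0"
  proof
    assume "Determinant.det R = 0"
    then obtain v where v: "v \<in> carrier_vec n" "v \<noteq> 0\<^sub>v n" "R *\<^sub>v v = 0\<^sub>v n"
      using det_0_iff_vec_prod_zero[OF Rc] by auto
    have "matvec n R (\<lambda>i. v $ i) i = (R *\<^sub>v v) $ i" if "i < n" for i
      using that Rc v(1) by (auto simp: matvec_def scalar_prod_def lessThan_atLeast0 intro!: sum.cong)
    then have "quad_form n R (\<lambda>i. v $ i) = 0" using v(3) by (simp add: quad_form_def)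
    then have "sqnorm n (\<lambda>i. v $ i) = 0"
      using Rb[of "\<lambda>i. v $ i"] b sqnorm_nonneg[of n "\<lambda>i. v $ i"] by (simp add: mult_le_0_iff)
    then show False using v(1,2) by (auto simp: sqnorm_eq_0_iff intro!: eq_vecI)
  qed
  have "R \<in> Units (ring_mat TYPE(real) n ())" by (rule det_non_zero_imp_unit[OF Rc det0])
  then obtain S where S: "mat_inverse R = Some S"
    using mat_inverse(1)[OF Rc, of "()"] by (cases "mat_inverse R") auto
  have RS: "R * S = 1\<^sub>m n" "S * R = 1\<^sub>m n" and Sc: "S \<in> carrier_mat n n"
    using mat_inverse(2)[OF Rc S] by auto
  have tS: "transpose_mat S = S"
  proof -
    have "transpose_mat S * R = transpose_mat (R * S)"
      using R transpose_mult[OF Rc Sc] by (simp add: sym_mat_transpose)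
    then have "transpose_mat S * R = 1\<^sub>m n" using RS by simp
    then have "transpose_mat S * R * S = S" using Sc by simp
    then show ?thesis using RS(1) Rc Sc by (simp add: assoc_mult_mat[of _ n n _ n _ n])
  qed
  have symS: "sym_mat n S" using tS Sc by (simp add: sym_mat_transpose)
  have RSx: "matvec n R (matvec n S x) i = x i" if "i < n" for x i
    using that Rc Sc RS by (simp flip: matvec_mult add: matvec_one)
  have qS: "quad_form n S x = quad_form n R (matvec n S x)" for x
    unfolding quad_form_def by (intro sum.cong refl) (simp add: RSx)
  have dpos: "0 < Determinant.det R"
  proof -
    have one: "sym_mat n (1\<^sub>m n)" by (simp add: sym_mat_def)
    obtain es where es: "\<And>e. e \<in> set es \<Longrightarrow> (0::real) \<le> e" "Determinant.det (1\<^sub>m n * R) = prod_list es"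
      using spectrum_of_psd_product[OF one R _ Rb b] by (metis quad_form_one sqnorm_nonneg)
    then show ?thesis using prod_list_nonneg[of es] det0 Rc by (simp add: less_le)
  qed
  have lowS: "b * sqnorm n (matvec n S x) \<le> quad_form n S x" for x
    using Rb[of "matvec n S x"] by (simp add: qS)
  have csS: "(quad_form n S x)\<^sup>2 \<le> sqnorm n x * sqnorm n (matvec n S x)" for x
    unfolding quad_form_def by (rule inner_square_le)
  have S2: "b\<^sup>2 * sqnorm n (matvec n S x) \<le> sqnorm n x" for x
  proof (cases "sqnorm n (matvec n S x) = 0")
    case False
    then have p: "0 < sqnorm n (matvec n S x)" using sqnorm_nonneg by (simp add: less_le)
    have "(b * sqnorm n (matvec n S x))\<^sup>2 \<le> (quad_form n S x)\<^sup>2"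
      using lowS b p by (intro power_mono) auto
    also have "\<dots> \<le> sqnorm n x * sqnorm n (matvec n S x)" by (rule csS)
    finally have "(b\<^sup>2 * sqnorm n (matvec n S x)) * sqnorm n (matvec n S x) \<le> sqnorm n x * sqnorm n (matvec n S x)"
      by (simp add: power2_eq_square mult_ac)
    then show ?thesis using p by simp
  qed (simp add: sqnorm_nonneg)
  show ?thesis
  proof
    show "0 \<le> quad_form n S x" for x
      using lowS[of x] b sqnorm_nonneg[of n "matvec n S x"] by (meson mult_nonneg_nonneg less_imp_le order_trans)
    show "quad_form n S x \<le> 1 / b * sqnorm n x" for x
    proof (rule power2_le_imp_le)
      have "(quad_form n S x)\<^sup>2 \<le> sqnorm n x * sqnorm n (matvec n S x)" by (rule csS)
      also have "\<dots> \<le> sqnorm n x * (sqnorm n x / b\<^sup>2)"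
        using S2[of x] b sqnorm_nonneg by (intro mult_left_mono) (simp_all add: field_simps)
      finally show "(quad_form n S x)\<^sup>2 \<le> (1 / b * sqnorm n x)\<^sup>2"
        by (simp add: power2_eq_square)
    qed (use b sqnorm_nonneg in auto)
    show "b / L * sqnorm n x \<le> quad_form n S x"
      if L: "0 < L" "\<And>x. sqnorm n (matvec n R x) \<le> L * sqnorm n x" for x L
    proof -
      have "sqnorm n x = sqnorm n (matvec n R (matvec n S x))"
        by (rule sqnorm_cong) (simp add: RSx)
      also have "\<dots> \<le> L * sqnorm n (matvec n S x)" by (rule L)
      finally have "b / L * sqnorm n x \<le> b / L * (L * sqnorm n (matvec n S x))"
        using b L(1) by (intro mult_left_mono) auto
      then show ?thesis using lowS[of x] L(1) by simp
    qed
  qed fact+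
qed

lemma matvec_minus:
  "A \<in> carrier_mat n n \<Longrightarrow> B \<in> carrier_mat n n \<Longrightarrow> i < n \<Longrightarrow>
     matvec n (A - B) x i = matvec n A x i - matvec n B x i"
  by (simp add: matvec_def sum_subtractf left_diff_distrib)

text \<open>
  With \<open>P = D M D\<close> positive semidefinite and \<open>M - (m/2) I\<close> positive definite, the product of the two
  has nonnegative eigenvalues and hence nonnegative trace. So \<open>tr (M D M D)\<close> is at least \<open>m/2\<close> times
  \<open>tr P\<close>, and the diagonal of \<open>P\<close> consists of values of the form of \<open>M\<close> at the columns of \<open>D\<close>.
\<close>

lemma trace_psd_product_ge:
  assumes M: "sym_mat n M" and D: "sym_mat n D" and m: "0 < m"
    and Mm: "\<And>x. m * sqnorm n x \<le> quad_form n M x"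
  shows "m\<^sup>2 / 2 * (\<Sum>i<n. \<Sum>j<n. (D $$ (i, j))\<^sup>2) \<le> mtrace (M * D * (M * D))"
proof -
  have Mc: "M \<in> carrier_mat n n" and Dc: "D \<in> carrier_mat n n" using M D by (auto simp: sym_mat_def)
  define P where "P = D * M * D"
  have Pc: "P \<in> carrier_mat n n" using Mc Dc by (simp add: P_def)
  have symP: "sym_mat n P"
    using M D Mc Dc by (simp add: sym_mat_transpose P_def transpose_mult[of _ n n _ n] assoc_mult_mat[of _ n n _ n _ n])
  have qP: "quad_form n P x = quad_form n M (matvec n D x)" for x
  proof -
    have "quad_form n P x = (\<Sum>i<n. x i * matvec n D (matvec n (M * D) x) i)"
      unfolding quad_form_def P_def using Mc Dc
      by (intro sum.cong refl) (simp add: matvec_mult assoc_mult_mat[of _ n n _ n _ n])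
    also have "\<dots> = (\<Sum>i<n. matvec n D x i * matvec n (M * D) x i)" by (rule matvec_symmetric[OF D])
    also have "\<dots> = quad_form n M (matvec n D x)"
      unfolding quad_form_def using Mc Dc by (intro sum.cong refl) (simp add: matvec_mult)
    finally show ?thesis .
  qed
  have P0: "0 \<le> quad_form n P x" for x
    using Mm[of "matvec n D x"] m sqnorm_nonneg[of n "matvec n D x"] unfolding qP
    by (meson mult_nonneg_nonneg less_imp_le order_trans)
  define Q where "Q = M - (m / 2) \<cdot>\<^sub>m 1\<^sub>m n"
  have Qc: "Q \<in> carrier_mat n n" unfolding Q_def by (rule minus_carrier_mat) simp
  have symQ: "sym_mat n Q" using M Qc by (auto simp: sym_mat_def Q_def)
  have mvI: "matvec n ((m / 2) \<cdot>\<^sub>m 1\<^sub>m n) x i = m / 2 * x i" if "i < n" for x i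
  proof -
    have "matvec n ((m / 2) \<cdot>\<^sub>m 1\<^sub>m n) x i = (\<Sum>j<n. m / 2 * (1\<^sub>m n $$ (i, j) * x j))"
      unfolding matvec_def using that by (intro sum.cong refl) simp
    also have "\<dots> = m / 2 * matvec n (1\<^sub>m n) x i" by (simp only: matvec_def sum_distrib_left)
    finally show ?thesis using that by (simp add: matvec_one)
  qed
  have qQ: "quad_form n Q x = quad_form n M x - m / 2 * sqnorm n x" for x
    unfolding quad_form_def sqnorm_def Q_def using Mc
    by (simp add: matvec_minus mvI right_diff_distrib sum_subtractf sum_distrib_left power2_eq_square mult_ac)
  have Q0: "m / 2 * sqnorm n x \<le> quad_form n Q x" for x using Mm[of x] by (simp add: qQ)
  have "0 \<le> mtrace (P * Q)"
  proof -
    obtain es where "\<And>e. e \<in> set es \<Longrightarrow> (0::real) \<le> e" "mtrace (P * Q) = sum_list es"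
      using spectrum_of_psd_product[OF symP symQ P0 Q0] m by (metis half_gt_zero)
    then show ?thesis by (simp add: sum_list_nonneg)
  qed
  moreover have "P * Q = P * M - (m / 2) \<cdot>\<^sub>m P"
    using Pc Mc by (simp add: Q_def mult_minus_distrib_mat[of P n n M n] mult_smult_distrib[of P n n _ n])
  ultimately have 1: "m / 2 * mtrace P \<le> mtrace (P * M)"
    using Pc Mc by (simp add: mtrace_minus[of _ n] mtrace_smult[of P n])
  have "mtrace (P * M) = mtrace (M * D * (M * D))"
  proof -
    have "mtrace (P * M) = mtrace (M * P)" by (rule mtrace_mult_comm[OF Pc Mc])
    also have "M * P = M * D * (M * D)" using Mc Dc by (simp add: P_def assoc_mult_mat[of _ n n _ n _ n])
    finally show ?thesis .
  qed
  moreover have "m * (\<Sum>i<n. \<Sum>j<n. (D $$ (i, j))\<^sup>2) \<le> mtrace P"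
  proof -
    let ?e = "\<lambda>i j. if j = i then 1 else (0::real)"
    have "P $$ (i, i) = quad_form n P (?e i)" if "i < n" for i
      using that by (simp add: quad_form_def matvec_def if_distrib[of "\<lambda>u. u * _"] if_distrib[of "\<lambda>u. _ * u"] cong: if_cong)
    moreover have "m * (\<Sum>j<n. (D $$ (i, j))\<^sup>2) \<le> quad_form n P (?e i)" if "i < n" for i
    proof -
      have "matvec n D (?e i) j = D $$ (i, j)" if "j < n" for j
        using that \<open>i < n\<close> D by (simp add: matvec_def sym_mat_def if_distrib[of "\<lambda>u. _ * u"] cong: if_cong)
      then have "sqnorm n (matvec n D (?e i)) = (\<Sum>j<n. (D $$ (i, j))\<^sup>2)" by (simp add: sqnorm_def)
      then show ?thesis using Mm[of "matvec n D (?e i)"] by (simp add: qP)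
    qed
    ultimately show ?thesis using Pc by (auto simp: mtrace_def sum_distrib_left intro!: sum_mono)
  qed
  then have "m / 2 * (m * (\<Sum>i<n. \<Sum>j<n. (D $$ (i, j))\<^sup>2)) \<le> m / 2 * mtrace P"
    using m by (intro mult_left_mono) auto
  ultimately show ?thesis using 1 by (simp add: power2_eq_square)
qed

text \<open>
  The two sides agree at \<open>1\<close>, and the derivative of their difference is \<open>(u - 1) (1/u - 1/C\<^sup>2)\<close>, which has
  the sign of \<open>u - 1\<close> on \<open>(0, C]\<close>.
\<close>

lemma ln_le_minus_square:
  fixes u :: real
  assumes "0 < u" "u \<le> C" "1 \<le> C"
  shows "(u - 1)\<^sup>2 / (2 * C\<^sup>2) \<le> u - 1 - ln u"
proof -
  define k where "k = 1 / (2 * C\<^sup>2)"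
  define f where "f = (\<lambda>u::real. u - 1 - ln u - k * (u - 1)\<^sup>2)"
  have d: "(f has_real_derivative (x - 1) * (1 / x - 2 * k)) (at x)" if "0 < x" for x
  proof -
    have "(f has_real_derivative (1 - 1 / x - 2 * k * (x - 1))) (at x)"
      unfolding f_def using that by (auto intro!: derivative_eq_intros)
    also have "1 - 1 / x - 2 * k * (x - 1) = (x - 1) * (1 / x - 2 * k)"
      using that by (simp add: field_simps)
    finally show ?thesis .
  qed
  have s: "0 \<le> 1 / x - 2 * k" if "0 < x" "x \<le> C" for x
  proof -
    have "C * 1 \<le> C * C" using assms by (intro mult_left_mono) auto
    then have "x \<le> C * C" using that by linarith
    then have "1 / (C * C) \<le> 1 / x" using that by (intro divide_left_mono) auto
    then show ?thesis by (simp add: k_def power2_eq_square)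
  qed
  have f1: "f 1 = 0" by (simp add: f_def)
  have "f 1 \<le> f u"
  proof (cases "u \<le> 1")
    case True
    show ?thesis
      using True
    proof (rule DERIV_nonpos_imp_nonincreasing)
      fix x assume x: "u \<le> x" "x \<le> 1"
      have "(x - 1) * (1 / x - 2 * k) \<le> 0" using s[of x] x assms by (intro mult_nonpos_nonneg) auto
      then show "\<exists>y. (f has_real_derivative y) (at x) \<and> y \<le> 0" using d[of x] x assms by force
    qed
  next
    case False
    then have "1 \<le> u" by simp
    then show ?thesis
    proof (rule DERIV_nonneg_imp_nondecreasing)
      fix x assume x: "1 \<le> x" "x \<le> u"
      have "0 \<le> (x - 1) * (1 / x - 2 * k)" using s[of x] x assms by (intro mult_nonneg_nonneg) auto
      then show "\<exists>y. (f has_real_derivative y) (at x) \<and> 0 \<le> y" using d[of x] x assms by force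
    qed
  qed
  then show ?thesis unfolding f1 by (simp add: f_def k_def)
qed

lemma ln_prod_list:
  "(\<And>e. e \<in> set es \<Longrightarrow> 0 < e) \<Longrightarrow>
     0 < prod_list es \<and> ln (prod_list es) = sum_list (map ln (es :: real list))"
  by (induction es) (auto simp: ln_mult_pos)

definition divergence_const :: "real \<Rightarrow> real \<Rightarrow> real" where
  "divergence_const b L = (b / L)\<^sup>2 / (4 * (max 1 (L / b\<^sup>2))\<^sup>2)"

lemma divergence_const_pos: "0 < b \<Longrightarrow> 0 < L \<Longrightarrow> 0 < divergence_const b L"
  by (auto simp: divergence_const_def intro!: divide_pos_pos)

text \<open>
  In terms of the eigenvalues \<open>e\<close> of \<open>S R0\<close>, the right-hand side is the sum of \<open>e - 1 - ln e\<close>. As the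
  eigenvalues are bounded, each summand dominates a multiple of \<open>(e - 1)\<^sup>2\<close>, and the sum of these
  squares is the trace of the square of \<open>S R0 - I = S (R0 - R)\<close>.
\<close>

lemma gaussian_divergence_ge:
  assumes R: "sym_mat n R" "\<And>x. b * sqnorm n x \<le> quad_form n R x"
      "\<And>x. sqnorm n (matvec n R x) \<le> L * sqnorm n x"
    and R0: "sym_mat n R0" "\<And>x. b * sqnorm n x \<le> quad_form n R0 x"
      "\<And>x. sqnorm n (matvec n R0 x) \<le> L * sqnorm n x"
    and b: "0 < b" and L: "0 < L" and S: "mat_inverse R = Some S"
  shows "divergence_const b L * (\<Sum>i<n. \<Sum>j<n. (R $$ (i, j) - R0 $$ (i, j))\<^sup>2)
    \<le> ln (Determinant.det R) - ln (Determinant.det R0) + mtrace (S * R0) - real n"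
proof -
  obtain S' where S': "mat_inverse R = Some S'" "sym_mat n S'" "S' * R = 1\<^sub>m n" "0 < Determinant.det R"
    "\<And>x. 0 \<le> quad_form n S' x" "\<And>x. quad_form n S' x \<le> 1 / b * sqnorm n x"
    "\<And>x. b / L * sqnorm n x \<le> quad_form n S' x"
    using spd_inverse[OF R(1) b R(2)] R(3) L by metis
  have "S' = S" using S S' by simp
  note S' = S'[unfolded this]
  have d0: "0 < Determinant.det R0" using spd_inverse[OF R0(1) b R0(2)] by metis
  have Rc: "R \<in> carrier_mat n n" and Sc: "S \<in> carrier_mat n n" and R0c: "R0 \<in> carrier_mat n n"
    using R(1) R0(1) S'(2) by (auto simp: sym_mat_def)
  obtain es where es: "length es = n" "\<And>e. e \<in> set es \<Longrightarrow> (0::real) \<le> e"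
    "Determinant.det (S * R0) = prod_list es" "mtrace (S * R0) = sum_list es"
    "mtrace ((S * R0) * (S * R0)) = sum_list (map (\<lambda>e. e\<^sup>2) es)"
    "\<And>p L e. e \<in> set es \<Longrightarrow> 0 \<le> p \<Longrightarrow> (\<And>x. quad_form n S x \<le> p * sqnorm n x) \<Longrightarrow>
       (\<And>x. sqnorm n (matvec n R0 x) \<le> L * sqnorm n x) \<Longrightarrow> e \<le> p * L / b"
    using spectrum_of_psd_product[OF S'(2) R0(1) S'(5) R0(2) b] by blast
  have dS: "Determinant.det S * Determinant.det R = 1"
    using det_mult[OF Sc Rc] S'(3) by simp
  have deq: "prod_list es = Determinant.det R0 / Determinant.det R"
    using det_mult[OF Sc R0c] es(3) dS S'(4) by (simp add: field_simps)
  have pos: "0 < e" if "e \<in> set es" for e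
    using prod_list_pos_imp[OF es(2) _ that] deq d0 S'(4) by simp
  define C where "C = max 1 (L / b\<^sup>2)"
  have up: "e \<le> C" if "e \<in> set es" for e
    using es(6)[OF that _ S'(6) R0(3)] b by (simp add: C_def power2_eq_square)
  have "ln (Determinant.det R) - ln (Determinant.det R0) = - sum_list (map ln es)"
    using ln_prod_list[of es] pos deq d0 S'(4) by (simp add: ln_div)
  then have "ln (Determinant.det R) - ln (Determinant.det R0) + mtrace (S * R0) - real n =
     sum_list (map (\<lambda>e. e - 1 - ln e) es)"
    using es(1,4) by (simp add: sum_list_subtractf sum_list_triv)
  also have "sum_list (map (\<lambda>e. (e - 1)\<^sup>2 / (2 * C\<^sup>2)) es) \<le> \<dots>"
    using pos up by (intro sum_list_mono ln_le_minus_square) (auto simp: C_def)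
  also have "sum_list (map (\<lambda>e. (e - 1)\<^sup>2 / (2 * C\<^sup>2)) es) =
     sum_list (map (\<lambda>e. (e - 1)\<^sup>2) es) / (2 * C\<^sup>2)"
    by (induction es) (simp_all add: add_divide_distrib)
  also have "sum_list (map (\<lambda>e. (e - 1)\<^sup>2) es) =
     sum_list (map (\<lambda>e. e\<^sup>2) es) - 2 * sum_list es + real (length es)"
    by (induction es) (auto simp: power2_eq_square algebra_simps)
  also have "\<dots> = mtrace (S * (R0 - R) * (S * (R0 - R)))"
  proof -
    have SD: "S * (R0 - R) = S * R0 - 1\<^sub>m n"
      using S'(3) Sc R0c Rc by (simp add: mult_minus_distrib_mat[of S n n R0 n])
    define X where "X = S * R0"
    have X: "X \<in> carrier_mat n n" using Sc R0c by (simp add: X_def)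
    have "(X - 1\<^sub>m n) * (X - 1\<^sub>m n) = (X * X - X) - (X - 1\<^sub>m n)"
    proof -
      have X1: "X - 1\<^sub>m n \<in> carrier_mat n n" by (rule minus_carrier_mat) simp
      have "(X - 1\<^sub>m n) * (X - 1\<^sub>m n) = (X - 1\<^sub>m n) * X - (X - 1\<^sub>m n) * 1\<^sub>m n"
        by (rule mult_minus_distrib_mat[OF X1 X]) simp
      also have "(X - 1\<^sub>m n) * X = X * X - 1\<^sub>m n * X"
        by (rule minus_mult_distrib_mat[OF X _ X]) simp
      finally show ?thesis using X X1 by simp
    qed
    moreover have "X * X \<in> carrier_mat n n" "X * X - X \<in> carrier_mat n n" "X - 1\<^sub>m n \<in> carrier_mat n n"
      using X by (auto intro: minus_carrier_mat)
    ultimately have "mtrace ((X - 1\<^sub>m n) * (X - 1\<^sub>m n)) = mtrace (X * X) - 2 * mtrace X + real n"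
      using X by (simp add: mtrace_minus[of _ n] mtrace_one)
    then show ?thesis using es(1,4,5) by (simp add: SD X_def)
  qed
  finally have 1: "mtrace (S * (R0 - R) * (S * (R0 - R))) / (2 * C\<^sup>2) \<le>
    ln (Determinant.det R) - ln (Determinant.det R0) + mtrace (S * R0) - real n" .
  have "sym_mat n (R0 - R)" using R(1) R0(1) minus_carrier_mat[OF Rc, of R0] by (auto simp: sym_mat_def)
  then have "(b / L)\<^sup>2 / 2 * (\<Sum>i<n. \<Sum>j<n. ((R0 - R) $$ (i, j))\<^sup>2) \<le> mtrace (S * (R0 - R) * (S * (R0 - R)))"
    using b L by (intro trace_psd_product_ge S'(2,7)) auto
  also have "(\<Sum>i<n. \<Sum>j<n. ((R0 - R) $$ (i, j))\<^sup>2) = (\<Sum>i<n. \<Sum>j<n. (R $$ (i, j) - R0 $$ (i, j))\<^sup>2)"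
    using Rc R0c by (intro sum.cong refl) (simp add: power2_commute)
  finally have "(b / L)\<^sup>2 / 2 * (\<Sum>i<n. \<Sum>j<n. (R $$ (i, j) - R0 $$ (i, j))\<^sup>2) / (2 * C\<^sup>2) \<le>
     mtrace (S * (R0 - R) * (S * (R0 - R))) / (2 * C\<^sup>2)"
    by (rule divide_right_mono) simp
  with 1 show ?thesis by (simp add: divergence_const_def C_def)
qed

section \<open>Poincare inequality for trigonometric polynomials of Gaussian variables\<close>

text \<open>
  Schur's theorem that entrywise powers of a positive semidefinite matrix are positive semidefinite.
  One factor is written as an expectation; under that expectation the induction hypothesis
  applies to the random weights \<open>d i * X i \<omega>\<close>.
\<close>

lemma (in prob_space) covariance_power_psd:
  fixes X :: "'i \<Rightarrow> 'a \<Rightarrow> real"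
  assumes "finite I" and int: "\<And>i j. i \<in> I \<Longrightarrow> j \<in> I \<Longrightarrow> integrable M (\<lambda>\<omega>. X i \<omega> * X j \<omega>)"
  shows "0 \<le> (\<Sum>i\<in>I. \<Sum>j\<in>I. d i * d j * (expectation (\<lambda>\<omega>. X i \<omega> * X j \<omega>)) ^ m)"
proof (induction m arbitrary: d)
  case 0
  have "(\<Sum>i\<in>I. \<Sum>j\<in>I. d i * d j) = (\<Sum>i\<in>I. d i)\<^sup>2"
    by (simp add: power2_eq_square sum_product)
  then show ?case by simp
next
  case (Suc m)
  let ?x = "\<lambda>i j. expectation (\<lambda>\<omega>. X i \<omega> * X j \<omega>)"
  have "(\<Sum>i\<in>I. \<Sum>j\<in>I. d i * d j * ?x i j ^ Suc m) =
     (\<Sum>i\<in>I. \<Sum>j\<in>I. expectation (\<lambda>\<omega>. d i * d j * ?x i j ^ m * (X i \<omega> * X j \<omega>)))"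
    unfolding integral_mult_right_zero by (simp add: mult_ac)
  also have "\<dots> = expectation (\<lambda>\<omega>. \<Sum>i\<in>I. \<Sum>j\<in>I. d i * d j * ?x i j ^ m * (X i \<omega> * X j \<omega>))"
    using int by (simp add: Bochner_Integration.integral_sum)
  also have "\<dots> = expectation (\<lambda>\<omega>. \<Sum>i\<in>I. \<Sum>j\<in>I. (d i * X i \<omega>) * (d j * X j \<omega>) * ?x i j ^ m)"
    by (simp add: mult_ac)
  also have "0 \<le> \<dots>"
    by (intro Bochner_Integration.integral_nonneg Suc.IH)
  finally show ?case .
qed

text \<open>
  What matters is that no coefficient is negative.
\<close>

lemma exp_remainder_sums:
  "(\<lambda>m. (if m = 0 then 0 else (real m - 1) / fact m) * x ^ m) sums (x * exp x - exp x + 1 :: real)"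
proof -
  have e: "(\<lambda>m. x ^ m / fact m) sums exp x"
    using exp_converges[of x] by (simp add: divide_inverse mult.commute)
  have "(\<lambda>m. real (Suc m) * x ^ Suc m / fact (Suc m)) sums (x * exp x)"
    using sums_mult[OF e, of x] by (simp add: field_simps del: of_nat_Suc)
  then have "(\<lambda>m. real m * x ^ m / fact m) sums (x * exp x)"
    by (subst (asm) sums_Suc_iff) simp
  from sums_diff[OF this e] have "(\<lambda>m. real m * x ^ m / fact m - x ^ m / fact m) sums (x * exp x - exp x)" .
  from sums_add[OF this sums_If_finite_set[of "{0}" "\<lambda>_. 1"]]
  have "(\<lambda>m. real m * x ^ m / fact m - x ^ m / fact m + (if m \<in> {0} then 1 else 0)) sums (x * exp x - exp x + 1)"
    by simp
  also have "(\<lambda>m. real m * x ^ m / fact m - x ^ m / fact m + (if m \<in> {0} then 1 else 0)) =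
     (\<lambda>m. (if m = 0 then 0 else (real m - 1) / fact m) * x ^ m)"
    by (auto simp: fun_eq_iff field_simps)
  finally show ?thesis .
qed

text \<open>
  Applying a power series with nonnegative coefficients to a covariance matrix entrywise keeps it
  positive semidefinite. This is what turns exact covariances of exponentials, \<open>e\<^sup>x - 1\<close>, into the
  bound \<open>x e\<^sup>x\<close> by gradients.
\<close>

lemma (in prob_space) covariance_exp_remainder_psd:
  fixes X :: "'i \<Rightarrow> 'a \<Rightarrow> real"
  assumes I: "finite I" and int: "\<And>i j. i \<in> I \<Longrightarrow> j \<in> I \<Longrightarrow> integrable M (\<lambda>\<omega>. X i \<omega> * X j \<omega>)"
  defines "x \<equiv> \<lambda>i j. expectation (\<lambda>\<omega>. X i \<omega> * X j \<omega>)"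
  shows "0 \<le> (\<Sum>i\<in>I. \<Sum>j\<in>I. d i * d j * (x i j * exp (x i j) - exp (x i j) + 1))"
proof -
  let ?h = "\<lambda>m::nat. if m = 0 then 0 else (real m - 1) / fact m"
  have s: "(\<lambda>m. \<Sum>i\<in>I. \<Sum>j\<in>I. d i * d j * (?h m * x i j ^ m)) sums
     (\<Sum>i\<in>I. \<Sum>j\<in>I. d i * d j * (x i j * exp (x i j) - exp (x i j) + 1))"
    by (intro sums_sum sums_mult exp_remainder_sums)
  have t: "0 \<le> (\<Sum>i\<in>I. \<Sum>j\<in>I. d i * d j * (?h m * x i j ^ m))" for m
  proof -
    have "(\<Sum>i\<in>I. \<Sum>j\<in>I. d i * d j * (?h m * x i j ^ m)) = ?h m * (\<Sum>i\<in>I. \<Sum>j\<in>I. d i * d j * x i j ^ m)"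
      by (simp add: sum_distrib_left mult_ac)
    moreover have "0 \<le> ?h m" by simp
    ultimately show ?thesis
      using covariance_power_psd[OF I int, where d = d and m = m] unfolding x_def by simp
  qed
  show ?thesis using sums_le[OF _ sums_zero s] t by blast
qed

definition frequency_sum :: "nat \<Rightarrow> (nat \<Rightarrow> real) \<Rightarrow> (nat \<Rightarrow> real) \<Rightarrow> real" where
  "frequency_sum n u z = (\<Sum>p<n. u p * z p)"

text \<open>
  \<open>trig_grad n F G\<close> states that \<open>F\<close> is a trigonometric polynomial in the first \<open>n\<close> variables and that
  \<open>G z r\<close> is the partial derivative of \<open>F\<close> at \<open>z\<close> in direction \<open>r\<close>. The gradient is carried along symbolically,
  so that the closure rules below are the sum and product rules of differentiation.
\<close>

inductive trig_grad :: "nat \<Rightarrow> ((nat \<Rightarrow> real) \<Rightarrow> complex) \<Rightarrow> ((nat \<Rightarrow> real) \<Rightarrow> nat \<Rightarrow> complex) \<Rightarrow> bool"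
  for n where
  wave: "trig_grad n (\<lambda>z. c * cis (frequency_sum n u z))
     (\<lambda>z r. c * (\<i> * of_real (u r)) * cis (frequency_sum n u z))"
| add: "trig_grad n F G \<Longrightarrow> trig_grad n F' G' \<Longrightarrow>
     trig_grad n (\<lambda>z. F z + F' z) (\<lambda>z r. G z r + G' z r)"

lemma trig_grad_wave_mult:
  "trig_grad n F G \<Longrightarrow>
     trig_grad n (\<lambda>z. c * cis (frequency_sum n u z) * F z)
       (\<lambda>z r. c * cis (frequency_sum n u z) * G z r + c * (\<i> * of_real (u r)) * cis (frequency_sum n u z) * F z)"
proof (induction rule: trig_grad.induct)
  case (wave c' u')
  let ?w = "\<lambda>p. u p + u' p"
  have e: "cis (frequency_sum n ?w z) = cis (frequency_sum n u z) * cis (frequency_sum n u' z)" for z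
    by (simp add: frequency_sum_def cis_mult sum.distrib algebra_simps)
  have "trig_grad n (\<lambda>z. (c * c') * cis (frequency_sum n ?w z))
     (\<lambda>z r. (c * c') * (\<i> * of_real (?w r)) * cis (frequency_sum n ?w z))"
    by (rule trig_grad.wave)
  then show ?case by (simp add: e algebra_simps)
next
  case (add F G F' G')
  from trig_grad.add[OF add.IH] show ?case by (simp add: algebra_simps)
qed

lemma trig_grad_mult:
  assumes "trig_grad n F G" "trig_grad n F' G'"
  shows "trig_grad n (\<lambda>z. F z * F' z) (\<lambda>z r. F z * G' z r + G z r * F' z)"
  using assms(1)
proof (induction rule: trig_grad.induct)
  case (wave c u)
  from trig_grad_wave_mult[OF assms(2)] show ?case .
next
  case (add F1 G1 F2 G2)
  from trig_grad.add[OF add.IH] show ?case by (simp add: algebra_simps)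
qed

lemma trig_grad_const: "trig_grad n (\<lambda>z. c) (\<lambda>z r. 0)"
  using trig_grad.wave[of n c "\<lambda>_. 0"] by (simp add: frequency_sum_def)

lemma trig_grad_sum:
  assumes "finite I" "\<And>i. i \<in> I \<Longrightarrow> trig_grad n (F i) (G i)"
  shows "trig_grad n (\<lambda>z. \<Sum>i\<in>I. F i z) (\<lambda>z r. \<Sum>i\<in>I. G i z r)"
  using assms by (induction I rule: finite_induct) (auto intro: trig_grad_const trig_grad.add)

lemma trig_grad_cmult:
  assumes "trig_grad n F G"
  shows "trig_grad n (\<lambda>z. c * F z) (\<lambda>z r. c * G z r)"
  using trig_grad_mult[OF trig_grad_const[of n c] assms] by simp

text \<open>
  Euler's formula writes the sine as a combination of two waves.
\<close>

lemma trig_grad_sin: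
  assumes "p < n"
  shows "trig_grad n (\<lambda>z. of_real (sin (w * z p))) (\<lambda>z r. if r = p then of_real (w * cos (w * z p)) else 0)"
proof -
  let ?u = "\<lambda>w r. if r = p then w else (0::real)"
  have f: "frequency_sum n (?u w) z = w * z p" for w z
    using assms by (simp add: frequency_sum_def if_distrib[of "\<lambda>u. u * _"] cong: if_cong)
  have "trig_grad n (\<lambda>z. (1 / (2 * \<i>)) * cis (w * z p) + (- 1 / (2 * \<i>)) * cis (- w * z p))
    (\<lambda>z r. (1 / (2 * \<i>)) * (\<i> * of_real (?u w r)) * cis (w * z p) + (- 1 / (2 * \<i>)) * (\<i> * of_real (?u (-w) r)) * cis (- w * z p))"
    using trig_grad.add[OF trig_grad.wave[of n "1 / (2 * \<i>)" "?u w"] trig_grad.wave[of n "- 1 / (2 * \<i>)" "?u (- w)"]]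
    unfolding f .
  also have "(\<lambda>z. (1 / (2 * \<i>)) * cis (w * z p) + (- 1 / (2 * \<i>)) * cis (- w * z p)) = (\<lambda>z. of_real (sin (w * z p)))"
    by (auto simp: fun_eq_iff complex_eq_iff)
  also have "(\<lambda>z r. (1 / (2 * \<i>)) * (\<i> * of_real (?u w r)) * cis (w * z p) + (- 1 / (2 * \<i>)) * (\<i> * of_real (?u (-w) r)) * cis (- w * z p)) =
     (\<lambda>z r. if r = p then of_real (w * cos (w * z p)) else 0)"
    by (auto simp: fun_eq_iff complex_eq_iff)
  finally show ?thesis .
qed

text \<open>
  The bounds are carried through the induction together with the derivative \<open>h\<close>, because the
  derivative of a product is controlled by bounds on the factors as well.
\<close>

lemma trig_grad_polynomial_sin:
  fixes g :: "real \<Rightarrow> real"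
  assumes "real_polynomial_function g"
  shows "\<exists>h B. (\<forall>t. \<bar>g (sin (w * t))\<bar> \<le> B \<and> \<bar>h t\<bar> \<le> B) \<and>
    (\<forall>n. \<forall>p<n. trig_grad n (\<lambda>z. of_real (g (sin (w * z p)))) (\<lambda>z r. if r = p then of_real (h (z p)) else 0))"
  using assms
proof (induction rule: real_polynomial_function.induct)
  case (linear f)
  then have f: "f x = f 1 * x" for x
    using linear_cmul[OF bounded_linear.linear[OF linear], of x 1] by simp
  show ?case
  proof (intro exI conjI allI impI)
    fix t :: real
    have "\<bar>f 1 * sin (w * t)\<bar> \<le> \<bar>f 1\<bar> * 1" unfolding abs_mult by (intro mult_left_mono) auto
    then show "\<bar>f (sin (w * t))\<bar> \<le> \<bar>f 1\<bar> + \<bar>f 1 * w\<bar>" by (subst f) simp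
    have "\<bar>f 1 * w * cos (w * t)\<bar> \<le> \<bar>f 1 * w\<bar> * 1" unfolding abs_mult[of "f 1 * w"] by (intro mult_left_mono) auto
    then show "\<bar>f 1 * w * cos (w * t)\<bar> \<le> \<bar>f 1\<bar> + \<bar>f 1 * w\<bar>" by simp
  next
    fix n p :: nat assume p: "p < n"
    have "(\<lambda>z. complex_of_real (f (sin (w * z p)))) = (\<lambda>z. of_real (f 1) * of_real (sin (w * z p)))"
      by (subst f) simp
    moreover have "(\<lambda>z r. if r = p then complex_of_real (f 1 * w * cos (w * z p)) else 0) =
      (\<lambda>z r. of_real (f 1) * (if r = p then of_real (w * cos (w * z p)) else 0))"
      by (auto simp: fun_eq_iff)
    ultimately show "trig_grad n (\<lambda>z. complex_of_real (f (sin (w * z p))))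
       (\<lambda>z r. if r = p then complex_of_real (f 1 * w * cos (w * z p)) else 0)"
      using trig_grad_cmult[OF trig_grad_sin[OF p, of w], of "of_real (f 1)"] by presburger
  qed
next
  case (const c)
  show ?case
    by (rule exI[of _ "\<lambda>_. 0"], rule exI[of _ "\<bar>c\<bar>"]) (use trig_grad_const in \<open>auto cong: if_cong\<close>)
next
  case (add f g)
  then obtain h B h' B' where
    h: "\<And>t. \<bar>f (sin (w * t))\<bar> \<le> B \<and> \<bar>h t\<bar> \<le> B"
       "\<And>n p. p < n \<Longrightarrow> trig_grad n (\<lambda>z. of_real (f (sin (w * z p)))) (\<lambda>z r. if r = p then of_real (h (z p)) else 0)"
    and h': "\<And>t. \<bar>g (sin (w * t))\<bar> \<le> B' \<and> \<bar>h' t\<bar> \<le> B'"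
       "\<And>n p. p < n \<Longrightarrow> trig_grad n (\<lambda>z. of_real (g (sin (w * z p)))) (\<lambda>z r. if r = p then of_real (h' (z p)) else 0)"
    by blast
  show ?case
  proof (intro exI conjI allI impI)
    fix t
    show "\<bar>f (sin (w * t)) + g (sin (w * t))\<bar> \<le> B + B'" using h(1)[of t] h'(1)[of t] by linarith
    show "\<bar>h t + h' t\<bar> \<le> B + B'" using h(1)[of t] h'(1)[of t] by linarith
  next
    fix n p :: nat assume p: "p < n"
    have "(\<lambda>z r. if r = p then complex_of_real (h (z p) + h' (z p)) else 0) =
       (\<lambda>z r. (if r = p then of_real (h (z p)) else 0) + (if r = p then of_real (h' (z p)) else 0))"
      by (auto simp: fun_eq_iff)
    then show "trig_grad n (\<lambda>z. of_real (f (sin (w * z p)) + g (sin (w * z p))))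
       (\<lambda>z r. if r = p then complex_of_real (h (z p) + h' (z p)) else 0)"
      using trig_grad.add[OF h(2)[OF p] h'(2)[OF p]] by simp
  qed
next
  case (mult f g)
  then obtain h B h' B' where
    h: "\<And>t. \<bar>f (sin (w * t))\<bar> \<le> B \<and> \<bar>h t\<bar> \<le> B"
       "\<And>n p. p < n \<Longrightarrow> trig_grad n (\<lambda>z. of_real (f (sin (w * z p)))) (\<lambda>z r. if r = p then of_real (h (z p)) else 0)"
    and h': "\<And>t. \<bar>g (sin (w * t))\<bar> \<le> B' \<and> \<bar>h' t\<bar> \<le> B'"
       "\<And>n p. p < n \<Longrightarrow> trig_grad n (\<lambda>z. of_real (g (sin (w * z p)))) (\<lambda>z r. if r = p then of_real (h' (z p)) else 0)"
    by blast
  show ?case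
  proof (intro exI conjI allI impI)
    fix t
    have B: "0 \<le> B" "0 \<le> B'" using h(1)[of t] h'(1)[of t] by linarith+
    have "\<bar>f (sin (w * t)) * g (sin (w * t))\<bar> \<le> B * B'"
      unfolding abs_mult using h(1)[of t] h'(1)[of t] B by (intro mult_mono) auto
    moreover have "0 \<le> B * B'" using B by simp
    ultimately show "\<bar>f (sin (w * t)) * g (sin (w * t))\<bar> \<le> 2 * (B * B')" by linarith
    have "\<bar>f (sin (w * t)) * h' t\<bar> \<le> B * B'"
      unfolding abs_mult using h(1)[of t] h'(1)[of t] B by (intro mult_mono) auto
    moreover have "\<bar>h t * g (sin (w * t))\<bar> \<le> B * B'"
      unfolding abs_mult using h(1)[of t] h'(1)[of t] B by (intro mult_mono) auto
    ultimately show "\<bar>f (sin (w * t)) * h' t + h t * g (sin (w * t))\<bar> \<le> 2 * (B * B')" by linarith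
  next
    fix n p :: nat assume p: "p < n"
    have "(\<lambda>z r. if r = p then complex_of_real (f (sin (w * z p)) * h' (z p) + h (z p) * g (sin (w * z p))) else 0) =
       (\<lambda>z r. of_real (f (sin (w * z p))) * (if r = p then of_real (h' (z p)) else 0) +
          (if r = p then of_real (h (z p)) else 0) * of_real (g (sin (w * z p))))"
      by (auto simp: fun_eq_iff)
    then show "trig_grad n (\<lambda>z. of_real (f (sin (w * z p)) * g (sin (w * z p))))
       (\<lambda>z r. if r = p then complex_of_real (f (sin (w * z p)) * h' (z p) + h (z p) * g (sin (w * z p))) else 0)"
      using trig_grad_mult[OF h(2)[OF p] h'(2)[OF p]] by simp
  qed
qed

text \<open>
  By the product rule each of the two factors contributes the same term, since \<open>A\<close> is symmetric.
\<close>

lemma trig_grad_quadratic: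
  fixes \<tau> h :: "real \<Rightarrow> real"
  assumes A: "sym_mat n A"
    and \<tau>: "\<And>p. p < n \<Longrightarrow> trig_grad n (\<lambda>z. of_real (\<tau> (z p))) (\<lambda>z r. if r = p then of_real (h (z p)) else 0)"
  shows "\<exists>G. trig_grad n (\<lambda>z. of_real (quad_form n A (\<lambda>p. \<tau> (z p)))) G \<and>
     (\<forall>z. \<forall>r<n. G z r = of_real (2 * h (z r) * matvec n A (\<lambda>p. \<tau> (z p)) r))"
proof -
  let ?G = "\<lambda>p q z r. complex_of_real (A $$ (p, q)) * (of_real (\<tau> (z p)) * (if r = q then of_real (h (z q)) else 0) +
     (if r = p then of_real (h (z p)) else 0) * of_real (\<tau> (z q)))"
  have tg: "trig_grad n (\<lambda>z. \<Sum>p<n. \<Sum>q<n. of_real (A $$ (p, q)) * (of_real (\<tau> (z p)) * of_real (\<tau> (z q))))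
     (\<lambda>z r. \<Sum>p<n. \<Sum>q<n. ?G p q z r)"
    by (intro trig_grad_sum trig_grad_cmult trig_grad_mult \<tau>) auto
  have eq: "(\<lambda>z. \<Sum>p<n. \<Sum>q<n. of_real (A $$ (p, q)) * (of_real (\<tau> (z p)) * of_real (\<tau> (z q)))) =
     (\<lambda>z. complex_of_real (quad_form n A (\<lambda>p. \<tau> (z p))))"
    by (simp add: quad_form_altdef mult_ac)
  show ?thesis
  proof (intro exI[of _ "\<lambda>z r. \<Sum>p<n. \<Sum>q<n. ?G p q z r"] conjI allI impI)
    show "trig_grad n (\<lambda>z. of_real (quad_form n A (\<lambda>p. \<tau> (z p)))) (\<lambda>z r. \<Sum>p<n. \<Sum>q<n. ?G p q z r)"
      using tg unfolding eq .
    fix z r assume r: "r < n"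
    have "(\<Sum>p<n. \<Sum>q<n. ?G p q z r) =
      (\<Sum>p<n. \<Sum>q<n. if r = q then of_real (A $$ (p, q) * \<tau> (z p) * h (z q)) else 0) +
      (\<Sum>p<n. \<Sum>q<n. if r = p then of_real (A $$ (p, q) * h (z p) * \<tau> (z q)) else 0)"
      unfolding sum.distrib[symmetric] by (intro sum.cong refl) (auto simp: distrib_left mult_ac)
    also have "(\<Sum>p<n. \<Sum>q<n. if r = p then complex_of_real (A $$ (p, q) * h (z p) * \<tau> (z q)) else 0) =
       (\<Sum>q<n. \<Sum>p<n. if r = p then of_real (A $$ (p, q) * h (z p) * \<tau> (z q)) else 0)"
      by (rule sum.swap)
    also have "(\<Sum>p<n. \<Sum>q<n. if r = q then complex_of_real (A $$ (p, q) * \<tau> (z p) * h (z q)) else 0) + \<dots> =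
       (\<Sum>p<n. of_real (A $$ (p, r) * \<tau> (z p) * h (z r))) + (\<Sum>q<n. of_real (A $$ (r, q) * h (z r) * \<tau> (z q)))"
      using r by simp
    also have "(\<Sum>p<n. complex_of_real (A $$ (p, r) * \<tau> (z p) * h (z r))) = (\<Sum>p<n. of_real (A $$ (r, p) * \<tau> (z p) * h (z r)))"
      using A r by (intro sum.cong refl) (auto simp: sym_mat_def)
    also have "\<dots> + (\<Sum>q<n. of_real (A $$ (r, q) * h (z r) * \<tau> (z q))) = of_real (2 * h (z r) * matvec n A (\<lambda>p. \<tau> (z p)) r)"
      by (simp add: matvec_def sum_distrib_left mult_ac flip: sum.distrib)
    finally show "(\<Sum>p<n. \<Sum>q<n. ?G p q z r) = of_real (2 * h (z r) * matvec n A (\<lambda>p. \<tau> (z p)) r)" .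
  qed
qed

lemma trig_grad_representation:
  assumes "trig_grad n F G"
  obtains N :: nat and c u where
    "\<And>z. F z = (\<Sum>k<N. c k * cis (frequency_sum n (u k) z))"
    "\<And>z r. G z r = (\<Sum>k<N. c k * (\<i> * of_real (u k r)) * cis (frequency_sum n (u k) z))"
proof -
  have "\<exists>xs. (\<forall>z. F z = (\<Sum>(c, u)\<leftarrow>xs. c * cis (frequency_sum n u z))) \<and>
      (\<forall>z r. G z r = (\<Sum>(c, u)\<leftarrow>xs. c * (\<i> * of_real (u r)) * cis (frequency_sum n u z)))"
    using assms
  proof (induction rule: trig_grad.induct)
    case (wave c u)
    show ?case by (rule exI[of _ "[(c, u)]"]) simp
  next
    case (add F G F' G')
    then obtain xs ys where
      "\<forall>z. F z = (\<Sum>(c, u)\<leftarrow>xs. c * cis (frequency_sum n u z))"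
      "\<forall>z r. G z r = (\<Sum>(c, u)\<leftarrow>xs. c * (\<i> * of_real (u r)) * cis (frequency_sum n u z))"
      "\<forall>z. F' z = (\<Sum>(c, u)\<leftarrow>ys. c * cis (frequency_sum n u z))"
      "\<forall>z r. G' z r = (\<Sum>(c, u)\<leftarrow>ys. c * (\<i> * of_real (u r)) * cis (frequency_sum n u z))"
      by blast
    then show ?case by (intro exI[of _ "xs @ ys"]) simp
  qed
  then obtain xs where xs:
    "\<And>z. F z = (\<Sum>(c, u)\<leftarrow>xs. c * cis (frequency_sum n u z))"
    "\<And>z r. G z r = (\<Sum>(c, u)\<leftarrow>xs. c * (\<i> * of_real (u r)) * cis (frequency_sum n u z))" by blast
  show ?thesis
  proof (rule that[where N = "length xs" and c = "\<lambda>k. fst (xs ! k)" and u = "\<lambda>k. snd (xs ! k)"])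
    fix z r
    show "F z = (\<Sum>k<length xs. fst (xs ! k) * cis (frequency_sum n (snd (xs ! k)) z))"
      by (simp add: xs(1) sum_list_sum_nth lessThan_atLeast0 case_prod_beta)
    show "G z r = (\<Sum>k<length xs. fst (xs ! k) * (\<i> * of_real (snd (xs ! k) r)) * cis (frequency_sum n (snd (xs ! k)) z))"
      by (simp add: xs(2) sum_list_sum_nth lessThan_atLeast0 case_prod_beta)
  qed
qed

lemma cmod_square_sum_cis:
  fixes x :: "'i \<Rightarrow> real"
  shows "(cmod (\<Sum>k\<in>I. c k * cis (x k)))\<^sup>2 = (\<Sum>k\<in>I. \<Sum>l\<in>I. Re (c k * cnj (c l) * cis (x k - x l)))"
proof -
  have "(cmod (\<Sum>k\<in>I. c k * cis (x k)))\<^sup>2 = Re ((\<Sum>k\<in>I. c k * cis (x k)) * cnj (\<Sum>k\<in>I. c k * cis (x k)))"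
    by (metis Re_complex_of_real complex_norm_square)
  also have "(\<Sum>k\<in>I. c k * cis (x k)) * cnj (\<Sum>k\<in>I. c k * cis (x k)) =
     (\<Sum>k\<in>I. \<Sum>l\<in>I. (c k * cis (x k)) * (cnj (c l) * cis (- x l)))"
    by (simp add: sum_product cis_cnj)
  also have "\<dots> = (\<Sum>k\<in>I. \<Sum>l\<in>I. c k * cnj (c l) * cis (x k - x l))"
    by (simp add: cis_mult[symmetric] mult_ac diff_conv_add_uminus del: add_uminus_conv_diff)
  finally show ?thesis by simp
qed

lemma (in prob_space) integrable_cis:
  assumes [measurable]: "X \<in> borel_measurable M"
  shows "integrable M (\<lambda>\<omega>. cis (X \<omega>))"
proof (rule integrable_const_bound[where B = 1])
  show "(\<lambda>\<omega>. cis (X \<omega>)) \<in> borel_measurable M"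
    unfolding cis_conv_exp by measurable
qed simp

lemma (in prob_space) centred_second_moment:
  fixes f :: "'a \<Rightarrow> complex"
  assumes f: "integrable M f" "integrable M (\<lambda>\<omega>. (cmod (f \<omega>))\<^sup>2)"
  shows "expectation (\<lambda>\<omega>. (cmod (f \<omega> - expectation f))\<^sup>2) =
     expectation (\<lambda>\<omega>. (cmod (f \<omega>))\<^sup>2) - (cmod (expectation f))\<^sup>2"
proof -
  let ?m = "expectation f"
  have e: "(cmod (f \<omega> - ?m))\<^sup>2 = (cmod (f \<omega>))\<^sup>2 - 2 * (Re (f \<omega>) * Re ?m + Im (f \<omega>) * Im ?m) + (cmod ?m)\<^sup>2" for \<omega>
    unfolding cmod_power2 by (simp add: power2_eq_square algebra_simps)
  have "expectation (\<lambda>\<omega>. (cmod (f \<omega> - ?m))\<^sup>2) =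
     expectation (\<lambda>\<omega>. (cmod (f \<omega>))\<^sup>2) - 2 * (Re ?m * Re ?m + Im ?m * Im ?m) + (cmod ?m)\<^sup>2"
    unfolding e using f by (simp add: prob_space)
  then show ?thesis unfolding cmod_power2[of ?m] by (simp add: power2_eq_square)
qed

lemma integral_double_sum:
  fixes f :: "'i \<Rightarrow> 'j \<Rightarrow> 'a \<Rightarrow> 'b::{banach, second_countable_topology}"
  assumes "\<And>p q. p \<in> P \<Longrightarrow> q \<in> Q \<Longrightarrow> integrable M (f p q)"
  shows "(\<integral>\<omega>. (\<Sum>p\<in>P. \<Sum>q\<in>Q. f p q \<omega>) \<partial>M) = (\<Sum>p\<in>P. \<Sum>q\<in>Q. \<integral>\<omega>. f p q \<omega> \<partial>M)"
proof -
  have "(\<integral>\<omega>. (\<Sum>p\<in>P. \<Sum>q\<in>Q. f p q \<omega>) \<partial>M) = (\<Sum>p\<in>P. \<integral>\<omega>. (\<Sum>q\<in>Q. f p q \<omega>) \<partial>M)"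
    using assms by (intro Bochner_Integration.integral_sum Bochner_Integration.integrable_sum) auto
  also have "\<dots> = (\<Sum>p\<in>P. \<Sum>q\<in>Q. \<integral>\<omega>. f p q \<omega> \<partial>M)"
    using assms by (intro sum.cong refl Bochner_Integration.integral_sum) auto
  finally show ?thesis .
qed

lemma sum_swap_pairs:
  fixes f :: "'a \<Rightarrow> 'b \<Rightarrow> 'c \<Rightarrow> 'd \<Rightarrow> 'e::comm_monoid_add"
  shows "(\<Sum>k\<in>A. \<Sum>l\<in>B. \<Sum>p\<in>C. \<Sum>q\<in>D. f k l p q) = (\<Sum>p\<in>C. \<Sum>q\<in>D. \<Sum>k\<in>A. \<Sum>l\<in>B. f k l p q)"
proof -
  have "(\<Sum>k\<in>A. \<Sum>l\<in>B. \<Sum>p\<in>C. \<Sum>q\<in>D. f k l p q) = (\<Sum>k\<in>A. \<Sum>p\<in>C. \<Sum>l\<in>B. \<Sum>q\<in>D. f k l p q)"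
    by (intro sum.cong refl sum.swap)
  also have "\<dots> = (\<Sum>p\<in>C. \<Sum>k\<in>A. \<Sum>l\<in>B. \<Sum>q\<in>D. f k l p q)" by (rule sum.swap)
  also have "\<dots> = (\<Sum>p\<in>C. \<Sum>k\<in>A. \<Sum>q\<in>D. \<Sum>l\<in>B. f k l p q)"
    by (intro sum.cong refl sum.swap)
  also have "\<dots> = (\<Sum>p\<in>C. \<Sum>q\<in>D. \<Sum>k\<in>A. \<Sum>l\<in>B. f k l p q)"
    by (intro sum.cong refl sum.swap)
  finally show ?thesis .
qed

text \<open>
  If \<open>F\<close> has coefficients \<open>c k\<close> and frequency vectors with covariances \<open>x k l\<close>, then the variance of \<open>F\<close> is
  \<open>\<Sum>k l. d k * cnj (d l) * (exp (x k l) - 1)\<close>, where \<open>d k\<close> is \<open>c k\<close> times the characteristic function at the \<open>k\<close>th frequency.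
  Replacing \<open>exp (x k l) - 1\<close> by \<open>x k l * exp (x k l)\<close> can only increase this form, and then it is the
  expectation of the covariance form \<open>r\<close> at the gradient of \<open>F\<close>. The hypothesis \<open>char\<close> says that \<open>Z\<close> is a
  centred Gaussian vector.
\<close>

theorem (in prob_space) gaussian_trig_poincare:
  fixes Z :: "nat \<Rightarrow> 'a \<Rightarrow> real"
  assumes Z: "\<And>p. p < n \<Longrightarrow> Z p \<in> borel_measurable M"
    and ZZ: "\<And>p q. p < n \<Longrightarrow> q < n \<Longrightarrow> integrable M (\<lambda>\<omega>. Z p \<omega> * Z q \<omega>)"
    and r: "\<And>p q. p < n \<Longrightarrow> q < n \<Longrightarrow> expectation (\<lambda>\<omega>. Z p \<omega> * Z q \<omega>) = r p q"
    and char: "\<And>u. expectation (\<lambda>\<omega>. cis (frequency_sum n u (\<lambda>p. Z p \<omega>))) =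
       of_real (exp (- (\<Sum>p<n. \<Sum>q<n. u p * u q * r p q) / 2))"
    and lam: "\<And>v. (\<Sum>p<n. \<Sum>q<n. v p * v q * r p q) \<le> \<Lambda> * (\<Sum>p<n. (v p)\<^sup>2)"
    and FG: "trig_grad n F G"
  shows "integrable M (\<lambda>\<omega>. F (\<lambda>p. Z p \<omega>))"
    and "integrable M (\<lambda>\<omega>. (cmod (F (\<lambda>p. Z p \<omega>)))\<^sup>2)"
    and "expectation (\<lambda>\<omega>. (cmod (F (\<lambda>p. Z p \<omega>) - expectation (\<lambda>\<omega>. F (\<lambda>p. Z p \<omega>))))\<^sup>2) \<le>
       \<Lambda> * expectation (\<lambda>\<omega>. \<Sum>p<n. (cmod (G (\<lambda>p. Z p \<omega>) p))\<^sup>2)"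
proof -
  obtain N c u where FG':
    "\<And>z. F z = (\<Sum>k<(N::nat). c k * cis (frequency_sum n (u k) z))"
    "\<And>z r. G z r = (\<Sum>k<N. c k * (\<i> * of_real (u k r)) * cis (frequency_sum n (u k) z))"
    by (rule trig_grad_representation[OF FG]) blast
  define X where "X = (\<lambda>k \<omega>. frequency_sum n (u k) (\<lambda>p. Z p \<omega>))"
  have X[measurable]: "X k \<in> borel_measurable M" for k
    unfolding X_def frequency_sum_def
    by (intro borel_measurable_sum borel_measurable_times borel_measurable_const Z) simp
  define cv where "cv = (\<lambda>u v. \<Sum>p<n. \<Sum>q<n. u p * v q * r p q)"
  have XXe: "X k \<omega> * X l \<omega> = (\<Sum>p<n. \<Sum>q<n. u k p * u l q * (Z p \<omega> * Z q \<omega>))" for k l \<omega>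
    by (simp add: X_def frequency_sum_def sum_product mult_ac)
  have XX: "integrable M (\<lambda>\<omega>. X k \<omega> * X l \<omega>)" for k l
    unfolding XXe using ZZ by (intro Bochner_Integration.integrable_sum integrable_mult_right) auto
  have EXX: "expectation (\<lambda>\<omega>. X k \<omega> * X l \<omega>) = cv (u k) (u l)" for k l
  proof -
    have "expectation (\<lambda>\<omega>. X k \<omega> * X l \<omega>) =
       (\<Sum>p<n. \<Sum>q<n. expectation (\<lambda>\<omega>. u k p * u l q * (Z p \<omega> * Z q \<omega>)))"
      unfolding XXe by (rule integral_double_sum) (simp add: ZZ)
    also have "\<dots> = cv (u k) (u l)"
      unfolding cv_def by (intro sum.cong refl) (simp add: r)
    finally show ?thesis .
  qed
  have EX: "expectation (\<lambda>\<omega>. cis (X k \<omega>)) = of_real (exp (- cv (u k) (u k) / 2))" for k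
    using char[of "u k"] by (simp add: X_def cv_def)
  have sym: "cv a b = cv b a" for a b
  proof -
    have "cv a b = (\<Sum>q<n. \<Sum>p<n. a p * b q * r p q)" unfolding cv_def by (rule sum.swap)
    also have "\<dots> = (\<Sum>q<n. \<Sum>p<n. b q * a p * r q p)"
    proof (intro sum.cong refl)
      fix p q assume "q \<in> {..<n}" "p \<in> {..<n}"
      then have "r p q = r q p" using r[of p q] r[of q p] by (simp add: mult.commute)
      then show "a p * b q * r p q = b q * a p * r q p" by simp
    qed
    finally show ?thesis by (simp add: cv_def)
  qed
  have cvd: "cv (\<lambda>p. a p - b p) (\<lambda>p. a p - b p) = cv a a + cv b b - 2 * cv a b" for a b
    using sym[of a b] by (simp add: cv_def algebra_simps sum.distrib sum_subtractf)
  have EXd: "expectation (\<lambda>\<omega>. cis (X k \<omega> - X l \<omega>)) =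
     of_real (exp (- cv (u k) (u k) / 2) * exp (- cv (u l) (u l) / 2) * exp (cv (u k) (u l)))" for k l
  proof -
    have "X k \<omega> - X l \<omega> = frequency_sum n (\<lambda>p. u k p - u l p) (\<lambda>p. Z p \<omega>)" for \<omega>
      by (simp add: X_def frequency_sum_def left_diff_distrib sum_subtractf)
    then have "expectation (\<lambda>\<omega>. cis (X k \<omega> - X l \<omega>)) = of_real (exp (- cv (\<lambda>p. u k p - u l p) (\<lambda>p. u k p - u l p) / 2))"
      using char[of "\<lambda>p. u k p - u l p"] by (simp add: cv_def)
    then show ?thesis by (simp add: cvd diff_divide_distrib add_divide_distrib flip: exp_add)
  qed
  define e where "e = (\<lambda>k. exp (- cv (u k) (u k) / 2))"
  have intd: "integrable M (\<lambda>\<omega>. cis (X k \<omega> - X l \<omega>))" for k l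
    by (intro integrable_cis) measurable
  have FX: "F (\<lambda>p. Z p \<omega>) = (\<Sum>k<N. c k * cis (X k \<omega>))" for \<omega> by (simp add: FG'(1) X_def)
  show intF: "integrable M (\<lambda>\<omega>. F (\<lambda>p. Z p \<omega>))"
    unfolding FX by (intro Bochner_Integration.integrable_sum integrable_mult_right integrable_cis) measurable
  have F2: "(cmod (F (\<lambda>p. Z p \<omega>)))\<^sup>2 = (\<Sum>k<N. \<Sum>l<N. Re (c k * cnj (c l) * cis (X k \<omega> - X l \<omega>)))" for \<omega>
    unfolding FX by (rule cmod_square_sum_cis)
  show intF2: "integrable M (\<lambda>\<omega>. (cmod (F (\<lambda>p. Z p \<omega>)))\<^sup>2)"
    unfolding F2 by (intro Bochner_Integration.integrable_sum integrable_Re integrable_mult_right intd)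
  have ReE: "expectation (\<lambda>\<omega>. Re (a * cis (X k \<omega> - X l \<omega>))) = Re a * (e k * e l * exp (cv (u k) (u l)))" for a k l
  proof -
    have "expectation (\<lambda>\<omega>. Re (a * cis (X k \<omega> - X l \<omega>))) = Re (expectation (\<lambda>\<omega>. a * cis (X k \<omega> - X l \<omega>)))"
      by (intro integral_Re integrable_mult_right intd)
    also have "\<dots> = Re (a * of_real (e k * e l * exp (cv (u k) (u l))))"
      using EXd[of k l] by (simp add: e_def)
    finally show ?thesis by simp
  qed
  have EF2: "expectation (\<lambda>\<omega>. (cmod (F (\<lambda>p. Z p \<omega>)))\<^sup>2) =
     (\<Sum>k<N. \<Sum>l<N. Re (c k * cnj (c l)) * (e k * e l * exp (cv (u k) (u l))))"
    unfolding F2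
    by (subst integral_double_sum) (intro integrable_Re integrable_mult_right intd, simp only: ReE)
  have EF: "(cmod (expectation (\<lambda>\<omega>. F (\<lambda>p. Z p \<omega>))))\<^sup>2 = (\<Sum>k<N. \<Sum>l<N. Re (c k * cnj (c l)) * (e k * e l))"
  proof -
    have "expectation (\<lambda>\<omega>. F (\<lambda>p. Z p \<omega>)) = (\<Sum>k<N. (c k * of_real (e k)) * cis 0)"
      unfolding FX using integrable_cis[OF X] EX by (simp add: Bochner_Integration.integral_sum e_def)
    then show ?thesis
      by (simp only: cmod_square_sum_cis) (simp add: algebra_simps)
  qed
  define d1 where "d1 = (\<lambda>k. Re (c k) * e k)"
  define d2 where "d2 = (\<lambda>k. Im (c k) * e k)"
  have dd: "Re (c k * cnj (c l)) * (e k * e l) = d1 k * d1 l + d2 k * d2 l" for k l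
    by (simp add: d1_def d2_def algebra_simps)
  have rem: "0 \<le> (\<Sum>k<N. \<Sum>l<N. Re (c k * cnj (c l)) * (e k * e l) *
     (cv (u k) (u l) * exp (cv (u k) (u l)) - exp (cv (u k) (u l)) + 1))"
    unfolding dd distrib_right sum.distrib
    using covariance_exp_remainder_psd[of "{..<N}" X d1] covariance_exp_remainder_psd[of "{..<N}" X d2] XX
    unfolding EXX by simp
  have g: "(\<Sum>k<N. \<Sum>l<N. Re (c k * cnj (c l) * cis (X k \<omega> - X l \<omega>)) * cv (u k) (u l)) \<le>
     \<Lambda> * (\<Sum>p<n. (cmod (G (\<lambda>p. Z p \<omega>) p))\<^sup>2)" for \<omega>
  proof -
    let ?g = "\<lambda>p. \<Sum>k<N. c k * of_real (u k p) * cis (X k \<omega>)"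
    have Gg: "G (\<lambda>p. Z p \<omega>) p = \<i> * ?g p" for p
      by (simp add: FG'(2) X_def sum_distrib_left mult_ac)
    have "(\<Sum>k<N. \<Sum>l<N. Re (c k * cnj (c l) * cis (X k \<omega> - X l \<omega>)) * cv (u k) (u l)) =
      (\<Sum>k<N. \<Sum>l<N. \<Sum>p<n. \<Sum>q<n. Re (c k * cnj (c l) * cis (X k \<omega> - X l \<omega>)) * (u k p * u l q * r p q))"
      by (simp add: cv_def sum_distrib_left)
    also have "\<dots> = (\<Sum>p<n. \<Sum>q<n. \<Sum>k<N. \<Sum>l<N. Re (c k * cnj (c l) * cis (X k \<omega> - X l \<omega>)) * (u k p * u l q * r p q))"
      by (rule sum_swap_pairs)
    also have "\<dots> = (\<Sum>p<n. \<Sum>q<n. r p q * Re (?g p * cnj (?g q)))"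
    proof (intro sum.cong refl)
      fix p q
      have "?g p * cnj (?g q) = (\<Sum>k<N. \<Sum>l<N. (c k * of_real (u k p) * cis (X k \<omega>)) * (cnj (c l) * of_real (u l q) * cis (- X l \<omega>)))"
        by (simp add: sum_product cis_cnj)
      also have "\<dots> = (\<Sum>k<N. \<Sum>l<N. of_real (u k p * u l q) * (c k * cnj (c l) * cis (X k \<omega> - X l \<omega>)))"
      proof (intro sum.cong refl)
        fix k l
        have "cis (X k \<omega> - X l \<omega>) = cis (X k \<omega>) * cis (- X l \<omega>)" by (simp add: cis_mult)
        then show "(c k * of_real (u k p) * cis (X k \<omega>)) * (cnj (c l) * of_real (u l q) * cis (- X l \<omega>)) =
            of_real (u k p * u l q) * (c k * cnj (c l) * cis (X k \<omega> - X l \<omega>))" by simp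
      qed
      finally have 1: "r p q * Re (?g p * cnj (?g q)) =
          r p q * (\<Sum>k<N. \<Sum>l<N. Re (of_real (u k p * u l q) * (c k * cnj (c l) * cis (X k \<omega> - X l \<omega>))))"
        by (simp only: Re_sum)
      have 2: "Re (of_real a * z) = a * Re z" for a z by simp
      show "(\<Sum>k<N. \<Sum>l<N. Re (c k * cnj (c l) * cis (X k \<omega> - X l \<omega>)) * (u k p * u l q * r p q)) =
          r p q * Re (?g p * cnj (?g q))"
        unfolding 1 2 sum_distrib_left by (intro sum.cong refl) simp
    qed
    also have "\<dots> = (\<Sum>p<n. \<Sum>q<n. Re (?g p) * Re (?g q) * r p q) + (\<Sum>p<n. \<Sum>q<n. Im (?g p) * Im (?g q) * r p q)"
    proof -
      have "a * Re (v * cnj w) = Re v * Re w * a + Im v * Im w * a" for a v w by (simp add: algebra_simps)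
      then show ?thesis by (simp only: sum.distrib)
    qed
    also have "\<dots> \<le> \<Lambda> * (\<Sum>p<n. (Re (?g p))\<^sup>2) + \<Lambda> * (\<Sum>p<n. (Im (?g p))\<^sup>2)"
      by (intro add_mono lam)
    also have "\<dots> = \<Lambda> * (\<Sum>p<n. (cmod (?g p))\<^sup>2)"
      by (simp add: cmod_power2 sum.distrib distrib_left del: Re_sum Im_sum)
    also have "\<dots> = \<Lambda> * (\<Sum>p<n. (cmod (G (\<lambda>p. Z p \<omega>) p))\<^sup>2)"
      by (simp add: Gg norm_mult)
    finally show ?thesis .
  qed
  have G2: "(cmod (G (\<lambda>p. Z p \<omega>) q))\<^sup>2 =
     (\<Sum>k<N. \<Sum>l<N. Re ((c k * (\<i> * of_real (u k q))) * cnj (c l * (\<i> * of_real (u l q))) * cis (X k \<omega> - X l \<omega>)))" for \<omega> q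
    unfolding FG'(2) X_def by (rule cmod_square_sum_cis)
  have intG: "integrable M (\<lambda>\<omega>. \<Sum>p<n. (cmod (G (\<lambda>p. Z p \<omega>) p))\<^sup>2)"
    unfolding G2 by (intro Bochner_Integration.integrable_sum integrable_Re integrable_mult_right intd)
  have "expectation (\<lambda>\<omega>. (cmod (F (\<lambda>p. Z p \<omega>) - expectation (\<lambda>\<omega>. F (\<lambda>p. Z p \<omega>))))\<^sup>2) =
     (\<Sum>k<N. \<Sum>l<N. Re (c k * cnj (c l)) * (e k * e l * exp (cv (u k) (u l)))) -
     (\<Sum>k<N. \<Sum>l<N. Re (c k * cnj (c l)) * (e k * e l))"
    using centred_second_moment[OF intF intF2] EF2 EF by simp
  also have "\<dots> \<le> (\<Sum>k<N. \<Sum>l<N. Re (c k * cnj (c l)) * (e k * e l * exp (cv (u k) (u l))) * cv (u k) (u l))"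
  proof -
    have "Re w * v * (x * y - y + 1) = Re w * (v * y) * x - (Re w * (v * y) - Re w * v)" for w and v x y :: real
      by (simp add: algebra_simps)
    from rem[unfolded this sum_subtractf] show ?thesis by linarith
  qed
  also have "\<dots> = expectation (\<lambda>\<omega>. \<Sum>k<N. \<Sum>l<N. Re (c k * cnj (c l) * cis (X k \<omega> - X l \<omega>)) * cv (u k) (u l))"
    by (subst integral_double_sum)
      (intro integrable_mult_left integrable_Re integrable_mult_right intd, simp only: integral_mult_left_zero ReE)
  also have "\<dots> \<le> expectation (\<lambda>\<omega>. \<Lambda> * (\<Sum>p<n. (cmod (G (\<lambda>p. Z p \<omega>) p))\<^sup>2))"
    by (intro integral_mono g integrable_mult_right intG Bochner_Integration.integrable_sum integrable_mult_left integrable_Re intd)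
  finally show "expectation (\<lambda>\<omega>. (cmod (F (\<lambda>p. Z p \<omega>) - expectation (\<lambda>\<omega>. F (\<lambda>p. Z p \<omega>))))\<^sup>2) \<le>
       \<Lambda> * expectation (\<lambda>\<omega>. \<Sum>p<n. (cmod (G (\<lambda>p. Z p \<omega>) p))\<^sup>2)"
    by simp
qed

section \<open>Mean square approximation by trigonometric polynomials\<close>

lemma (in prob_space) gaussian_variable_expectation_cis:
  assumes g: "gaussian_variable M X" and X: "integrable M X" "expectation X = 0"
  shows "expectation (\<lambda>\<omega>. cis (X \<omega>)) = of_real (exp (- expectation (\<lambda>\<omega>. (X \<omega>)\<^sup>2) / 2))"
proof -
  have meas[measurable]: "X \<in> borel_measurable M" using g by (simp add: gaussian_variable_def)
  from g obtain \<mu> where "(AE \<omega> in M. X \<omega> = \<mu>) \<or> (\<exists>\<sigma>>0. distributed M lborel X (normal_density \<mu> \<sigma>))"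
    by (auto simp: gaussian_variable_def)
  then show ?thesis
  proof (elim disjE exE conjE)
    assume ae: "AE \<omega> in M. X \<omega> = \<mu>"
    have "expectation X = expectation (\<lambda>_. \<mu>)" by (rule integral_cong_AE) (use ae in auto)
    then have m: "\<mu> = 0" using X by (simp add: prob_space)
    have "expectation (\<lambda>\<omega>. (X \<omega>)\<^sup>2) = expectation (\<lambda>_. 0)"
      by (rule integral_cong_AE) (use ae m in auto)
    moreover have "expectation (\<lambda>\<omega>. cis (X \<omega>)) = expectation (\<lambda>_. 1)"
    proof (rule integral_cong_AE)
      show "(\<lambda>\<omega>. cis (X \<omega>)) \<in> borel_measurable M" unfolding cis_conv_exp by measurable
    qed (use ae m in auto)
    ultimately show ?thesis by (simp add: prob_space)
  next
    fix \<sigma> :: real assume s: "0 < \<sigma>" and d: "distributed M lborel X (normal_density \<mu> \<sigma>)"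
    have m: "\<mu> = 0" using normal_distributed_expectation[OF s d] X by simp
    have v: "expectation (\<lambda>\<omega>. (X \<omega>)\<^sup>2) = \<sigma>\<^sup>2" using normal_distributed_variance[OF s d] X by simp
    have "distributed M lborel (\<lambda>x. X x / \<sigma>) std_normal_density"
      using normal_standard_normal_convert[OF s, of X \<mu>] d m by simp
    then have dd: "distr M lborel (\<lambda>x. X x / \<sigma>) = std_normal_distribution"
      by (simp add: distributed_def)
    have "complex_of_real (exp (- (\<sigma>\<^sup>2) / 2)) = char std_normal_distribution \<sigma>"
      by (simp add: char_std_normal_distribution)
    also have "\<dots> = (\<integral>x. iexp (\<sigma> * x) \<partial>distr M lborel (\<lambda>x. X x / \<sigma>))" by (simp add: char_def dd)
    also have "\<dots> = expectation (\<lambda>\<omega>. iexp (\<sigma> * (X \<omega> / \<sigma>)))" by (rule integral_distr) auto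
    also have "\<dots> = expectation (\<lambda>\<omega>. cis (X \<omega>))" using s by (simp add: cis_conv_exp)
    finally show ?thesis by (simp add: v)
  qed
qed

lemma (in prob_space) real_distribution_distr_borel:
  "X \<in> borel_measurable M \<Longrightarrow> real_distribution (distr M borel X)"
  by (intro real_distribution.intro prob_space_distr real_distribution_axioms.intro) auto

lemma (in prob_space) char_distr:
  assumes [measurable]: "X \<in> borel_measurable M"
  shows "char (distr M borel X) t = expectation (\<lambda>\<omega>. cis (t * X \<omega>))"
  unfolding char_def by (subst integral_distr) (auto simp: cis_conv_exp)

lemma (in prob_space) distr_eqI_cis:
  assumes [measurable]: "X \<in> borel_measurable M" "Y \<in> borel_measurable M"
    and "\<And>t. expectation (\<lambda>\<omega>. cis (t * X \<omega>)) = expectation (\<lambda>\<omega>. cis (t * Y \<omega>))"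
  shows "distr M borel X = distr M borel Y"
  using assms by (intro Levy_uniqueness real_distribution_distr_borel) (auto simp: char_distr)

text \<open>
  A monotone function on \<open>{- \<bar>t\<bar>..\<bar>t\<bar>}\<close> takes values between those at the endpoints. The right-hand side
  serves as a dominating function.
\<close>

lemma mono_square_le:
  fixes T :: "real \<Rightarrow> real"
  assumes "mono T" "\<bar>u\<bar> \<le> \<bar>t\<bar>"
  shows "(T t - T u)\<^sup>2 \<le> 4 * ((T t)\<^sup>2 + (T (- t))\<^sup>2)"
proof -
  have sq: "b\<^sup>2 \<le> x\<^sup>2 + y\<^sup>2" if "x \<le> b" "b \<le> y" for b x y :: real
  proof (cases "0 \<le> b")
    case True
    then have "b\<^sup>2 \<le> y\<^sup>2" using that by (intro power_mono) auto
    then show ?thesis by (simp add: add_increasing)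
  next
    case False
    then have "(- b)\<^sup>2 \<le> (- x)\<^sup>2" using that by (intro power_mono) auto
    then show ?thesis by (simp add: add_increasing2)
  qed
  have "(T u)\<^sup>2 \<le> (T (- \<bar>t\<bar>))\<^sup>2 + (T \<bar>t\<bar>)\<^sup>2"
    using assms by (intro sq) (auto intro!: monoD[OF assms(1)])
  also have "\<dots> = (T t)\<^sup>2 + (T (- t))\<^sup>2" by (cases "0 \<le> t") auto
  finally have "2 * (T u)\<^sup>2 \<le> 2 * (T t)\<^sup>2 + 2 * (T (- t))\<^sup>2" by simp
  moreover have "(T t - T u)\<^sup>2 \<le> 2 * (T t)\<^sup>2 + 2 * (T u)\<^sup>2"
    using zero_le_power2[of "T t + T u"] by (simp add: power2_eq_square algebra_simps)
  moreover have "0 \<le> (T (- t))\<^sup>2" by simp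
  ultimately show ?thesis unfolding distrib_left by linarith
qed

lemma abs_sin_scaled_le:
  fixes w t :: real assumes "0 < w" shows "\<bar>sin (w * t) / w\<bar> \<le> \<bar>t\<bar>"
  using abs_sin_x_le_abs_x[of "w * t"] assms by (simp add: abs_mult field_simps)

text \<open>
  The functions \<open>t \<mapsto> m * sin (t / m)\<close> are periodic, do not exceed \<open>\<bar>t\<bar>\<close> and converge to the
  identity. Composition with them makes any function periodic without increasing its size.
\<close>

lemma sin_scaled_tendsto: "(\<lambda>n. sin (t / real (Suc n)) * real (Suc n)) \<longlonglongrightarrow> t"
proof (cases "t = 0")
  case False
  have "(\<lambda>n. t / real (Suc n)) \<longlonglongrightarrow> 0" by (rule LIMSEQ_Suc[OF lim_const_over_n])
  then have lim: "filterlim (\<lambda>n. t / real (Suc n)) (at 0) sequentially"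
    using False by (intro filterlim_atI) auto
  have "((\<lambda>x::real. sin x / x) \<longlongrightarrow> 1) (at 0)" using DERIV_sin[of 0] by (simp add: DERIV_def)
  from tendsto_mult_left[OF filterlim_compose[OF this lim], of t]
  have "(\<lambda>n. t * (sin (t / real (Suc n)) / (t / real (Suc n)))) \<longlonglongrightarrow> t" by simp
  moreover have "(\<lambda>n. t * (sin (t / real (Suc n)) / (t / real (Suc n)))) = (\<lambda>n. sin (t / real (Suc n)) * real (Suc n))"
    using False by (simp del: of_nat_Suc)
  ultimately show ?thesis by simp
qed simp

text \<open>
  The function \<open>t \<mapsto> T (sin (w * t) / w)\<close> is close to \<open>T\<close> in mean square for small \<open>w\<close>, by dominated
  convergence. It is a continuous function of \<open>sin (w * t)\<close>, so Weierstrass' theorem on \<open>{-1..1}\<close>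
  approximates it uniformly by a polynomial in \<open>sin (w * t)\<close>. The symmetry of \<open>\<mu>\<close> makes \<open>T (- t)\<close> square integrable.
\<close>

lemma trig_polynomial_L2_approx:
  fixes T :: "real \<Rightarrow> real"
  assumes \<mu>: "real_distribution \<mu>" and sym: "distr \<mu> borel uminus = \<mu>"
    and T: "continuous_on UNIV T" "mono T" "integrable \<mu> (\<lambda>t. (T t)\<^sup>2)" and e: "0 < e"
  obtains w g where "real_polynomial_function g"
    "integrable \<mu> (\<lambda>t. (T t - g (sin (w * t)))\<^sup>2)" "(\<integral>t. (T t - g (sin (w * t)))\<^sup>2 \<partial>\<mu>) \<le> e"
proof -
  interpret real_distribution \<mu> by fact
  have [measurable]: "T \<in> borel_measurable borel" by (rule borel_measurable_continuous_onI[OF T(1)])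
  have b: "integrable \<mu> (\<lambda>t. 4 * ((T t)\<^sup>2 + (T (- t))\<^sup>2))"
  proof -
    have "integrable (distr \<mu> borel uminus) (\<lambda>t. (T t)\<^sup>2)" using T(3) sym by simp
    then have "integrable \<mu> (\<lambda>t. (T (- t))\<^sup>2)" by (subst (asm) integrable_distr_eq) auto
    then show ?thesis using T(3) by simp
  qed
  let ?s = "\<lambda>n t. sin (t / real (Suc n)) * real (Suc n)"
  have "(\<lambda>n. \<integral>t. (T t - T (?s n t))\<^sup>2 \<partial>\<mu>) \<longlonglongrightarrow> (\<integral>t. 0 \<partial>\<mu>)"
  proof (rule integral_dominated_convergence[OF _ _ b])
    show "AE t in \<mu>. (\<lambda>n. (T t - T (?s n t))\<^sup>2) \<longlonglongrightarrow> 0"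
    proof (rule AE_I2)
      fix t
      have "isCont T t" using T(1) by (simp add: continuous_on_eq_continuous_at)
      from isCont_tendsto_compose[OF this sin_scaled_tendsto]
      have "(\<lambda>n. (T t - T (?s n t))\<^sup>2) \<longlonglongrightarrow> (T t - T t)\<^sup>2" by (intro tendsto_intros)
      then show "(\<lambda>n. (T t - T (?s n t))\<^sup>2) \<longlonglongrightarrow> 0" by simp
    qed
    fix n
    show "AE t in \<mu>. norm ((T t - T (?s n t))\<^sup>2) \<le> 4 * ((T t)\<^sup>2 + (T (- t))\<^sup>2)"
    proof (rule AE_I2)
      fix t
      have "\<bar>?s n t\<bar> \<le> \<bar>t\<bar>" using abs_sin_scaled_le[of "1 / real (Suc n)" t] by simp
      from mono_square_le[OF T(2) this]
      show "norm ((T t - T (?s n t))\<^sup>2) \<le> 4 * ((T t)\<^sup>2 + (T (- t))\<^sup>2)" by simp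
    qed
  qed measurable
  then have "\<forall>\<^sub>F n in sequentially. (\<integral>t. (T t - T (?s n t))\<^sup>2 \<partial>\<mu>) < e / 4"
    using e by (intro order_tendstoD(2)[where y = "\<integral>t. 0 \<partial>\<mu>"]) auto
  then obtain n where n: "(\<integral>t. (T t - T (?s n t))\<^sup>2 \<partial>\<mu>) < e / 4" by (auto dest: eventually_happens)
  define w where "w = 1 / real (Suc n)"
  have w: "0 < w" by (simp add: w_def)
  \<comment> \<open>the function of \<open>sin (w * t)\<close> to which Weierstrass' theorem is applied\<close>
  define f where "f = (\<lambda>x. T (x / w))"
  have fs: "f (sin (w * t)) = T (?s n t)" for t by (simp add: f_def w_def)
  have "continuous_on {-1..1} f"
    unfolding f_def using w by (intro continuous_on_compose2[OF T(1)] continuous_intros) auto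
  from Stone_Weierstrass_real_polynomial_function[OF compact_Icc this, of "sqrt (e / 4)"] e
  obtain g where g: "real_polynomial_function g" "\<And>x. x \<in> {-1..1} \<Longrightarrow> \<bar>f x - g x\<bar> < sqrt (e / 4)"
    by auto
  have gm[measurable]: "g \<in> borel_measurable borel"
    using g(1) by (intro borel_measurable_continuous_onI continuous_at_imp_continuous_on)
      (simp add: continuous_real_polymonial_function)
  have i1: "integrable \<mu> (\<lambda>t. (T t - T (?s n t))\<^sup>2)"
  proof (rule Bochner_Integration.integrable_bound[OF b])
    show "AE t in \<mu>. norm ((T t - T (?s n t))\<^sup>2) \<le> norm (4 * ((T t)\<^sup>2 + (T (- t))\<^sup>2))"
    proof (rule AE_I2)
      fix t
      have "\<bar>?s n t\<bar> \<le> \<bar>t\<bar>" using abs_sin_scaled_le[of "1 / real (Suc n)" t] by simp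
      from mono_square_le[OF T(2) this]
      show "norm ((T t - T (?s n t))\<^sup>2) \<le> norm (4 * ((T t)\<^sup>2 + (T (- t))\<^sup>2))" by simp
    qed
  qed measurable
  have le: "(T t - g (sin (w * t)))\<^sup>2 \<le> 2 * (T t - T (?s n t))\<^sup>2 + e / 2" for t
  proof -
    have "\<bar>T (?s n t) - g (sin (w * t))\<bar> \<le> sqrt (e / 4)"
      using g(2)[of "sin (w * t)"] fs[of t] by (simp add: less_imp_le)
    then have "\<bar>T (?s n t) - g (sin (w * t))\<bar>\<^sup>2 \<le> (sqrt (e / 4))\<^sup>2" by (rule power_mono) simp
    then have "(T (?s n t) - g (sin (w * t)))\<^sup>2 \<le> e / 4" using e by simp
    moreover have "(a + b)\<^sup>2 \<le> 2 * a\<^sup>2 + 2 * b\<^sup>2" for a b :: real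
      using zero_le_power2[of "a - b"] by (simp add: power2_eq_square algebra_simps)
    from this[of "T t - T (?s n t)" "T (?s n t) - g (sin (w * t))"]
    have "(T t - g (sin (w * t)))\<^sup>2 \<le> 2 * (T t - T (?s n t))\<^sup>2 + 2 * (T (?s n t) - g (sin (w * t)))\<^sup>2" by simp
    ultimately show ?thesis by linarith
  qed
  have i2: "integrable \<mu> (\<lambda>t. (T t - g (sin (w * t)))\<^sup>2)"
  proof (rule Bochner_Integration.integrable_bound)
    show "integrable \<mu> (\<lambda>t. 2 * (T t - T (?s n t))\<^sup>2 + e / 2)" using i1 by simp
    show "AE t in \<mu>. norm ((T t - g (sin (w * t)))\<^sup>2) \<le> norm (2 * (T t - T (?s n t))\<^sup>2 + e / 2)"
      using le e by (intro AE_I2) (simp add: abs_of_nonneg)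
  qed measurable
  have "(\<integral>t. (T t - g (sin (w * t)))\<^sup>2 \<partial>\<mu>) \<le> (\<integral>t. 2 * (T t - T (?s n t))\<^sup>2 + e / 2 \<partial>\<mu>)"
    using le i1 i2 by (intro integral_mono) auto
  also have "\<dots> = 2 * (\<integral>t. (T t - T (?s n t))\<^sup>2 \<partial>\<mu>) + e / 2"
    using i1 prob_space by simp
  also have "\<dots> \<le> e" using n by simp
  finally show ?thesis using that[OF g(1) i2] by blast
qed

section \<open>Concentration of quadratic forms\<close>

lemma (in prob_space) expectation_le_bound:
  fixes f :: "'a \<Rightarrow> real"
  assumes "0 \<le> c" "\<And>\<omega>. f \<omega> \<le> c"
  shows "expectation f \<le> c"
  using assms by (cases "integrable M f") (auto intro: integral_le_const simp: not_integrable_integral_eq)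

text \<open>
  A centred Gaussian sequence with covariances \<open>r\<close> whose operator norms are bounded by \<open>\<Lambda>\<close>. Joint
  Gaussianity is expressed by the characteristic function of linear combinations.
\<close>

locale gaussian_sequence = prob_space M for M :: "'w measure" +
  fixes Z :: "nat \<Rightarrow> 'w \<Rightarrow> real" and r :: "nat \<Rightarrow> nat \<Rightarrow> real" and \<Lambda> v :: real
  assumes Z_measurable[measurable]: "\<And>i. Z i \<in> borel_measurable M"
    and ZZ_integrable: "\<And>i j. integrable M (\<lambda>\<omega>. Z i \<omega> * Z j \<omega>)"
    and ZZ_expectation: "\<And>i j. expectation (\<lambda>\<omega>. Z i \<omega> * Z j \<omega>) = r i j"
    and cis_expectation: "\<And>n u. expectation (\<lambda>\<omega>. cis (frequency_sum n u (\<lambda>i. Z i \<omega>))) =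
       of_real (exp (- (\<Sum>i<n. \<Sum>j<n. u i * u j * r i j) / 2))"
    and variance_eq: "\<And>i. r i i = v"
    and covariance_bound: "\<And>n x. (\<Sum>i<n. \<Sum>j<n. x i * x j * r i j) \<le> \<Lambda> * (\<Sum>i<n. (x i)\<^sup>2)"
    and \<Lambda>_pos: "0 < \<Lambda>"
begin

lemma cis_expectation_single: "expectation (\<lambda>\<omega>. cis (t * Z i \<omega>)) = of_real (exp (- (t\<^sup>2 * v) / 2))"
proof -
  let ?u = "\<lambda>j. if j = i then t else 0"
  have "frequency_sum (Suc i) ?u z = t * z i" for z
    by (simp add: frequency_sum_def if_distrib[of "\<lambda>u. u * _"] cong: if_cong)
  moreover have "(\<Sum>p<Suc i. \<Sum>q<Suc i. ?u p * ?u q * r p q) = t\<^sup>2 * v"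
    by (simp add: if_distrib[of "\<lambda>u. u * _"] if_distrib[of "\<lambda>u. _ * u"] variance_eq power2_eq_square cong: if_cong)
  ultimately show ?thesis using cis_expectation[of "Suc i" ?u] by simp
qed

text \<open>
  By Levy's theorem, since the characteristic function depends on the common variance only.
\<close>

lemma same_distribution: "distr M borel (Z i) = distr M borel (Z j)"
  by (rule distr_eqI_cis) (simp_all add: cis_expectation_single)

lemma symmetric_distribution: "distr (distr M borel (Z i)) borel uminus = distr M borel (Z i)"
proof -
  have "distr (distr M borel (Z i)) borel uminus = distr M borel (\<lambda>\<omega>. - Z i \<omega>)"
    by (subst distr_distr) (auto simp: comp_def)
  also have "\<dots> = distr M borel (Z i)"
    using cis_expectation_single[of "- _" i]
    by (intro distr_eqI_cis) (simp_all add: cis_expectation_single)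
  finally show ?thesis .
qed

lemma trig_polynomial_approx:
  fixes T :: "real \<Rightarrow> real"
  assumes T: "continuous_on UNIV T" "mono T" "\<And>i. integrable M (\<lambda>\<omega>. (T (Z i \<omega>))\<^sup>2)" and e: "0 < e"
  obtains w g where "real_polynomial_function g"
    "\<And>i. integrable M (\<lambda>\<omega>. (T (Z i \<omega>) - g (sin (w * Z i \<omega>)))\<^sup>2)"
    "\<And>i. expectation (\<lambda>\<omega>. (T (Z i \<omega>) - g (sin (w * Z i \<omega>)))\<^sup>2) \<le> e"
proof -
  have [measurable]: "T \<in> borel_measurable borel" by (rule borel_measurable_continuous_onI[OF T(1)])
  let ?\<mu> = "distr M borel (Z 0)"
  have "integrable ?\<mu> (\<lambda>t. (T t)\<^sup>2)" using T(3)[of 0] by (subst integrable_distr_eq) auto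
  then obtain w g where g: "real_polynomial_function g"
    "integrable ?\<mu> (\<lambda>t. (T t - g (sin (w * t)))\<^sup>2)" "(\<integral>t. (T t - g (sin (w * t)))\<^sup>2 \<partial>?\<mu>) \<le> e"
    by (rule trig_polynomial_L2_approx[OF real_distribution_distr_borel[OF Z_measurable]
          symmetric_distribution T(1,2) _ e]) blast
  have [measurable]: "g \<in> borel_measurable borel"
    using g(1) by (intro borel_measurable_continuous_onI continuous_at_imp_continuous_on)
      (simp add: continuous_real_polymonial_function)
  show ?thesis
  proof (rule that[OF g(1)])
    fix i
    have "integrable (distr M borel (Z i)) (\<lambda>t. (T t - g (sin (w * t)))\<^sup>2)"
      using g(2) same_distribution[of 0 i] by simp
    then show "integrable M (\<lambda>\<omega>. (T (Z i \<omega>) - g (sin (w * Z i \<omega>)))\<^sup>2)"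
      by (subst (asm) integrable_distr_eq) auto
    have "(\<integral>t. (T t - g (sin (w * t)))\<^sup>2 \<partial>distr M borel (Z i)) \<le> e"
      using g(3) same_distribution[of 0 i] by simp
    then show "expectation (\<lambda>\<omega>. (T (Z i \<omega>) - g (sin (w * Z i \<omega>)))\<^sup>2) \<le> e"
      by (subst (asm) integral_distr) auto
  qed
qed

text \<open>
  The gradient of the quadratic form has the entries \<open>2 * h (z r) * (A \<tau>) r\<close>, and its squared length is
  bounded by the squared operator norm of \<open>A\<close> times \<open>n\<close>, up to constants.
\<close>

lemma quad_form_trig_variance:
  assumes A: "sym_mat n A" "\<And>x. sqnorm n (matvec n A x) \<le> C * sqnorm n x" and C: "0 \<le> C"
    and B: "\<And>t. \<bar>\<tau> t\<bar> \<le> B" "\<And>t. \<bar>h t\<bar> \<le> B"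
    and \<tau>: "\<And>p. p < n \<Longrightarrow> trig_grad n (\<lambda>z. of_real (\<tau> (z p))) (\<lambda>z r. if r = p then of_real (h (z p)) else 0)"
  defines "q \<equiv> \<lambda>\<omega>. quad_form n A (\<lambda>p. \<tau> (Z p \<omega>))"
  shows "integrable M q" "integrable M (\<lambda>\<omega>. (q \<omega> - expectation q)\<^sup>2)"
    "expectation (\<lambda>\<omega>. (q \<omega> - expectation q)\<^sup>2) \<le> \<Lambda> * (4 * B\<^sup>2 * (C * (real n * B\<^sup>2)))"
proof -
  obtain G where G: "trig_grad n (\<lambda>z. of_real (quad_form n A (\<lambda>p. \<tau> (z p)))) G"
    "\<And>z r. r < n \<Longrightarrow> G z r = of_real (2 * h (z r) * matvec n A (\<lambda>p. \<tau> (z p)) r)"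
    using trig_grad_quadratic[OF A(1) \<tau>] by blast
  note P = gaussian_trig_poincare[OF Z_measurable ZZ_integrable ZZ_expectation cis_expectation covariance_bound G(1), folded q_def]
  have iq: "integrable M q" using P(1) by (simp only: q_def complex_of_real_integrable_eq)
  then show "integrable M q" .
  have iq2: "integrable M (\<lambda>\<omega>. (q \<omega>)\<^sup>2)" using P(2) by (simp add: q_def norm_power)
  show "integrable M (\<lambda>\<omega>. (q \<omega> - expectation q)\<^sup>2)"
    unfolding power2_diff using iq iq2 by simp
  have "expectation (\<lambda>\<omega>. (q \<omega> - expectation q)\<^sup>2) =
     expectation (\<lambda>\<omega>. (cmod (of_real (q \<omega>) - expectation (\<lambda>\<omega>. complex_of_real (q \<omega>))))\<^sup>2)"
    by (simp add: norm_power flip: of_real_diff)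
  also have "\<dots> \<le> \<Lambda> * expectation (\<lambda>\<omega>. \<Sum>p<n. (cmod (G (\<lambda>p. Z p \<omega>) p))\<^sup>2)"
    using P(3) by (simp add: q_def)
  also have "\<dots> \<le> \<Lambda> * (4 * B\<^sup>2 * (C * (real n * B\<^sup>2)))"
  proof (rule mult_left_mono)
    have "(\<Sum>p<n. (cmod (G z p))\<^sup>2) \<le> 4 * B\<^sup>2 * (C * (real n * B\<^sup>2))" for z
    proof -
      have "(\<Sum>p<n. (cmod (G z p))\<^sup>2) = (\<Sum>p<n. 4 * (h (z p))\<^sup>2 * (matvec n A (\<lambda>p. \<tau> (z p)) p)\<^sup>2)"
        by (intro sum.cong refl) (simp add: G(2) norm_mult power_mult_distrib)
      also have "\<dots> \<le> (\<Sum>p<n. 4 * B\<^sup>2 * (matvec n A (\<lambda>p. \<tau> (z p)) p)\<^sup>2)"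
        using power_mono[OF B(2) abs_ge_zero, of _ 2] by (intro sum_mono mult_right_mono mult_left_mono) auto
      also have "\<dots> = 4 * B\<^sup>2 * sqnorm n (matvec n A (\<lambda>p. \<tau> (z p)))"
        by (simp add: sqnorm_def sum_distrib_left)
      also have "\<dots> \<le> 4 * B\<^sup>2 * (C * sqnorm n (\<lambda>p. \<tau> (z p)))"
        by (intro mult_left_mono A(2)) auto
      also have "\<dots> \<le> 4 * B\<^sup>2 * (C * (real n * B\<^sup>2))"
      proof -
        have "sqnorm n (\<lambda>p. \<tau> (z p)) \<le> (\<Sum>p<n. B\<^sup>2)"
          unfolding sqnorm_def using power_mono[OF B(1) abs_ge_zero, of _ 2] by (intro sum_mono) auto
        then show ?thesis using C by (intro mult_left_mono) auto
      qed
      finally show ?thesis .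
    qed
    then show "expectation (\<lambda>\<omega>. \<Sum>p<n. (cmod (G (\<lambda>p. Z p \<omega>) p))\<^sup>2) \<le> 4 * B\<^sup>2 * (C * (real n * B\<^sup>2))"
      using C by (intro expectation_le_bound) auto
  qed (use \<Lambda>_pos in simp)
  finally show "expectation (\<lambda>\<omega>. (q \<omega> - expectation q)\<^sup>2) \<le> \<Lambda> * (4 * B\<^sup>2 * (C * (real n * B\<^sup>2)))" .
qed

end

text \<open>
  The difference is the pairing of \<open>x - y\<close> with \<open>A (x + y)\<close>. It is split by a weighted inequality between
  arithmetic and geometric mean, so that only squared lengths have to be integrated later.
\<close>

lemma quad_form_diff_le:
  assumes A: "sym_mat n A" "\<And>x. sqnorm n (matvec n A x) \<le> C * sqnorm n x" and C: "0 \<le> C" and h: "0 < \<eta>"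
  shows "\<bar>quad_form n A x - quad_form n A y\<bar> \<le>
    (1 / (2 * \<eta>) + \<eta> * C) * sqnorm n (\<lambda>i. x i - y i) + 4 * \<eta> * C * sqnorm n x"
proof -
  have "quad_form n A x - quad_form n A y = (\<Sum>i<n. (x i - y i) * matvec n A (\<lambda>i. x i + y i) i)"
  proof -
    have "matvec n A (\<lambda>i. x i + y i) i = matvec n A x i + matvec n A y i" for i
      by (simp add: matvec_def sum.distrib distrib_left)
    then have "(\<Sum>i<n. (x i - y i) * matvec n A (\<lambda>i. x i + y i) i) =
       quad_form n A x + (\<Sum>i<n. x i * matvec n A y i) - (\<Sum>i<n. y i * matvec n A x i) - quad_form n A y"
      by (simp add: quad_form_def algebra_simps sum.distrib sum_subtractf)
    also have "(\<Sum>i<n. x i * matvec n A y i) = (\<Sum>i<n. y i * matvec n A x i)"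
      using matvec_symmetric[OF A(1), of x y] by (simp add: mult.commute)
    finally show ?thesis by simp
  qed
  also have "\<bar>\<dots>\<bar> \<le> (\<Sum>i<n. \<bar>(x i - y i) * matvec n A (\<lambda>i. x i + y i) i\<bar>)" by (rule sum_abs)
  also have "\<dots> \<le> (\<Sum>i<n. 1 / (2 * \<eta>) * (x i - y i)\<^sup>2 + \<eta> / 2 * (matvec n A (\<lambda>i. x i + y i) i)\<^sup>2)"
  proof (rule sum_mono)
    fix i
    have "\<bar>a * b\<bar> \<le> 1 / (2 * \<eta>) * a\<^sup>2 + \<eta> / 2 * b\<^sup>2" for a b :: real
    proof -
      have "0 \<le> (\<bar>a\<bar> - \<eta> * \<bar>b\<bar>)\<^sup>2" by simp
      then have "2 * \<eta> * \<bar>a * b\<bar> \<le> a\<^sup>2 + \<eta>\<^sup>2 * b\<^sup>2"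
        by (simp add: power2_diff power_mult_distrib abs_mult mult_ac)
      then have "2 * \<eta> * \<bar>a * b\<bar> / (2 * \<eta>) \<le> (a\<^sup>2 + \<eta>\<^sup>2 * b\<^sup>2) / (2 * \<eta>)"
        using h by (intro divide_right_mono) auto
      then show ?thesis using h by (simp add: add_divide_distrib power2_eq_square)
    qed
    then show "\<bar>(x i - y i) * matvec n A (\<lambda>i. x i + y i) i\<bar> \<le>
      1 / (2 * \<eta>) * (x i - y i)\<^sup>2 + \<eta> / 2 * (matvec n A (\<lambda>i. x i + y i) i)\<^sup>2" .
  qed
  also have "\<dots> = 1 / (2 * \<eta>) * sqnorm n (\<lambda>i. x i - y i) + \<eta> / 2 * sqnorm n (matvec n A (\<lambda>i. x i + y i))"
    by (simp add: sqnorm_def sum.distrib sum_distrib_left)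
  also have "sqnorm n (matvec n A (\<lambda>i. x i + y i)) \<le> C * sqnorm n (\<lambda>i. x i + y i)" by (rule A(2))
  also have "sqnorm n (\<lambda>i. x i + y i) \<le> (\<Sum>i<n. 8 * (x i)\<^sup>2 + 2 * (x i - y i)\<^sup>2)"
    unfolding sqnorm_def
  proof (rule sum_mono)
    fix i
    show "(x i + y i)\<^sup>2 \<le> 8 * (x i)\<^sup>2 + 2 * (x i - y i)\<^sup>2"
      using zero_le_power2[of "3 * x i - y i"] by (simp add: power2_eq_square algebra_simps)
  qed
  also have "\<dots> = 8 * sqnorm n x + 2 * sqnorm n (\<lambda>i. x i - y i)"
    by (simp add: sqnorm_def sum.distrib sum_distrib_left)
  finally have "\<bar>quad_form n A x - quad_form n A y\<bar> \<le> 1 / (2 * \<eta>) * sqnorm n (\<lambda>i. x i - y i) +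
     \<eta> / 2 * (C * (8 * sqnorm n x + 2 * sqnorm n (\<lambda>i. x i - y i)))"
    using C h by (simp add: mult_left_mono)
  then show ?thesis by (simp add: algebra_simps)
qed

lemma (in prob_space) expectation_abs_le:
  fixes X :: "'a \<Rightarrow> real"
  assumes X: "integrable M X" "integrable M (\<lambda>\<omega>. (X \<omega>)\<^sup>2)" and k: "0 < \<kappa>"
  shows "expectation (\<lambda>\<omega>. \<bar>X \<omega>\<bar>) \<le> \<kappa> / 2 + expectation (\<lambda>\<omega>. (X \<omega>)\<^sup>2) / (2 * \<kappa>)"
proof -
  have "expectation (\<lambda>\<omega>. \<bar>X \<omega>\<bar>) \<le> expectation (\<lambda>\<omega>. \<kappa> / 2 + (X \<omega>)\<^sup>2 / (2 * \<kappa>))"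
  proof (rule integral_mono)
    fix \<omega>
    have "0 \<le> (\<bar>X \<omega>\<bar> - \<kappa>)\<^sup>2" by simp
    then have "2 * \<kappa> * \<bar>X \<omega>\<bar> \<le> \<kappa>\<^sup>2 + (X \<omega>)\<^sup>2" by (simp add: power2_diff algebra_simps)
    then have "2 * \<kappa> * \<bar>X \<omega>\<bar> / (2 * \<kappa>) \<le> (\<kappa>\<^sup>2 + (X \<omega>)\<^sup>2) / (2 * \<kappa>)"
      using k by (intro divide_right_mono) auto
    then show "\<bar>X \<omega>\<bar> \<le> \<kappa> / 2 + (X \<omega>)\<^sup>2 / (2 * \<kappa>)"
      using k by (simp add: add_divide_distrib power2_eq_square)
  qed (use X in auto)
  also have "\<dots> = \<kappa> / 2 + expectation (\<lambda>\<omega>. (X \<omega>)\<^sup>2) / (2 * \<kappa>)"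
    using X prob_space by simp
  finally show ?thesis .
qed

lemma quad_form_integrable:
  assumes "\<And>i j. i < n \<Longrightarrow> j < n \<Longrightarrow> integrable M (\<lambda>\<omega>. y i \<omega> * y j \<omega>)"
  shows "integrable M (\<lambda>\<omega>. quad_form n A (\<lambda>i. y i \<omega>))"
    and "(\<integral>\<omega>. quad_form n A (\<lambda>i. y i \<omega>) \<partial>M) = (\<Sum>i<n. \<Sum>j<n. A $$ (i, j) * (\<integral>\<omega>. y i \<omega> * y j \<omega> \<partial>M))"
proof -
  have q: "quad_form n A (\<lambda>i. y i \<omega>) = (\<Sum>i<n. \<Sum>j<n. A $$ (i, j) * (y i \<omega> * y j \<omega>))" for \<omega>
    by (simp add: quad_form_altdef mult.assoc)
  show "integrable M (\<lambda>\<omega>. quad_form n A (\<lambda>i. y i \<omega>))"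
    unfolding q using assms by (intro Bochner_Integration.integrable_sum integrable_mult_right) auto
  have "(\<integral>\<omega>. quad_form n A (\<lambda>i. y i \<omega>) \<partial>M) = (\<Sum>i<n. \<Sum>j<n. (\<integral>\<omega>. A $$ (i, j) * (y i \<omega> * y j \<omega>) \<partial>M))"
    unfolding q using assms by (intro integral_double_sum integrable_mult_right) auto
  then show "(\<integral>\<omega>. quad_form n A (\<lambda>i. y i \<omega>) \<partial>M) = (\<Sum>i<n. \<Sum>j<n. A $$ (i, j) * (\<integral>\<omega>. y i \<omega> * y j \<omega> \<partial>M))"
    by simp
qed

lemma integrable_mult_of_squares:
  fixes f g :: "'a \<Rightarrow> real"
  assumes [measurable]: "f \<in> borel_measurable M" "g \<in> borel_measurable M"
    and "integrable M (\<lambda>x. (f x)\<^sup>2)" "integrable M (\<lambda>x. (g x)\<^sup>2)"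
  shows "integrable M (\<lambda>x. f x * g x)"
proof (rule Bochner_Integration.integrable_bound)
  show "integrable M (\<lambda>x. (f x)\<^sup>2 + (g x)\<^sup>2)" using assms by simp
  have "\<bar>a * b\<bar> \<le> a\<^sup>2 + b\<^sup>2" for a b :: real
  proof -
    have "0 \<le> (\<bar>a\<bar> - \<bar>b\<bar>)\<^sup>2" by simp
    then have "2 * \<bar>a * b\<bar> \<le> a\<^sup>2 + b\<^sup>2" by (simp add: power2_diff abs_mult)
    then show ?thesis by linarith
  qed
  then show "AE x in M. norm (f x * g x) \<le> norm ((f x)\<^sup>2 + (g x)\<^sup>2)"
    by (intro AE_I2) (simp add: abs_of_nonneg)
qed simp

context gaussian_sequence
begin

text \<open>
  The fluctuation is compared with that of the quadratic form in the approximating trigonometric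
  polynomial. The latter has a standard deviation of order \<open>sqrt n\<close> and the approximation costs a small
  multiple of \<open>n\<close> in mean. The bound depends on \<open>A\<close> through its operator norm only.
\<close>

theorem quad_form_concentration:
  fixes T :: "real \<Rightarrow> real"
  assumes T: "continuous_on UNIV T" "mono T" "\<And>i. integrable M (\<lambda>\<omega>. (T (Z i \<omega>))\<^sup>2)"
    and V: "\<And>i. expectation (\<lambda>\<omega>. (T (Z i \<omega>))\<^sup>2) \<le> V" and C: "0 \<le> C" and e: "0 < e"
  obtains N where "\<And>n A. N \<le> n \<Longrightarrow> sym_mat n A \<Longrightarrow>
    (\<And>x. sqnorm n (matvec n A x) \<le> C * sqnorm n x) \<Longrightarrow>
    expectation (\<lambda>\<omega>. \<bar>quad_form n A (\<lambda>i. T (Z i \<omega>)) - expectation (\<lambda>\<omega>. quad_form n A (\<lambda>i. T (Z i \<omega>)))\<bar>) \<le> e * real n"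
proof -
  have [measurable]: "T \<in> borel_measurable borel" by (rule borel_measurable_continuous_onI[OF T(1)])
  have V0: "0 \<le> V"
    by (rule order_trans[OF Bochner_Integration.integral_nonneg V[of 0]]) simp
  \<comment> \<open>the weight \<open>\<eta>\<close> is chosen first, to absorb the squared length of \<open>y\<close>; the accuracy \<open>\<delta>\<close> of the
    approximation then compensates the factor \<open>1 / (2 * \<eta>)\<close>\<close>
  define \<eta> where "\<eta> = e / (12 * (C * (4 * V + 1) + 1))"
  have D: "0 < C * (4 * V + 1) + 1" using C V0 by (intro add_nonneg_pos mult_nonneg_nonneg) auto
  have \<eta>: "0 < \<eta>" using e D by (simp add: \<eta>_def)
  have \<eta>2: "\<eta> * (C * (4 * V + 1)) \<le> e / 12"
  proof -
    have "\<eta> * (C * (4 * V + 1)) \<le> \<eta> * (C * (4 * V + 1) + 1)" using \<eta> by (intro mult_left_mono) auto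
    also have "\<dots> = e / 12"
    proof -
      have "e / (12 * d) * d = e / 12" if "0 < d" for d using that by simp
      from this[OF D] show ?thesis by (simp only: \<eta>_def)
    qed
    finally show ?thesis .
  qed
  define \<delta> where "\<delta> = min 1 (\<eta> * e / 6)"
  have \<delta>: "0 < \<delta>" "\<delta> \<le> 1" "\<delta> / (2 * \<eta>) \<le> e / 12"
    using \<eta> e by (auto simp: \<delta>_def min_def field_simps)
  obtain w g where g: "real_polynomial_function g"
    "\<And>i. integrable M (\<lambda>\<omega>. (T (Z i \<omega>) - g (sin (w * Z i \<omega>)))\<^sup>2)"
    "\<And>i. expectation (\<lambda>\<omega>. (T (Z i \<omega>) - g (sin (w * Z i \<omega>)))\<^sup>2) \<le> \<delta>"
    by (rule trig_polynomial_approx[OF T \<delta>(1)]) blast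
  have [measurable]: "g \<in> borel_measurable borel"
    using g(1) by (intro borel_measurable_continuous_onI continuous_at_imp_continuous_on)
      (simp add: continuous_real_polymonial_function)
  from trig_grad_polynomial_sin[OF g(1), of w] obtain h B where hB:
    "\<And>t. \<bar>g (sin (w * t))\<bar> \<le> B" "\<And>t. \<bar>h t\<bar> \<le> B"
    "\<And>n p. p < n \<Longrightarrow> trig_grad n (\<lambda>z. of_real (g (sin (w * z p)))) (\<lambda>z r. if r = p then of_real (h (z p)) else 0)"
    by blast
  define K where "K = \<Lambda> * (4 * B\<^sup>2 * (C * B\<^sup>2))"
  have K0: "0 \<le> K" using \<Lambda>_pos C by (simp add: K_def)
  \<comment> \<open>from this size on the standard deviation, of order \<open>sqrt n\<close>, is below \<open>n * e / 3\<close>\<close>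
  define N where "N = Suc (nat \<lceil>9 * K / e\<^sup>2\<rceil>)"
  show ?thesis
  proof (rule that[of N])
    fix n A assume n: "N \<le> n" and A: "sym_mat n A" "\<And>x. sqnorm n (matvec n A x) \<le> C * sqnorm n x"
    have npos: "0 < real n" using n by (simp add: N_def)
    have nK: "9 * K \<le> e\<^sup>2 * real n"
    proof -
      have "9 * K / e\<^sup>2 \<le> real n" using n unfolding N_def by linarith
      then show ?thesis using e by (simp add: field_simps)
    qed
    let ?y = "\<lambda>\<omega> i. T (Z i \<omega>)" and ?t = "\<lambda>\<omega> i. g (sin (w * Z i \<omega>))"
    define q where "q = (\<lambda>\<omega>. quad_form n A (?y \<omega>))"
    define q' where "q' = (\<lambda>\<omega>. quad_form n A (?t \<omega>))"
    have iq: "integrable M q"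
      unfolding q_def using T(3) by (intro quad_form_integrable(1) integrable_mult_of_squares) measurable
    note var = quad_form_trig_variance[OF A C hB(1,2) hB(3), folded fun_cong[OF q'_def] q'_def]
    have iD: "integrable M (\<lambda>\<omega>. sqnorm n (\<lambda>i. ?y \<omega> i - ?t \<omega> i))" "integrable M (\<lambda>\<omega>. sqnorm n (?y \<omega>))"
      unfolding sqnorm_def using T(3) g(2) by auto
    have ED: "expectation (\<lambda>\<omega>. sqnorm n (\<lambda>i. ?y \<omega> i - ?t \<omega> i)) \<le> real n * \<delta>"
    proof -
      have "expectation (\<lambda>\<omega>. sqnorm n (\<lambda>i. ?y \<omega> i - ?t \<omega> i)) = (\<Sum>i<n. expectation (\<lambda>\<omega>. (?y \<omega> i - ?t \<omega> i)\<^sup>2))"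
        unfolding sqnorm_def using g(2) by (intro Bochner_Integration.integral_sum)
      also have "\<dots> \<le> (\<Sum>i<n. \<delta>)" by (intro sum_mono g(3))
      finally show ?thesis by simp
    qed
    have EY: "expectation (\<lambda>\<omega>. sqnorm n (?y \<omega>)) \<le> real n * V"
    proof -
      have "expectation (\<lambda>\<omega>. sqnorm n (?y \<omega>)) = (\<Sum>i<n. expectation (\<lambda>\<omega>. (?y \<omega> i)\<^sup>2))"
        unfolding sqnorm_def using T(3) by (intro Bochner_Integration.integral_sum)
      also have "\<dots> \<le> (\<Sum>i<n. V)" by (intro sum_mono V)
      finally show ?thesis by simp
    qed
    have ED': "expectation (\<lambda>\<omega>. \<bar>q \<omega> - q' \<omega>\<bar>) \<le> real n * (e / 6)"
    proof -
      have "expectation (\<lambda>\<omega>. \<bar>q \<omega> - q' \<omega>\<bar>) \<le> expectation (\<lambda>\<omega>.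
         (1 / (2 * \<eta>) + \<eta> * C) * sqnorm n (\<lambda>i. ?y \<omega> i - ?t \<omega> i) + 4 * \<eta> * C * sqnorm n (?y \<omega>))"
        using iq var(1) iD quad_form_diff_le[OF A C \<eta>] unfolding q_def q'_def
        by (intro integral_mono) auto
      also have "\<dots> = (1 / (2 * \<eta>) + \<eta> * C) * expectation (\<lambda>\<omega>. sqnorm n (\<lambda>i. ?y \<omega> i - ?t \<omega> i)) +
          4 * \<eta> * C * expectation (\<lambda>\<omega>. sqnorm n (?y \<omega>))"
        using iD by simp
      also have "\<dots> \<le> (1 / (2 * \<eta>) + \<eta> * C) * (real n * \<delta>) + 4 * \<eta> * C * (real n * V)"
        using \<eta> C by (intro add_mono mult_left_mono ED EY) auto
      also have "\<dots> = real n * (\<delta> / (2 * \<eta>) + \<eta> * C * \<delta> + 4 * \<eta> * C * V)" by (simp add: algebra_simps)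
      also have "\<dots> \<le> real n * (\<delta> / (2 * \<eta>) + \<eta> * C * 1 + 4 * \<eta> * C * V)"
        using \<eta> C \<delta> by (intro mult_left_mono add_mono) auto
      also have "\<dots> = real n * (\<delta> / (2 * \<eta>) + \<eta> * (C * (4 * V + 1)))" by (simp add: algebra_simps)
      also have "\<dots> \<le> real n * (e / 12 + e / 12)"
        using \<eta>2 \<delta> by (intro mult_left_mono add_mono) auto
      finally show ?thesis by simp
    qed
    have Evar: "expectation (\<lambda>\<omega>. \<bar>q' \<omega> - expectation q'\<bar>) \<le> real n * (e / 3)"
    proof -
      have "expectation (\<lambda>\<omega>. \<bar>q' \<omega> - expectation q'\<bar>) \<le> (real n * e / 3) / 2 +
         expectation (\<lambda>\<omega>. (q' \<omega> - expectation q')\<^sup>2) / (2 * (real n * e / 3))"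
        using var npos e by (intro expectation_abs_le) auto
      also have "\<dots> \<le> (real n * e / 3) / 2 + (real n * K) / (2 * (real n * e / 3))"
        using var(3) npos e by (intro add_left_mono divide_right_mono) (auto simp: K_def mult_ac)
      also have "(real n * K) / (2 * (real n * e / 3)) = 3 * K / (2 * e)" using npos by simp
      also have "3 * K / (2 * e) \<le> real n * e / 6" using nK e by (simp add: field_simps power2_eq_square)
      finally show ?thesis by (simp add: mult_ac)
    qed
    have "expectation (\<lambda>\<omega>. \<bar>q \<omega> - expectation q\<bar>) \<le>
       expectation (\<lambda>\<omega>. \<bar>q \<omega> - q' \<omega>\<bar> + \<bar>q' \<omega> - expectation q'\<bar> + \<bar>expectation q' - expectation q\<bar>)"
      using iq var(1) by (intro integral_mono) auto
    also have "\<dots> = expectation (\<lambda>\<omega>. \<bar>q \<omega> - q' \<omega>\<bar>) + expectation (\<lambda>\<omega>. \<bar>q' \<omega> - expectation q'\<bar>) + \<bar>expectation q' - expectation q\<bar>"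
      using iq var(1) prob_space by simp
    also have "\<bar>expectation q' - expectation q\<bar> \<le> expectation (\<lambda>\<omega>. \<bar>q \<omega> - q' \<omega>\<bar>)"
    proof -
      have "expectation q' - expectation q = - expectation (\<lambda>\<omega>. q \<omega> - q' \<omega>)" using iq var(1) by simp
      then show ?thesis using integral_abs_bound[of M "\<lambda>\<omega>. q \<omega> - q' \<omega>"] by simp
    qed
    finally have "expectation (\<lambda>\<omega>. \<bar>q \<omega> - expectation q\<bar>) \<le> real n * (e / 6) + real n * (e / 3) + real n * (e / 6)"
      using ED' Evar by linarith
    also have "\<dots> \<le> e * real n" using npos e by (simp add: algebra_simps)
    finally show "expectation (\<lambda>\<omega>. \<bar>quad_form n A (?y \<omega>) - expectation (\<lambda>\<omega>. quad_form n A (?y \<omega>))\<bar>) \<le> e * real n"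
      by (simp add: q_def)
  qed
qed

end

section \<open>Gaussian Fourier transforms\<close>

definition gauss_kernel :: "real \<Rightarrow> 'a::euclidean_space \<Rightarrow> real" where
  "gauss_kernel \<sigma> x = exp (- (norm x)\<^sup>2 / (2 * \<sigma>\<^sup>2))"

lemma gauss_kernel_prod: "gauss_kernel \<sigma> x = (\<Prod>b\<in>Basis. exp (- (x \<bullet> b)\<^sup>2 / (2 * \<sigma>\<^sup>2)))"
proof -
  have "(norm x)\<^sup>2 = (\<Sum>b\<in>Basis. (x \<bullet> b)\<^sup>2)"
    unfolding power2_norm_eq_inner euclidean_inner[of x x] by (simp add: power2_eq_square)
  then have "- (norm x)\<^sup>2 / (2 * \<sigma>\<^sup>2) = (\<Sum>b\<in>Basis. - (x \<bullet> b)\<^sup>2 / (2 * \<sigma>\<^sup>2))"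
    by (simp add: sum_divide_distrib sum_negf)
  then show ?thesis by (simp add: gauss_kernel_def exp_sum)
qed

lemma cis_inner_prod: "cis (x \<bullet> y) = (\<Prod>b\<in>Basis. cis ((x \<bullet> b) * (y \<bullet> b)))"
proof -
  have "cis (\<Sum>b\<in>A. f b) = (\<Prod>b\<in>A. cis (f b))" if "finite A" for A and f :: "'a \<Rightarrow> real"
    using that by (induction A rule: finite_induct) (auto simp flip: cis_mult)
  then show ?thesis unfolding euclidean_inner[of x y] by simp
qed

text \<open>
  Up to scaling this is the characteristic function of the standard normal distribution.
\<close>

lemma gauss_fourier_real:
  fixes y \<sigma> :: real
  assumes \<sigma>: "0 < \<sigma>"
  shows "integrable lborel (\<lambda>t. of_real (exp (- t\<^sup>2 / (2 * \<sigma>\<^sup>2))) * cis (t * y))"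
    and "(\<integral>t. of_real (exp (- t\<^sup>2 / (2 * \<sigma>\<^sup>2))) * cis (t * y) \<partial>lborel) =
      of_real (\<sigma> * sqrt (2 * pi) * exp (- (\<sigma>\<^sup>2 * y\<^sup>2) / 2))"
proof -
  have cis_meas: "(\<lambda>t. cis (t * y)) \<in> borel_measurable borel"
    by (intro borel_measurable_continuous_onI continuous_intros)
  have nd: "exp (- t\<^sup>2 / (2 * \<sigma>\<^sup>2)) = \<sigma> * sqrt (2 * pi) * normal_density 0 \<sigma> t" for t
    using \<sigma> by (simp add: normal_density_def real_sqrt_mult)
  have int: "integrable lborel (\<lambda>t. exp (- t\<^sup>2 / (2 * \<sigma>\<^sup>2)))"
    unfolding nd using integrable_normal_density[OF \<sigma>, of 0] by simp
  show "integrable lborel (\<lambda>t. of_real (exp (- t\<^sup>2 / (2 * \<sigma>\<^sup>2))) * cis (t * y))"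
    by (rule Bochner_Integration.integrable_bound[OF int]) (use cis_meas in \<open>auto simp: norm_mult\<close>)
  have "(\<integral>t. of_real (exp (- t\<^sup>2 / (2 * \<sigma>\<^sup>2))) * cis (t * y) \<partial>lborel) =
     \<sigma> *\<^sub>R (\<integral>u. of_real (exp (- (\<sigma> * u)\<^sup>2 / (2 * \<sigma>\<^sup>2))) * cis (\<sigma> * u * y) \<partial>lborel)"
    using lborel_integral_real_affine[of \<sigma> "\<lambda>t. of_real (exp (- t\<^sup>2 / (2 * \<sigma>\<^sup>2))) * cis (t * y)" 0] \<sigma> by simp
  also have "(\<integral>u. of_real (exp (- (\<sigma> * u)\<^sup>2 / (2 * \<sigma>\<^sup>2))) * cis (\<sigma> * u * y) \<partial>lborel) =
     (\<integral>u. of_real (sqrt (2 * pi)) * (std_normal_density u *\<^sub>R iexp (\<sigma> * y * u)) \<partial>lborel)"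
    using \<sigma> by (intro Bochner_Integration.integral_cong refl)
      (simp add: std_normal_density_def power_mult_distrib scaleR_conv_of_real cis_conv_exp mult_ac)
  also have "\<dots> = of_real (sqrt (2 * pi)) * char std_normal_distribution (\<sigma> * y)"
    unfolding char_def integral_mult_right_zero
    by (subst integral_density) (auto simp: normal_density_nonneg)
  finally show "(\<integral>t. of_real (exp (- t\<^sup>2 / (2 * \<sigma>\<^sup>2))) * cis (t * y) \<partial>lborel) =
      of_real (\<sigma> * sqrt (2 * pi) * exp (- (\<sigma>\<^sup>2 * y\<^sup>2) / 2))"
    by (simp add: char_std_normal_distribution scaleR_conv_of_real power_mult_distrib)
qed

lemma gauss_fourier:
  fixes y :: "'a::euclidean_space"
  assumes \<sigma>: "0 < \<sigma>"
  shows "integrable lborel (\<lambda>x::'a. of_real (gauss_kernel \<sigma> x) * cis (x \<bullet> y))"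
    and "(\<integral>x. of_real (gauss_kernel \<sigma> x) * cis (x \<bullet> y) \<partial>lborel) =
      of_real ((\<sigma> * sqrt (2 * pi)) ^ DIM('a) * exp (- (\<sigma>\<^sup>2 * (norm y)\<^sup>2) / 2))"
proof -
  interpret product_sigma_finite "\<lambda>b::'a. lborel :: real measure" by standard
  let ?f = "\<lambda>b t. complex_of_real (exp (- t\<^sup>2 / (2 * \<sigma>\<^sup>2))) * cis (t * (y \<bullet> b))"
  let ?g = "\<lambda>x::'a. complex_of_real (gauss_kernel \<sigma> x) * cis (x \<bullet> y)"
  have [measurable]: "?g \<in> borel_measurable borel"
    unfolding gauss_kernel_def using \<sigma> by (intro borel_measurable_continuous_onI continuous_intros) auto
  have m[measurable]: "(\<lambda>f. \<Sum>b\<in>Basis. f b *\<^sub>R b :: 'a) \<in> borel_measurable (Pi\<^sub>M Basis (\<lambda>b. lborel))"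
    by measurable
  have g: "?g (\<Sum>b\<in>Basis. f b *\<^sub>R b) = (\<Prod>b\<in>Basis. ?f b (f b))" for f
    unfolding gauss_kernel_prod cis_inner_prod of_real_prod prod.distrib[symmetric]
    by (intro prod.cong refl) (simp add: inner_sum_left inner_Basis if_distrib cong: if_cong)
  have lb: "lborel = distr (\<Pi>\<^sub>M b\<in>Basis. lborel) borel (\<lambda>f. \<Sum>b\<in>Basis. f b *\<^sub>R b :: 'a)" by (rule lborel_eq)
  have ip: "integrable (\<Pi>\<^sub>M b\<in>Basis. lborel) (\<lambda>f. \<Prod>b\<in>(Basis::'a set). ?f b (f b))"
    by (rule product_integrable_prod) (use gauss_fourier_real(1)[OF \<sigma>] in auto)
  show "integrable lborel ?g"
    by (subst lb, subst integrable_distr_eq) (use ip in \<open>simp_all only: g m, measurable\<close>)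
  have "integral\<^sup>L lborel ?g = (\<integral>f. (\<Prod>b\<in>(Basis::'a set). ?f b (f b)) \<partial>(\<Pi>\<^sub>M b\<in>Basis. lborel))"
    by (subst lb, subst integral_distr) (simp_all only: g m, measurable)
  also have "\<dots> = (\<Prod>b\<in>(Basis::'a set). (\<integral>t. ?f b t \<partial>lborel))"
    by (rule product_integral_prod) (use gauss_fourier_real(1)[OF \<sigma>] in auto)
  also have "\<dots> = (\<Prod>b\<in>(Basis::'a set). of_real (\<sigma> * sqrt (2 * pi)) * of_real (exp (- (y \<bullet> b)\<^sup>2 / (2 * (1 / \<sigma>)\<^sup>2))))"
    unfolding gauss_fourier_real(2)[OF \<sigma>] using \<sigma>
    by (intro prod.cong refl) (simp add: power_divide mult_ac)
  also have "\<dots> = of_real ((\<sigma> * sqrt (2 * pi)) ^ DIM('a) * gauss_kernel (1 / \<sigma>) y)"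
    by (simp only: prod.distrib prod_constant gauss_kernel_prod of_real_mult of_real_prod of_real_power)
      (simp only: power_mult_distrib of_real_mult)
  also have "gauss_kernel (1 / \<sigma>) y = exp (- (\<sigma>\<^sup>2 * (norm y)\<^sup>2) / 2)"
    using \<sigma> by (simp add: gauss_kernel_def power_divide mult.commute)
  finally show "integral\<^sup>L lborel ?g = of_real ((\<sigma> * sqrt (2 * pi)) ^ DIM('a) * exp (- (\<sigma>\<^sup>2 * (norm y)\<^sup>2) / 2))" .
qed

section \<open>Quadratic forms of stationary kernels and spectral density\<close>

text \<open>
  The points of an indexed family may coincide; the weights of coinciding points are added up.
\<close>

lemma covariance_function_indexed:
  assumes K: "covariance_function K" and I: "finite I"
  shows "0 \<le> (\<Sum>i\<in>I. \<Sum>j\<in>I. c i * c j * K (p i) (p j))"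
proof -
  define d where "d = (\<lambda>x. \<Sum>i\<in>{i \<in> I. p i = x}. c i)"
  have g: "(\<Sum>i\<in>I. c i * h (p i)) = (\<Sum>x\<in>p ` I. d x * h x)" for h
  proof -
    have "(\<Sum>i\<in>I. c i * h (p i)) = (\<Sum>x\<in>p ` I. \<Sum>i\<in>{i \<in> I. p i = x}. c i * h (p i))"
      by (rule sum.image_gen[OF I])
    also have "\<dots> = (\<Sum>x\<in>p ` I. d x * h x)"
      by (intro sum.cong refl) (simp add: d_def sum_distrib_right)
    finally show ?thesis .
  qed
  have "(\<Sum>i\<in>I. \<Sum>j\<in>I. c i * c j * K (p i) (p j)) = (\<Sum>i\<in>I. c i * (\<Sum>j\<in>I. c j * K (p i) (p j)))"
    by (simp add: sum_distrib_left mult.assoc)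
  also have "\<dots> = (\<Sum>i\<in>I. c i * (\<Sum>y\<in>p ` I. d y * K (p i) y))"
    by (simp only: g)
  also have "\<dots> = (\<Sum>x\<in>p ` I. d x * (\<Sum>y\<in>p ` I. d y * K x y))"
    by (rule g)
  also have "\<dots> = (\<Sum>x\<in>p ` I. \<Sum>y\<in>p ` I. d x * d y * K x y)"
    by (simp add: sum_distrib_left mult.assoc)
  also have "0 \<le> \<dots>"
    using K finite_imageI[OF I, of p] unfolding covariance_function_def by blast
  finally show ?thesis .
qed

definition kernel_form :: "('a::ab_group_add \<Rightarrow> real) \<Rightarrow> (nat \<Rightarrow> 'a) \<Rightarrow> nat \<Rightarrow> (nat \<Rightarrow> real) \<Rightarrow> 'a \<Rightarrow> real" where
  "kernel_form k s n x t = (\<Sum>i<n. \<Sum>j<n. x i * x j * k (s i - s j + t))"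

lemma stationary_covariance_even:
  assumes "stationary_covariance k" shows "k (- x) = k x"
proof -
  have "k (0 - x) = k (x - 0)"
    using assms unfolding stationary_covariance_def covariance_function_def by blast
  then show ?thesis by simp
qed

text \<open>
  Positive semidefiniteness is applied to the weights \<open>x\<close> at the points \<open>s i + t\<close> together with the weights
  \<open>- x\<close> at the points \<open>s i\<close>.
\<close>

lemma kernel_form_shift_le:
  fixes k :: "real ^ 'd \<Rightarrow> real"
  assumes k: "stationary_covariance k"
  shows "kernel_form k s n x t \<le> kernel_form k s n x 0"
proof -
  let ?c = "\<lambda>(i, b). if b then x i else - x i" and ?p = "\<lambda>(i, b). if b then s i + t else s i"
  have "0 \<le> (\<Sum>a\<in>{..<n} \<times> UNIV. \<Sum>a'\<in>{..<n} \<times> (UNIV :: bool set). ?c a * ?c a' * k (?p a - ?p a'))"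
    using k by (intro covariance_function_indexed) (auto simp: stationary_covariance_def)
  also have "\<dots> = (\<Sum>i<n. \<Sum>j<n. x i * x j * (2 * k (s i - s j) - k (s i - s j + t) - k (s i - s j - t)))"
  proof -
    have e: "(\<Sum>b\<in>UNIV. \<Sum>b'\<in>UNIV. ?c (i, b) * ?c (j, b') * k (?p (i, b) - ?p (j, b'))) =
        x i * x j * (2 * k (s i - s j) - k (s i - s j + t) - k (s i - s j - t))" for i j
    proof -
      have E: "s i + t - (s j + t) = s i - s j" "s i + t - s j = s i - s j + t" "s i - (s j + t) = s i - s j - t"
        by (simp_all add: algebra_simps)
      have "a * b * u + (a * - b) * v + ((- a) * b * w + (- a) * (- b) * u) = a * b * (2 * u - v - w)"
        for a b u v w :: real by (simp add: algebra_simps)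
      from this[of "x i" "x j" "k (s i - s j)" "k (s i - s j + t)" "k (s i - s j - t)"]
      show ?thesis by (simp add: UNIV_bool E del: minus_mult_minus)
    qed
    have "(\<Sum>a\<in>{..<n} \<times> UNIV. \<Sum>a'\<in>{..<n} \<times> UNIV. ?c a * ?c a' * k (?p a - ?p a')) =
        (\<Sum>i<n. \<Sum>b\<in>UNIV. \<Sum>j<n. \<Sum>b'\<in>UNIV. ?c (i, b) * ?c (j, b') * k (?p (i, b) - ?p (j, b')))"
      by (simp only: sum.cartesian_product')
    also have "\<dots> = (\<Sum>i<n. \<Sum>j<n. \<Sum>b\<in>UNIV. \<Sum>b'\<in>UNIV. ?c (i, b) * ?c (j, b') * k (?p (i, b) - ?p (j, b')))"
      by (intro sum.cong refl sum.swap)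
    finally show ?thesis by (simp only: e)
  qed
  also have "\<dots> = 2 * kernel_form k s n x 0 - kernel_form k s n x t - kernel_form k s n x (- t)"
  proof -
    have "a * (2 * u - v - w) = 2 * (a * u) - a * v - a * w" for a u v w :: real by (simp add: algebra_simps)
    then show ?thesis by (simp add: kernel_form_def sum_subtractf sum_distrib_left)
  qed
  also have "kernel_form k s n x (- t) = kernel_form k s n x t"
  proof -
    have "k (s i - s j - t) = k (s j - s i + t)" for i j
      using stationary_covariance_even[OF k, of "s j - s i + t"] by (simp add: algebra_simps)
    then have "kernel_form k s n x (- t) = (\<Sum>i<n. \<Sum>j<n. x j * x i * k (s j - s i + t))"
      by (simp add: kernel_form_def mult.commute)
    also have "\<dots> = kernel_form k s n x t" unfolding kernel_form_def by (rule sum.swap)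
    finally show ?thesis .
  qed
  finally show ?thesis by simp
qed

lemma gauss_kernel_integrable:
  assumes "0 < \<sigma>" shows "integrable lborel (gauss_kernel \<sigma> :: 'a::euclidean_space \<Rightarrow> real)"
proof -
  have "integrable lborel (\<lambda>x::'a. of_real (gauss_kernel \<sigma> x) * cis (x \<bullet> 0))" by (rule gauss_fourier(1)[OF assms])
  then show ?thesis by (simp add: complex_of_real_integrable_eq)
qed

lemma gauss_kernel_pos: "0 < gauss_kernel \<sigma> x" by (simp add: gauss_kernel_def)

lemma gauss_kernel_continuous: "continuous_on A (gauss_kernel \<sigma>)"
  unfolding gauss_kernel_def by (cases "\<sigma> = 0") (auto intro!: continuous_intros)

text \<open>
  The Gaussian is written as the Fourier transform of a Gaussian; then Fubini's theorem applies to an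
  absolutely integrable double integral.
\<close>

lemma gauss_smoothing_fourier:
  fixes h :: "'a::euclidean_space \<Rightarrow> real"
  assumes h: "integrable lborel h"
  defines "F \<equiv> \<lambda>f. \<integral>t. of_real (h t) * cis (- (f \<bullet> t)) \<partial>lborel"
  shows "integrable lborel (\<lambda>f. of_real (gauss_kernel 1 f) * cis (f \<bullet> a) * F f)"
    and "of_real (sqrt (2 * pi) ^ DIM('a) * (\<integral>t. gauss_kernel 1 t * h (a + t) \<partial>lborel)) =
      (\<integral>f. of_real (gauss_kernel 1 f) * cis (f \<bullet> a) * F f \<partial>lborel)"
proof -
  have hm[measurable]: "h \<in> borel_measurable borel" using h by auto
  have gm[measurable]: "(gauss_kernel 1 :: 'a \<Rightarrow> real) \<in> borel_measurable borel"
    by (intro borel_measurable_continuous_onI gauss_kernel_continuous)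
  have cm: "(\<lambda>p::'a \<times> 'a. cis (snd p \<bullet> (a - fst p))) \<in> borel_measurable borel"
    by (intro borel_measurable_continuous_onI continuous_intros)
  have cm'[measurable]: "(\<lambda>p::'a \<times> 'a. cis (snd p \<bullet> (a - fst p))) \<in> borel_measurable (borel \<Otimes>\<^sub>M borel)"
    using cm by (simp add: borel_prod)
  let ?G = "\<lambda>p::'a \<times> 'a. complex_of_real (h (fst p)) * (of_real (gauss_kernel 1 (snd p)) * cis (snd p \<bullet> (a - fst p)))"
  have Gm[measurable]: "?G \<in> borel_measurable (lborel \<Otimes>\<^sub>M lborel)" by measurable
  have nG: "norm (?G (u, f)) = \<bar>h u\<bar> * gauss_kernel 1 f" for u f
    using gauss_kernel_pos[of 1 f] by (simp add: norm_mult)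
  have iG: "integrable (lborel \<Otimes>\<^sub>M lborel) ?G"
  proof (rule lborel_pair.Fubini_integrable[OF Gm])
    show "integrable lborel (\<lambda>u. \<integral>f. norm (?G (u, f)) \<partial>lborel)"
      unfolding nG using h by simp
    show "AE u in lborel. integrable lborel (\<lambda>f. ?G (u, f))"
    proof (rule AE_I2)
      fix u
      show "integrable lborel (\<lambda>f. ?G (u, f))"
        using gauss_fourier(1)[of 1 "a - u"] by simp
    qed
  qed
  have Ff: "(\<integral>u. ?G (u, f) \<partial>lborel) = of_real (gauss_kernel 1 f) * cis (f \<bullet> a) * F f" for f
  proof -
    have "(\<integral>u. ?G (u, f) \<partial>lborel) = (\<integral>u. of_real (gauss_kernel 1 f) * cis (f \<bullet> a) * (of_real (h u) * cis (- (f \<bullet> u))) \<partial>lborel)"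
    proof (intro Bochner_Integration.integral_cong refl)
      fix u
      have "cis (f \<bullet> (a - u)) = cis (f \<bullet> a) * cis (- (f \<bullet> u))"
        by (simp add: inner_diff_right cis_mult)
      then show "?G (u, f) = of_real (gauss_kernel 1 f) * cis (f \<bullet> a) * (of_real (h u) * cis (- (f \<bullet> u)))" by simp
    qed
    then show ?thesis by (simp add: F_def)
  qed
  have uu: "(\<integral>f. ?G (u, f) \<partial>lborel) = of_real (sqrt (2 * pi) ^ DIM('a) * (gauss_kernel 1 (a - u) * h u))" for u
    using gauss_fourier(2)[of 1 "a - u"] by (simp add: gauss_kernel_def)
  show "integrable lborel (\<lambda>f. of_real (gauss_kernel 1 f) * cis (f \<bullet> a) * F f)"
    using lborel_pair.integrable_snd[of "\<lambda>u f. ?G (u, f)"] iG unfolding Ff by (simp add: case_prod_beta')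
  have "(\<integral>f. of_real (gauss_kernel 1 f) * cis (f \<bullet> a) * F f \<partial>lborel) = (\<integral>u. (\<integral>f. ?G (u, f) \<partial>lborel) \<partial>lborel)"
    unfolding Ff[symmetric] using lborel_pair.Fubini_integral[of "\<lambda>u f. ?G (u, f)"] iG by (simp add: case_prod_beta')
  also have "\<dots> = of_real (sqrt (2 * pi) ^ DIM('a) * (\<integral>u. gauss_kernel 1 (a - u) * h u \<partial>lborel))"
    unfolding uu by (simp del: of_real_mult of_real_power)
  also have "(\<integral>u. gauss_kernel 1 (a - u) * h u \<partial>lborel) = (\<integral>t. gauss_kernel 1 t * h (a + t) \<partial>lborel)"
  proof -
    have "(\<integral>u. gauss_kernel 1 (a - u) * h u \<partial>lborel) = (\<integral>u. gauss_kernel 1 (a - u) * h u \<partial>distr lborel borel ((+) a))"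
      by (simp add: lborel_distr_plus)
    also have "\<dots> = (\<integral>t. gauss_kernel 1 (a - (a + t)) * h (a + t) \<partial>lborel)"
      by (subst integral_distr) auto
    finally show ?thesis by (simp add: gauss_kernel_def)
  qed
  finally show "of_real (sqrt (2 * pi) ^ DIM('a) * (\<integral>t. gauss_kernel 1 t * h (a + t) \<partial>lborel)) =
      (\<integral>f. of_real (gauss_kernel 1 f) * cis (f \<bullet> a) * F f \<partial>lborel)" by simp
qed

text \<open>
  The pointwise inequality for a kernel is to be integrated after replacing the kernel by an almost
  everywhere equal Borel function, simultaneously at finitely many translates.
\<close>

lemma AE_lborel_translate:
  fixes a :: "'a::euclidean_space"
  assumes "AE t in lborel. P t"
  shows "AE t in lborel. P (a + t)"
proof -
  from assms obtain N where N: "{t. \<not> P t} \<subseteq> N" "N \<in> null_sets lborel"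
    by (auto simp: eventually_ae_filter)
  have "AE t in distr lborel borel ((+) a). t \<notin> N"
    unfolding lborel_distr_plus by (rule AE_not_in[OF N(2)])
  then have "AE t in lborel. a + t \<notin> N"
    using N(2) by (subst (asm) AE_distr_iff) auto
  then show ?thesis using N(1) by (auto elim!: eventually_mono)
qed

text \<open>
  For a continuous kernel the quadratic form is the integral of the spectral density times the square
  of the exponential sum. In general it is at least this integral damped by a Gaussian:
  the form at shift \<open>t\<close> is at most the form at \<open>0\<close>, and averaging over Gaussian shifts \<open>t\<close> turns the left-hand
  side into the damped integral.
\<close>

lemma spectral_representation_le:
  fixes k :: "real ^ 'd \<Rightarrow> real" and s :: "nat \<Rightarrow> real ^ 'd" and x :: "nat \<Rightarrow> real" and n :: nat
  assumes k: "stationary_covariance k" and int: "integrable lebesgue k"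
    and real: "\<And>f. fourier_transform k f \<in> \<real>"
  defines "P \<equiv> \<lambda>f. (cmod (\<Sum>i<n. of_real (x i) * cis (f \<bullet> s i)))\<^sup>2"
  shows "integrable lborel (\<lambda>f. gauss_kernel 1 f * Re (fourier_transform k f) * P f)"
    and "(\<integral>f. gauss_kernel 1 f * Re (fourier_transform k f) * P f \<partial>lborel) \<le> kernel_form k s n x 0"
proof -
  \<comment> \<open>a Borel version of \<open>k\<close>, for Fubini's theorem on products of Lebesgue-Borel measures\<close>
  obtain h where h[measurable]: "h \<in> borel_measurable lborel" and kh: "AE t in lborel. k t = h t"
    using completion_ex_borel_measurable_real[of k lborel] int by blast
  have khc: "AE t in lebesgue. k t = h t" using kh by (rule AE_completion)
  have hint: "integrable lborel h"
  proof -
    have "integrable lebesgue h"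
      by (rule integrable_cong_AE_imp[OF int]) (use khc h in \<open>auto intro: measurable_completion\<close>)
    then show ?thesis using integrable_completion[OF h] by simp
  qed
  have hm[measurable]: "h \<in> borel_measurable borel" using h by simp
  define D where "D = (2 * pi) ^ CARD('d)"
  define c where "c = sqrt (2 * pi) ^ CARD('d)"
  have D: "0 < D" "c * c = D" "0 < c"
  proof -
    have "c * c = (sqrt (2 * pi) * sqrt (2 * pi)) ^ CARD('d)" by (simp only: c_def power_mult_distrib)
    then show "c * c = D" by (simp add: D_def)
  qed (simp_all add: D_def c_def)
  define F where "F = (\<lambda>f. \<integral>t. of_real (h t) * cis (- (f \<bullet> t)) \<partial>lborel)"
  have cm[measurable]: "(\<lambda>t::real ^ 'd. cis (- (f \<bullet> t))) \<in> borel_measurable borel" for f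
    by (intro borel_measurable_continuous_onI continuous_intros)
  have km[measurable]: "k \<in> borel_measurable lebesgue" using int by auto
  have FT: "of_real D * fourier_transform k f = F f" for f
  proof -
    have e: "exp (- (\<i> * complex_of_real (f \<bullet> t))) = cis (- (f \<bullet> t))" for t
      by (simp add: cis_conv_exp)
    have mm: "(\<lambda>t::real ^ 'd. of_real (h t) * cis (- (f \<bullet> t))) \<in> borel_measurable lborel" by simp
    have "(\<integral>t. complex_of_real (k t) * cis (- (f \<bullet> t)) \<partial>lebesgue) = (\<integral>t. of_real (h t) * cis (- (f \<bullet> t)) \<partial>lebesgue)"
    proof (rule integral_cong_AE)
      show "(\<lambda>t::real ^ 'd. of_real (k t) * cis (- (f \<bullet> t))) \<in> borel_measurable lebesgue"
        using measurable_completion[of "\<lambda>t::real ^ 'd. cis (- (f \<bullet> t))" lborel borel] by (intro borel_measurable_times) auto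
      show "(\<lambda>t::real ^ 'd. of_real (h t) * cis (- (f \<bullet> t))) \<in> borel_measurable lebesgue"
        by (rule measurable_completion[OF mm])
    qed (use khc in auto)
    also have "\<dots> = F f" unfolding F_def by (rule integral_completion[OF mm])
    finally show ?thesis unfolding fourier_transform_def e D_def[symmetric] using D(1) by simp
  qed
  have FR: "F f = of_real (D * Re (fourier_transform k f))" for f
    using FT[of f] real[of f] by (metis of_real_Re of_real_mult)
  note S = gauss_smoothing_fourier[OF hint, folded fun_cong[OF F_def], unfolded DIM_cart DIM_real mult_1_right, folded c_def]
  let ?a = "\<lambda>i j. s i - s j"
  have Pe: "gauss_kernel 1 f * Re (fourier_transform k f) * P f =
      (\<Sum>i<n. \<Sum>j<n. 1 / D * (x i * x j * Re (of_real (gauss_kernel 1 f) * cis (f \<bullet> ?a i j) * F f)))" for f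
  proof -
    have "P f = (\<Sum>i<n. \<Sum>j<n. x i * x j * cos (f \<bullet> ?a i j))"
      unfolding P_def cmod_square_sum_cis by (simp add: inner_diff_right)
    then show ?thesis using D(1) by (simp add: FR sum_distrib_left mult_ac)
  qed
  have iS: "integrable lborel (\<lambda>f. 1 / D * (x i * x j * Re (of_real (gauss_kernel 1 f) * cis (f \<bullet> ?a i j) * F f)))" for i j
    by (intro integrable_mult_right integrable_Re S(1))
  show "integrable lborel (\<lambda>f. gauss_kernel 1 f * Re (fourier_transform k f) * P f)"
    unfolding Pe by (intro Bochner_Integration.integrable_sum iS)
  have gi: "integrable lborel (\<lambda>t. gauss_kernel 1 t * h (a + t))" for a
  proof (rule Bochner_Integration.integrable_bound)
    have "integrable (distr lborel borel ((+) a)) h" using hint by (simp add: lborel_distr_plus)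
    then show "integrable lborel (\<lambda>t. h (a + t))" by (subst (asm) integrable_distr_eq) auto
    have gm: "(gauss_kernel 1 :: real ^ 'd \<Rightarrow> real) \<in> borel_measurable borel"
      by (intro borel_measurable_continuous_onI gauss_kernel_continuous)
    then show "(\<lambda>t. gauss_kernel 1 t * h (a + t)) \<in> borel_measurable lborel" by simp
    show "AE t in lborel. norm (gauss_kernel 1 t * h (a + t)) \<le> norm (h (a + t))"
      by (intro AE_I2) (auto simp: abs_mult gauss_kernel_def intro!: mult_left_le_one_le)
  qed
  have "(\<integral>f. gauss_kernel 1 f * Re (fourier_transform k f) * P f \<partial>lborel) =
     (\<Sum>i<n. \<Sum>j<n. 1 / D * (x i * x j * Re (\<integral>f. of_real (gauss_kernel 1 f) * cis (f \<bullet> ?a i j) * F f \<partial>lborel)))"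
    unfolding Pe by (subst integral_double_sum[OF iS]) (simp only: integral_mult_right_zero integral_Re[OF S(1)])
  also have "\<dots> = (\<Sum>i<n. \<Sum>j<n. c / D * (\<integral>t. x i * x j * (gauss_kernel 1 t * h (?a i j + t)) \<partial>lborel))"
    by (intro sum.cong refl) (simp flip: S(2))
  also have "\<dots> = c / D * (\<Sum>i<n. \<Sum>j<n. (\<integral>t. x i * x j * (gauss_kernel 1 t * h (?a i j + t)) \<partial>lborel))"
    by (simp only: sum_distrib_left)
  finally have eq: "(\<integral>f. gauss_kernel 1 f * Re (fourier_transform k f) * P f \<partial>lborel) =
     c / D * (\<Sum>i<n. \<Sum>j<n. (\<integral>t. x i * x j * (gauss_kernel 1 t * h (?a i j + t)) \<partial>lborel))" .
  have "(\<Sum>i<n. \<Sum>j<n. (\<integral>t. x i * x j * (gauss_kernel 1 t * h (?a i j + t)) \<partial>lborel)) =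
     (\<integral>t. (\<Sum>i<n. \<Sum>j<n. x i * x j * (gauss_kernel 1 t * h (?a i j + t))) \<partial>lborel)"
    by (rule integral_double_sum[symmetric]) (intro integrable_mult_right gi)
  also have "\<dots> \<le> (\<integral>t. gauss_kernel 1 (t::real ^ 'd) * kernel_form k s n x 0 \<partial>lborel)"
  proof (rule integral_mono_AE)
    show "integrable lborel (\<lambda>t. \<Sum>i<n. \<Sum>j<n. x i * x j * (gauss_kernel 1 t * h (?a i j + t)))"
      by (intro Bochner_Integration.integrable_sum integrable_mult_right gi)
    show "integrable lborel (\<lambda>t::real ^ 'd. gauss_kernel 1 t * kernel_form k s n x 0)"
      by (intro integrable_mult_left gauss_kernel_integrable) simp
    have "AE t in lborel. \<forall>i\<in>{..<n}. \<forall>j\<in>{..<n}. k (?a i j + t) = h (?a i j + t)"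
      by (intro AE_finite_allI finite_lessThan AE_lborel_translate kh)
    then show "AE t in lborel. (\<Sum>i<n. \<Sum>j<n. x i * x j * (gauss_kernel 1 t * h (?a i j + t)))
        \<le> gauss_kernel 1 t * kernel_form k s n x 0"
    proof eventually_elim
      case (elim t)
      then have "(\<Sum>i<n. \<Sum>j<n. x i * x j * (gauss_kernel 1 t * h (?a i j + t))) = gauss_kernel 1 t * kernel_form k s n x t"
        by (simp add: kernel_form_def sum_distrib_left mult_ac)
      also have "\<dots> \<le> gauss_kernel 1 t * kernel_form k s n x 0"
        by (intro mult_left_mono kernel_form_shift_le[OF k] less_imp_le gauss_kernel_pos)
      finally show ?case .
    qed
  qed
  also have "\<dots> = c * kernel_form k s n x 0"
  proof -
    have "complex_of_real (\<integral>t. gauss_kernel 1 (t::real ^ 'd) \<partial>lborel) = of_real (c)"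
      using gauss_fourier(2)[of 1 "0 :: real ^ 'd"] by (simp add: c_def)
    then have "(\<integral>t. gauss_kernel 1 (t::real ^ 'd) \<partial>lborel) = c"
      by (simp only: of_real_eq_iff)
    then show ?thesis by simp
  qed
  finally have "c / D * (\<Sum>i<n. \<Sum>j<n. (\<integral>t. x i * x j * (gauss_kernel 1 t * h (?a i j + t)) \<partial>lborel)) \<le>
     c / D * (c * kernel_form k s n x 0)"
    using D by (intro mult_left_mono) auto
  also have "\<dots> = kernel_form k s n x 0" using D(3) by (simp flip: D(2))
  finally show "(\<integral>f. gauss_kernel 1 f * Re (fourier_transform k f) * P f \<partial>lborel) \<le> kernel_form k s n x 0"
    unfolding eq .
qed

section \<open>Exponential sums over separated points\<close>

lemma exp_int_sum_le:
  fixes B :: "int set"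
  assumes c: "0 < c" and B: "finite B"
  shows "(\<Sum>m\<in>B. exp (- c * \<bar>real_of_int (m - a)\<bar>)) \<le> 2 / (1 - exp (- c))"
proof -
  let ?q = "exp (- c)"
  have q: "0 < ?q" "?q < 1" using c by auto
  have half: "(\<Sum>m\<in>B'. exp (- c * \<bar>real_of_int (m - a)\<bar>)) \<le> 1 / (1 - ?q)"
    if B': "finite B'" "inj_on (\<lambda>m. nat \<bar>m - a\<bar>) B'" for B'
  proof -
    have "(\<Sum>m\<in>B'. exp (- c * \<bar>real_of_int (m - a)\<bar>)) = (\<Sum>m\<in>B'. ?q ^ nat \<bar>m - a\<bar>)"
      by (intro sum.cong refl) (simp add: exp_of_nat_mult[symmetric] mult.commute)
    also have "\<dots> = (\<Sum>i\<in>(\<lambda>m. nat \<bar>m - a\<bar>) ` B'. ?q ^ i)"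
      using B'(2) by (simp add: sum.reindex)
    also have "\<dots> \<le> (\<Sum>i. ?q ^ i)"
      using q B'(1) by (intro sum_le_suminf summable_geometric) auto
    also have "\<dots> = 1 / (1 - ?q)" using q by (intro suminf_geometric) simp
    finally show ?thesis .
  qed
  have "(\<Sum>m\<in>B. exp (- c * \<bar>real_of_int (m - a)\<bar>)) =
     (\<Sum>m\<in>{m\<in>B. a \<le> m}. exp (- c * \<bar>real_of_int (m - a)\<bar>)) +
     (\<Sum>m\<in>{m\<in>B. m < a}. exp (- c * \<bar>real_of_int (m - a)\<bar>))"
    using B by (subst sum.union_disjoint[symmetric]) (auto intro!: sum.cong)
  also have "\<dots> \<le> 1 / (1 - ?q) + 1 / (1 - ?q)"
    using B by (intro add_mono half) (auto simp: inj_on_def)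
  finally show ?thesis by simp
qed

lemma infnorm_less_cart: "(\<And>i. \<bar>(x :: real ^ 'd) $ i\<bar> < e) \<Longrightarrow> infnorm x < e"
  unfolding infnorm_Max by (subst Max_less_iff) (auto simp: Basis_vec_def inner_axis)

lemma infnorm_exp_le_prod:
  fixes x :: "real ^ 'd"
  assumes "0 < c"
  shows "exp (- c * infnorm x) \<le> (\<Prod>i\<in>UNIV. exp (- (c / CARD('d)) * \<bar>x $ i\<bar>))"
proof -
  have "(\<Sum>i\<in>(UNIV :: 'd set). \<bar>x $ i\<bar>) \<le> (\<Sum>i\<in>(UNIV :: 'd set). infnorm x)"
    by (intro sum_mono component_le_infnorm_cart)
  then have "c / CARD('d) * (\<Sum>i\<in>UNIV. \<bar>x $ i\<bar>) \<le> c / CARD('d) * (CARD('d) * infnorm x)"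
    using assms by (intro mult_left_mono) auto
  moreover have "(\<Prod>i\<in>UNIV. exp (- (c / CARD('d)) * \<bar>x $ i\<bar>)) = exp (- (c / CARD('d) * (\<Sum>i\<in>UNIV. \<bar>x $ i\<bar>)))"
    by (simp only: exp_sum[symmetric] finite sum_distrib_left[symmetric] mult_minus_left sum_negf)
  ultimately show ?thesis by simp
qed

lemma well_separated_distance:
  assumes "well_separated s"
  obtains \<delta> where "0 < \<delta>" "\<And>i j. i \<noteq> j \<Longrightarrow> \<delta> \<le> infnorm (s i - s j)"
proof -
  define \<delta> where "\<delta> = (INF (i, j)\<in>{(i, j). i \<noteq> j}. infnorm (s i - s j))"
  have "\<delta> \<le> infnorm (s i - s j)" if "i \<noteq> j" for i j
  proof -
    have "bdd_below ((\<lambda>(i, j). infnorm (s i - s j)) ` {(i, j). i \<noteq> j})"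
      by (rule bdd_belowI[of _ 0]) (auto simp: infnorm_pos_le)
    from cINF_lower[OF this, of "(i, j)"] that show ?thesis by (simp add: \<delta>_def)
  qed
  then show ?thesis using that[of \<delta>] assms by (auto simp: well_separated_def \<delta>_def)
qed

text \<open>
  In the grid of cubes of side \<open>\<delta>\<close> every cube contains at most one point. The sum over the points is
  thus bounded by a sum over the integer lattice, which factors into geometric series.
\<close>

lemma separated_exp_sum_bounded:
  fixes s :: "nat \<Rightarrow> real ^ 'd"
  assumes \<delta>: "0 < \<delta>" "\<And>i j. i \<noteq> j \<Longrightarrow> \<delta> \<le> infnorm (s i - s j)" and c: "0 < c"
  obtains S where "0 < S" "\<And>n x. (\<Sum>j<n. exp (- c * infnorm (x - s j))) \<le> S"
proof -
  \<comment> \<open>decay rate per coordinate and per cube; the factor \<open>exp c'\<close> in \<open>g\<close> pays for rounding down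
    to the corner of a cube\<close>
  define c' where "c' = c / CARD('d) * \<delta>"
  have c': "0 < c'" using c \<delta> by (simp add: c'_def)
  define g where "g = (\<lambda>m::int. exp c' * exp (- c' * \<bar>real_of_int m\<bar>))"
  define G where "G = exp c' * (2 / (1 - exp (- c')))"
  define u where "u = (\<lambda>x :: real ^ 'd. \<lambda>i. \<lfloor>x $ i / \<delta>\<rfloor>)"
  have G: "0 < G" using c' by (simp add: G_def)
  have inj: "inj (\<lambda>j. u (s j))"
  proof (rule injI, rule ccontr)
    fix j k assume eq: "u (s j) = u (s k)" and "j \<noteq> k"
    have "\<bar>(s j - s k) $ i\<bar> < \<delta>" for i
    proof -
      have "\<lfloor>s j $ i / \<delta>\<rfloor> = \<lfloor>s k $ i / \<delta>\<rfloor>" using eq by (simp add: u_def fun_eq_iff)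
      then have "\<bar>s j $ i / \<delta> - s k $ i / \<delta>\<bar> < 1" by linarith
      then show ?thesis using \<delta>(1) by (simp add: field_simps flip: diff_divide_distrib)
    qed
    then have "infnorm (s j - s k) < \<delta>" by (rule infnorm_less_cart)
    then show False using \<delta>(2)[OF \<open>j \<noteq> k\<close>] by simp
  qed
  have prod_bound: "exp (- c * infnorm (x - y)) \<le> (\<Prod>i\<in>UNIV. g (u y i - u x i))" for x y :: "real ^ 'd"
  proof -
    have "exp (- c * infnorm (x - y)) \<le> (\<Prod>i\<in>UNIV. exp (- (c / CARD('d)) * \<bar>(x - y) $ i\<bar>))"
      by (rule infnorm_exp_le_prod[OF c])
    also have "\<dots> \<le> (\<Prod>i\<in>UNIV. g (u y i - u x i))"
    proof (intro prod_mono conjI)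
      fix i
      have "\<bar>real_of_int (u y i - u x i)\<bar> - 1 \<le> \<bar>x $ i / \<delta> - y $ i / \<delta>\<bar>"
        unfolding u_def by linarith
      also have "\<bar>x $ i / \<delta> - y $ i / \<delta>\<bar> = \<bar>(x - y) $ i\<bar> / \<delta>"
        using \<delta>(1) by (simp flip: diff_divide_distrib)
      finally have "c' * (\<bar>real_of_int (u y i - u x i)\<bar> - 1) \<le> c' * (\<bar>(x - y) $ i\<bar> / \<delta>)"
        using c' by (intro mult_left_mono) auto
      also have "\<dots> = c / CARD('d) * \<bar>(x - y) $ i\<bar>" using \<delta>(1) by (simp add: c'_def)
      finally show "exp (- (c / CARD('d)) * \<bar>(x - y) $ i\<bar>) \<le> g (u y i - u x i)"
        unfolding g_def exp_add[symmetric] by (simp add: algebra_simps)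
    qed simp
    finally show ?thesis .
  qed
  show ?thesis
  proof (rule that[of "G ^ CARD('d)"])
    show "0 < G ^ CARD('d)" using G by simp
    fix n x
    define B where "B = (\<lambda>i. (\<lambda>j. u (s j) i) ` {..<n})"
    have "(\<Sum>j<n. exp (- c * infnorm (x - s j))) \<le> (\<Sum>j<n. \<Prod>i\<in>UNIV. g (u (s j) i - u x i))"
      by (intro sum_mono prod_bound)
    also have "\<dots> = (\<Sum>m\<in>(\<lambda>j. u (s j)) ` {..<n}. \<Prod>i\<in>UNIV. g (m i - u x i))"
      using inj by (simp add: sum.reindex inj_on_subset)
    also have "\<dots> \<le> (\<Sum>m\<in>PiE UNIV B. \<Prod>i\<in>UNIV. g (m i - u x i))"
      proof (rule sum_mono2)
      show "finite (PiE UNIV B)" by (intro finite_PiE) (auto simp: B_def)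
      show "(\<lambda>j. u (s j)) ` {..<n} \<subseteq> PiE UNIV B" by (auto simp: B_def)
    qed (intro prod_nonneg, simp add: g_def)
    also have "\<dots> = (\<Prod>i\<in>UNIV. \<Sum>m\<in>B i. g (m - u x i))"
      by (rule prod_sum_PiE[symmetric]) (auto simp: B_def)
    also have "\<dots> \<le> (\<Prod>i\<in>(UNIV :: 'd set). G)"
    proof (intro prod_mono conjI)
      fix i
      show "0 \<le> (\<Sum>m\<in>B i. g (m - u x i))" by (intro sum_nonneg) (simp add: g_def)
      have "(\<Sum>m\<in>B i. g (m - u x i)) = exp c' * (\<Sum>m\<in>B i. exp (- c' * \<bar>real_of_int (m - u x i)\<bar>))"
        by (simp add: g_def sum_distrib_left)
      also have "\<dots> \<le> G" unfolding G_def
        by (intro mult_left_mono exp_int_sum_le[OF c']) (auto simp: B_def)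
      finally show "(\<Sum>m\<in>B i. g (m - u x i)) \<le> G" .
    qed
    finally show "(\<Sum>j<n. exp (- c * infnorm (x - s j))) \<le> G ^ CARD('d)" by simp
  qed
qed

text \<open>
  At distance \<open>r \<ge> \<delta>\<close> the exponent \<open>\<sigma>\<^sup>2 r\<^sup>2 / 2\<close> is at least \<open>r + L\<close> once \<open>\<sigma>\<close> is large, so that the sum is at most
  \<open>exp (- L)\<close> times a bounded exponential sum.
\<close>

lemma separated_gauss_offdiag_small:
  fixes s :: "nat \<Rightarrow> real ^ 'd"
  assumes \<delta>: "0 < \<delta>" "\<And>i j. i \<noteq> j \<Longrightarrow> \<delta> \<le> infnorm (s i - s j)"
  obtains \<sigma> where "0 < \<sigma>"
    "\<And>n i. (\<Sum>j\<in>{..<n} - {i}. exp (- (\<sigma>\<^sup>2 * (norm (s i - s j))\<^sup>2) / 2)) \<le> 1 / 2"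
proof -
  obtain S where S: "0 < S" "\<And>n x. (\<Sum>j<n. exp (- 1 * infnorm (x - s j))) \<le> S"
    by (rule separated_exp_sum_bounded[OF \<delta>, where c = 1]) auto
  define L where "L = max 0 (ln (2 * S))"
  define \<sigma> where "\<sigma> = sqrt (2 * (1 + L / \<delta>) / \<delta>)"
  have L: "0 \<le> L" "S * exp (- L) \<le> 1 / 2"
  proof -
    have "2 * S \<le> exp L" using S(1) by (cases "0 \<le> ln (2 * S)") (auto simp: L_def max_def not_le)
    then show "S * exp (- L) \<le> 1 / 2" by (simp add: exp_minus field_simps)
  qed (simp add: L_def)
  have pos: "0 < 2 * (1 + L / \<delta>) / \<delta>" using \<delta>(1) L(1) by (auto intro!: divide_pos_pos mult_pos_pos add_pos_nonneg)
  have \<sigma>2: "\<sigma>\<^sup>2 = 2 * (1 + L / \<delta>) / \<delta>" using pos by (simp add: \<sigma>_def)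
  show ?thesis
  proof (rule that[of \<sigma>])
    show "0 < \<sigma>" using pos by (simp add: \<sigma>_def)
    fix n i
    have "(\<Sum>j\<in>{..<n} - {i}. exp (- (\<sigma>\<^sup>2 * (norm (s i - s j))\<^sup>2) / 2)) \<le>
       (\<Sum>j\<in>{..<n} - {i}. exp (- L) * exp (- 1 * infnorm (s i - s j)))"
    proof (rule sum_mono)
      fix j assume "j \<in> {..<n} - {i}"
      then have d: "\<delta> \<le> infnorm (s i - s j)" using \<delta>(2)[of i j] by auto
      let ?r = "infnorm (s i - s j)"
      have "L + ?r \<le> (L / \<delta>) * ?r + ?r"
        using mult_left_mono[OF d, of "L / \<delta>"] L(1) \<delta>(1) by simp
      also have "\<dots> = (1 + L / \<delta>) / \<delta> * (\<delta> * ?r)" using \<delta>(1) by (simp add: field_simps)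
      also have "\<dots> \<le> (1 + L / \<delta>) / \<delta> * (?r * ?r)"
        using d \<delta>(1) L(1) by (intro mult_left_mono mult_right_mono) auto
      also have "\<dots> \<le> (1 + L / \<delta>) / \<delta> * (norm (s i - s j) * norm (s i - s j))"
        using d \<delta>(1) L(1) infnorm_le_norm[of "s i - s j"] by (intro mult_left_mono mult_mono) auto
      also have "\<dots> = (\<sigma>\<^sup>2 * (norm (s i - s j))\<^sup>2) / 2"
      proof -
        have "a / \<delta> * (b * b) = 2 * a / \<delta> * b\<^sup>2 / 2" for a b by (simp add: power2_eq_square)
        then show ?thesis by (simp only: \<sigma>2)
      qed
      finally show "exp (- (\<sigma>\<^sup>2 * (norm (s i - s j))\<^sup>2) / 2) \<le> exp (- L) * exp (- 1 * ?r)"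
        unfolding exp_add[symmetric] by simp
    qed
    also have "\<dots> \<le> (\<Sum>j<n. exp (- L) * exp (- 1 * infnorm (s i - s j)))"
      by (intro sum_mono2) auto
    also have "\<dots> = exp (- L) * (\<Sum>j<n. exp (- 1 * infnorm (s i - s j)))" by (simp only: sum_distrib_left)
    also have "\<dots> \<le> exp (- L) * S" by (intro mult_left_mono S(2)) simp
    also have "\<dots> \<le> 1 / 2" using L(2) by (simp add: mult.commute)
    finally show "(\<Sum>j\<in>{..<n} - {i}. exp (- (\<sigma>\<^sup>2 * (norm (s i - s j))\<^sup>2) / 2)) \<le> 1 / 2" .
  qed
qed

section \<open>Uniform positive definiteness\<close>

lemma row_sum_form_le:
  fixes a :: "nat \<Rightarrow> nat \<Rightarrow> real"
  assumes "finite I" "\<And>i j. i \<in> I \<Longrightarrow> j \<in> I \<Longrightarrow> a i j = a j i"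
    and "\<And>i. i \<in> I \<Longrightarrow> (\<Sum>j\<in>I. \<bar>a i j\<bar>) \<le> \<rho>"
  shows "\<bar>\<Sum>i\<in>I. \<Sum>j\<in>I. x i * x j * a i j\<bar> \<le> \<rho> * (\<Sum>i\<in>I. (x i)\<^sup>2)"
proof -
  have "\<bar>\<Sum>i\<in>I. \<Sum>j\<in>I. x i * x j * a i j\<bar> \<le> (\<Sum>i\<in>I. \<Sum>j\<in>I. \<bar>x i * x j * a i j\<bar>)"
    by (intro order_trans[OF sum_abs] sum_mono sum_abs)
  also have "\<dots> \<le> (\<Sum>i\<in>I. \<Sum>j\<in>I. (x i)\<^sup>2 * \<bar>a i j\<bar> / 2 + (x j)\<^sup>2 * \<bar>a i j\<bar> / 2)"
  proof (intro sum_mono)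
    fix i j
    have "0 \<le> (\<bar>x i\<bar> - \<bar>x j\<bar>)\<^sup>2" by simp
    then have "\<bar>x i\<bar> * \<bar>x j\<bar> \<le> ((x i)\<^sup>2 + (x j)\<^sup>2) / 2" by (simp add: power2_diff)
    then have "\<bar>x i\<bar> * \<bar>x j\<bar> * \<bar>a i j\<bar> \<le> ((x i)\<^sup>2 + (x j)\<^sup>2) / 2 * \<bar>a i j\<bar>"
      by (rule mult_right_mono) simp
    then show "\<bar>x i * x j * a i j\<bar> \<le> (x i)\<^sup>2 * \<bar>a i j\<bar> / 2 + (x j)\<^sup>2 * \<bar>a i j\<bar> / 2"
      by (simp add: abs_mult algebra_simps add_divide_distrib)
  qed
  also have "\<dots> = (\<Sum>i\<in>I. \<Sum>j\<in>I. (x i)\<^sup>2 * \<bar>a i j\<bar> / 2) + (\<Sum>i\<in>I. \<Sum>j\<in>I. (x j)\<^sup>2 * \<bar>a i j\<bar> / 2)"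
    by (simp only: sum.distrib)
  also have "(\<Sum>i\<in>I. \<Sum>j\<in>I. (x j)\<^sup>2 * \<bar>a i j\<bar> / 2) = (\<Sum>j\<in>I. \<Sum>i\<in>I. (x j)\<^sup>2 * \<bar>a i j\<bar> / 2)"
    by (rule sum.swap)
  also have "\<dots> = (\<Sum>i\<in>I. \<Sum>j\<in>I. (x i)\<^sup>2 * \<bar>a i j\<bar> / 2)"
    using assms(2) by (intro sum.cong refl) simp
  also have "(\<Sum>i\<in>I. \<Sum>j\<in>I. (x i)\<^sup>2 * \<bar>a i j\<bar> / 2) + (\<Sum>i\<in>I. \<Sum>j\<in>I. (x i)\<^sup>2 * \<bar>a i j\<bar> / 2)
      = (\<Sum>i\<in>I. (x i)\<^sup>2 * (\<Sum>j\<in>I. \<bar>a i j\<bar>))"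
    by (simp add: sum_distrib_left mult.commute flip: sum.distrib)
  also have "\<dots> \<le> (\<Sum>i\<in>I. (x i)\<^sup>2 * \<rho>)"
    using assms(3) by (intro sum_mono mult_left_mono) auto
  finally show ?thesis by (simp add: sum_distrib_left mult_ac)
qed

text \<open>
  For large \<open>\<sigma>\<close> distinct points hardly interact: the resulting form is nearly diagonal.
\<close>

lemma gauss_exponential_sum:
  fixes s :: "nat \<Rightarrow> 'a::euclidean_space" and x :: "nat \<Rightarrow> real" and n :: nat
  assumes \<sigma>: "0 < \<sigma>"
  defines "P \<equiv> \<lambda>f. (cmod (\<Sum>i<n. of_real (x i) * cis (f \<bullet> s i)))\<^sup>2"
  shows "integrable lborel (\<lambda>f. gauss_kernel \<sigma> f * P f)"
    and "(\<integral>f. gauss_kernel \<sigma> f * P f \<partial>lborel) = (\<sigma> * sqrt (2 * pi)) ^ DIM('a) *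
      (\<Sum>i<n. \<Sum>j<n. x i * x j * exp (- (\<sigma>\<^sup>2 * (norm (s i - s j))\<^sup>2) / 2))"
proof -
  note G = gauss_fourier[OF \<sigma>, where 'a = 'a]
  have P: "gauss_kernel \<sigma> f * P f = (\<Sum>i<n. \<Sum>j<n. x i * x j * Re (of_real (gauss_kernel \<sigma> f) * cis (f \<bullet> (s i - s j))))" for f
    unfolding P_def cmod_square_sum_cis by (simp add: inner_diff_right sum_distrib_left mult_ac)
  have i: "integrable lborel (\<lambda>f. x i * x j * Re (of_real (gauss_kernel \<sigma> f) * cis (f \<bullet> (s i - s j))))" for i j
    by (intro integrable_mult_right integrable_Re G(1))
  show "integrable lborel (\<lambda>f. gauss_kernel \<sigma> f * P f)"
    unfolding P by (intro Bochner_Integration.integrable_sum i)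
  have "(\<integral>f. gauss_kernel \<sigma> f * P f \<partial>lborel) =
     (\<Sum>i<n. \<Sum>j<n. x i * x j * Re (\<integral>f. of_real (gauss_kernel \<sigma> f) * cis (f \<bullet> (s i - s j)) \<partial>lborel))"
    unfolding P by (subst integral_double_sum[OF i]) (simp only: integral_mult_right_zero integral_Re[OF G(1)])
  also have "\<dots> = (\<sigma> * sqrt (2 * pi)) ^ DIM('a) *
      (\<Sum>i<n. \<Sum>j<n. x i * x j * exp (- (\<sigma>\<^sup>2 * (norm (s i - s j))\<^sup>2) / 2))"
    unfolding G(2) Re_complex_of_real sum_distrib_left by (intro sum.cong refl) simp
  finally show "(\<integral>f. gauss_kernel \<sigma> f * P f \<partial>lborel) = (\<sigma> * sqrt (2 * pi)) ^ DIM('a) *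
      (\<Sum>i<n. \<Sum>j<n. x i * x j * exp (- (\<sigma>\<^sup>2 * (norm (s i - s j))\<^sup>2) / 2))" .
qed

text \<open>
  By compactness the spectral densities, damped by a Gaussian, exceed some \<open>m > 0\<close> on the ball of
  radius \<open>B\<close>. The function \<open>g = G\<^sub>\<sigma> - exp (- B\<^sup>2 / (4 \<sigma>\<^sup>2)) G\<^sub>\<tau>\<close> with \<open>\<tau> = sqrt 2 * \<sigma>\<close> is at most \<open>1\<close>
  everywhere and nonpositive outside the ball, so \<open>m * g\<close> is a minorant of the damped densities.
  The integral of the squared exponential sum against \<open>g\<close> is computed exactly. For large \<open>\<sigma>\<close> the first
  Gaussian contributes, up to a constant factor, at least half of the squared length of \<open>x\<close>, and for
  large \<open>B\<close> the second one takes away at most half of that.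
\<close>

theorem kernel_form_uniform_lower_bound:
  fixes s :: "nat \<Rightarrow> real ^ 'd" and K :: "real ^ 'p \<Rightarrow> real ^ 'd \<Rightarrow> real"
  assumes \<delta>: "0 < \<delta>" "\<And>i j. i \<noteq> j \<Longrightarrow> \<delta> \<le> infnorm (s i - s j)"
    and \<Theta>: "compact \<Theta>" and K: "\<And>\<theta>. \<theta> \<in> \<Theta> \<Longrightarrow> stationary_covariance (K \<theta>)" and ps: "positive_spectrum \<Theta> K"
  obtains b where "0 < b"
    "\<And>\<theta> n x. \<theta> \<in> \<Theta> \<Longrightarrow> b * sqnorm n x \<le> kernel_form (K \<theta>) s n x 0"
proof -
  obtain \<sigma> where \<sigma>: "0 < \<sigma>"
    "\<And>n i. (\<Sum>j\<in>{..<n} - {i}. exp (- (\<sigma>\<^sup>2 * (norm (s i - s j))\<^sup>2) / 2)) \<le> 1 / 2"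
    by (rule separated_gauss_offdiag_small[OF \<delta>]) auto
  let ?d = "CARD('d)"
  define \<tau> where "\<tau> = sqrt 2 * \<sigma>"
  have \<tau>: "0 < \<tau>" "\<tau>\<^sup>2 = 2 * \<sigma>\<^sup>2" using \<sigma>(1) by (simp_all add: \<tau>_def power_mult_distrib)
  \<comment> \<open>the second Gaussian has integral \<open>sqrt 2 ^ d\<close> relative to the first and row sums at most \<open>3/2\<close>,
    so this weight makes its contribution at most a quarter\<close>
  define q where "q = 1 / (6 * sqrt 2 ^ ?d)"
  have q: "0 < q" by (simp add: q_def)
  \<comment> \<open>radius beyond which the comparison function is nonpositive\<close>
  define B where "B = 2 * \<sigma> * sqrt (max 0 (- ln q))"
  have B0: "0 \<le> B" using \<sigma>(1) by (simp add: B_def)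
  have Bq: "exp (- (B\<^sup>2 / (4 * \<sigma>\<^sup>2))) \<le> q"
  proof -
    have "B\<^sup>2 / (4 * \<sigma>\<^sup>2) = max 0 (- ln q)" using \<sigma>(1) by (simp add: B_def power_mult_distrib)
    then have "- (B\<^sup>2 / (4 * \<sigma>\<^sup>2)) \<le> ln q" by linarith
    then have "exp (- (B\<^sup>2 / (4 * \<sigma>\<^sup>2))) \<le> exp (ln q)" by (simp only: exp_le_cancel_iff)
    then show ?thesis using q by simp
  qed
  define g where "g = (\<lambda>f :: real ^ 'd. gauss_kernel \<sigma> f - exp (- (B\<^sup>2 / (4 * \<sigma>\<^sup>2))) * gauss_kernel \<tau> f)"
  \<comment> \<open>the second Gaussian is the square root of the first, which gives the sign of \<open>g\<close>\<close>
  have sq: "gauss_kernel \<sigma> f = gauss_kernel \<tau> f * gauss_kernel \<tau> f" for f :: "real ^ 'd"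
    unfolding gauss_kernel_def \<tau>(2) exp_add[symmetric] using \<sigma>(1) by (simp add: field_simps)
  have g1: "g f \<le> 1" for f
  proof -
    have "gauss_kernel \<sigma> f \<le> 1" by (simp add: gauss_kernel_def)
    moreover have "0 \<le> exp (- (B\<^sup>2 / (4 * \<sigma>\<^sup>2))) * gauss_kernel \<tau> f" by (simp add: gauss_kernel_def)
    ultimately show ?thesis unfolding g_def by linarith
  qed
  have g0: "g f \<le> 0" if "B \<le> norm f" for f
  proof -
    have "B\<^sup>2 \<le> (norm f)\<^sup>2" using that B0 by (intro power_mono) auto
    then have "B\<^sup>2 / (4 * \<sigma>\<^sup>2) \<le> (norm f)\<^sup>2 / (4 * \<sigma>\<^sup>2)" by (intro divide_right_mono) auto
    then have "gauss_kernel \<tau> f \<le> exp (- (B\<^sup>2 / (4 * \<sigma>\<^sup>2)))" by (simp add: gauss_kernel_def \<tau>(2))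
    then have "gauss_kernel \<tau> f * gauss_kernel \<tau> f \<le> exp (- (B\<^sup>2 / (4 * \<sigma>\<^sup>2))) * gauss_kernel \<tau> f"
      by (intro mult_right_mono) (auto simp: gauss_kernel_def)
    then show ?thesis by (simp add: g_def sq)
  qed
  let ?k = "\<lambda>\<theta> f. Re (fourier_transform (K \<theta>) f)"
  have kpos: "0 < ?k \<theta> f" "fourier_transform (K \<theta>) f \<in> \<real>" if "\<theta> \<in> \<Theta>" for \<theta> f
    using ps that by (auto simp: positive_spectrum_def)
  obtain m where m: "0 < m" "\<And>\<theta> f. \<theta> \<in> \<Theta> \<Longrightarrow> norm f \<le> B \<Longrightarrow> m \<le> gauss_kernel 1 f * ?k \<theta> f"
  proof (cases "\<Theta> = {}")
    case True
    then show ?thesis using that[of 1] by simp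
  next
    case False
    let ?h = "\<lambda>(\<theta>, f). gauss_kernel 1 f * ?k \<theta> f"
    have c1: "continuous_on (\<Theta> \<times> cball 0 B) (\<lambda>p. Re ((\<lambda>(\<theta>, f). fourier_transform (K \<theta>) f) p))"
    proof (rule continuous_on_Re, rule continuous_on_subset)
      show "continuous_on (\<Theta> \<times> UNIV) (\<lambda>p. (\<lambda>(\<theta>, f). fourier_transform (K \<theta>) f) p)"
        using ps by (simp add: positive_spectrum_def)
    qed auto
    have c2: "continuous_on (\<Theta> \<times> cball 0 B) (\<lambda>p. gauss_kernel 1 (snd p :: real ^ 'd))"
      by (rule continuous_on_compose2[OF gauss_kernel_continuous[of UNIV] continuous_on_snd[OF continuous_on_id]]) auto
    have "continuous_on (\<Theta> \<times> cball 0 B) (\<lambda>p. gauss_kernel 1 (snd p) * Re ((\<lambda>(\<theta>, f). fourier_transform (K \<theta>) f) p))"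
      by (rule continuous_on_mult[OF c2 c1])
    then have "continuous_on (\<Theta> \<times> cball 0 B) ?h" by (simp add: case_prod_beta')
    moreover have "compact (\<Theta> \<times> cball (0 :: real ^ 'd) B)" using \<Theta> by (intro compact_Times) auto
    moreover have "\<Theta> \<times> cball (0 :: real ^ 'd) B \<noteq> {}" using False B0 by auto
    ultimately have "\<exists>p\<in>\<Theta> \<times> cball 0 B. \<forall>y\<in>\<Theta> \<times> cball 0 B. ?h p \<le> ?h y"
      by (intro continuous_attains_inf)
    then obtain p where p: "p \<in> \<Theta> \<times> cball 0 B" "\<And>y. y \<in> \<Theta> \<times> cball 0 B \<Longrightarrow> ?h p \<le> ?h y"
      by blast
    show ?thesis
    proof (rule that[of "?h p"])
      show "0 < ?h p" using p(1) kpos(1) gauss_kernel_pos by (cases p) (auto intro!: mult_pos_pos)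
      show "?h p \<le> gauss_kernel 1 f * ?k \<theta> f" if "\<theta> \<in> \<Theta>" "norm f \<le> B" for \<theta> f
        using p(2)[of "(\<theta>, f)"] that by simp
    qed
  qed
  have mg: "m * g f \<le> gauss_kernel 1 f * ?k \<theta> f" if "\<theta> \<in> \<Theta>" for \<theta> f
  proof (cases "norm f \<le> B")
    case True
    have "m * g f \<le> m * 1" using g1 m(1) by (intro mult_left_mono) auto
    then show ?thesis using m(2)[OF that True] by simp
  next
    case False
    then have "m * g f \<le> 0" using g0[of f] m(1) by (intro mult_nonneg_nonpos) auto
    also have "0 \<le> gauss_kernel 1 f * ?k \<theta> f"
      using kpos(1)[OF that] gauss_kernel_pos by (intro mult_nonneg_nonneg less_imp_le)
    finally show ?thesis .
  qed
  have intK: "integrable lebesgue (K \<theta>)" if "\<theta> \<in> \<Theta>" for \<theta>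
  proof (rule ccontr)
    assume "\<not> integrable lebesgue (K \<theta>)"
    then have "fourier_transform (K \<theta>) 0 = 0"
      by (simp add: fourier_transform_def integral_complex_of_real not_integrable_integral_eq)
    then show False using kpos(1)[OF that, of 0] by simp
  qed
  define N where "N = (\<sigma> * sqrt (2 * pi)) ^ ?d"
  have N: "0 < N" using \<sigma>(1) by (simp add: N_def)
  have N\<tau>: "(\<tau> * sqrt (2 * pi)) ^ ?d = sqrt 2 ^ ?d * N" by (simp add: N_def \<tau>_def power_mult_distrib)
  show ?thesis
  proof (rule that[of "m * (N / 4)"])
    show "0 < m * (N / 4)" using m N by simp
    fix \<theta> n x assume \<theta>: "\<theta> \<in> \<Theta>"
    define P where "P = (\<lambda>f. (cmod (\<Sum>i<n. of_real (x i) * cis (f \<bullet> s i)))\<^sup>2)"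
    note R = spectral_representation_le[OF K[OF \<theta>] intK[OF \<theta>] kpos(2)[OF \<theta>], of x s n, folded fun_cong[OF P_def]]
    note G\<sigma> = gauss_exponential_sum[OF \<sigma>(1), of x s n, folded fun_cong[OF P_def], unfolded DIM_cart DIM_real mult_1_right, folded N_def]
    note G\<tau> = gauss_exponential_sum[OF \<tau>(1), of x s n, folded fun_cong[OF P_def], unfolded DIM_cart DIM_real mult_1_right N\<tau>]
    let ?e = "\<lambda>\<sigma> i j. exp (- (\<sigma>\<^sup>2 * (norm (s i - s j))\<^sup>2) / 2)"
    have off: "\<bar>\<Sum>i<n. \<Sum>j<n. x i * x j * (if j = i then 0 else ?e \<sigma> i j)\<bar> \<le> 1 / 2 * sqnorm n x"
      unfolding sqnorm_def
    proof (rule row_sum_form_le)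
      fix i assume "i \<in> {..<n}"
      have "(\<Sum>j<n. \<bar>if j = i then 0 else ?e \<sigma> i j\<bar>) = (\<Sum>j\<in>{..<n} - {i}. ?e \<sigma> i j)"
        by (intro sum.mono_neutral_cong_right) auto
      then show "(\<Sum>j<n. \<bar>if j = i then 0 else ?e \<sigma> i j\<bar>) \<le> 1 / 2" using \<sigma>(2)[of i n] by simp
    qed (auto simp: norm_minus_commute)
    have "(\<Sum>i<n. \<Sum>j<n. x i * x j * ?e \<sigma> i j) = (\<Sum>i<n. \<Sum>j<n. (if j = i then (x i)\<^sup>2 else 0) + x i * x j * (if j = i then 0 else ?e \<sigma> i j))"
      by (intro sum.cong refl) (auto simp: power2_eq_square)
    also have "\<dots> = sqnorm n x + (\<Sum>i<n. \<Sum>j<n. x i * x j * (if j = i then 0 else ?e \<sigma> i j))"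
      by (simp only: sum.distrib) (simp add: sqnorm_def)
    finally have e\<sigma>: "1 / 2 * sqnorm n x \<le> (\<Sum>i<n. \<Sum>j<n. x i * x j * ?e \<sigma> i j)" using off by simp
    have e\<tau>: "(\<Sum>i<n. \<Sum>j<n. x i * x j * ?e \<tau> i j) \<le> 3 / 2 * sqnorm n x"
    proof -
      have "\<bar>\<Sum>i<n. \<Sum>j<n. x i * x j * ?e \<tau> i j\<bar> \<le> 3 / 2 * (\<Sum>i<n. (x i)\<^sup>2)"
      proof (rule row_sum_form_le)
        fix i assume i: "i \<in> {..<n}"
        have "(\<Sum>j<n. \<bar>?e \<tau> i j\<bar>) = \<bar>?e \<tau> i i\<bar> + (\<Sum>j\<in>{..<n} - {i}. \<bar>?e \<tau> i j\<bar>)"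
          using i by (simp add: sum.remove)
        also have "(\<Sum>j\<in>{..<n} - {i}. \<bar>?e \<tau> i j\<bar>) \<le> (\<Sum>j\<in>{..<n} - {i}. ?e \<sigma> i j)"
          by (intro sum_mono) (simp add: \<tau>(2))
        finally show "(\<Sum>j<n. \<bar>?e \<tau> i j\<bar>) \<le> 3 / 2" using \<sigma>(2)[of i n] by simp
      qed (auto simp: norm_minus_commute)
      then show ?thesis by (simp add: sqnorm_def)
    qed
    have "m * (N / 4) * sqnorm n x \<le> m * (N * (\<Sum>i<n. \<Sum>j<n. x i * x j * ?e \<sigma> i j) -
       exp (- (B\<^sup>2 / (4 * \<sigma>\<^sup>2))) * (sqrt 2 ^ ?d * N * (\<Sum>i<n. \<Sum>j<n. x i * x j * ?e \<tau> i j)))"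
    proof -
      let ?E = "exp (- (B\<^sup>2 / (4 * \<sigma>\<^sup>2)))"
      have "?E * (sqrt 2 ^ ?d * N * (\<Sum>i<n. \<Sum>j<n. x i * x j * ?e \<tau> i j)) \<le> ?E * (sqrt 2 ^ ?d * N * (3 / 2 * sqnorm n x))"
        using N e\<tau> by (intro mult_left_mono) auto
      also have "\<dots> \<le> q * (sqrt 2 ^ ?d * N * (3 / 2 * sqnorm n x))"
        using N sqnorm_nonneg[of n x] by (intro mult_right_mono Bq) auto
      also have "\<dots> = N / 4 * sqnorm n x" by (simp add: q_def)
      finally have 1: "?E * (sqrt 2 ^ ?d * N * (\<Sum>i<n. \<Sum>j<n. x i * x j * ?e \<tau> i j)) \<le> N / 4 * sqnorm n x" .
      have "N * (1 / 2 * sqnorm n x) \<le> N * (\<Sum>i<n. \<Sum>j<n. x i * x j * ?e \<sigma> i j)"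
        using N e\<sigma> by (intro mult_left_mono) auto
      with 1 have "N / 4 * sqnorm n x \<le> N * (\<Sum>i<n. \<Sum>j<n. x i * x j * ?e \<sigma> i j) -
         ?E * (sqrt 2 ^ ?d * N * (\<Sum>i<n. \<Sum>j<n. x i * x j * ?e \<tau> i j))" by simp
      then show ?thesis using m(1) by (simp add: mult.assoc)
    qed
    also have "\<dots> = (\<integral>f. m * (gauss_kernel \<sigma> f * P f - exp (- (B\<^sup>2 / (4 * \<sigma>\<^sup>2))) * (gauss_kernel \<tau> f * P f)) \<partial>lborel)"
      using G\<sigma>(1) G\<tau>(1) by (simp add: G\<sigma>(2) G\<tau>(2))
    also have "\<dots> \<le> (\<integral>f. gauss_kernel 1 f * ?k \<theta> f * P f \<partial>lborel)"
    proof (rule integral_mono)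
      show "integrable lborel (\<lambda>f. m * (gauss_kernel \<sigma> f * P f - exp (- (B\<^sup>2 / (4 * \<sigma>\<^sup>2))) * (gauss_kernel \<tau> f * P f)))"
        using G\<sigma>(1) G\<tau>(1) by (intro integrable_mult_right Bochner_Integration.integrable_diff)
      show "integrable lborel (\<lambda>f. gauss_kernel 1 f * ?k \<theta> f * P f)" by (rule R(1))
      fix f
      have "m * (gauss_kernel \<sigma> f * P f - exp (- (B\<^sup>2 / (4 * \<sigma>\<^sup>2))) * (gauss_kernel \<tau> f * P f)) = m * g f * P f"
        by (simp add: g_def algebra_simps)
      also have "\<dots> \<le> gauss_kernel 1 f * ?k \<theta> f * P f"
        by (intro mult_right_mono mg \<theta>) (simp add: P_def)
      finally show "m * (gauss_kernel \<sigma> f * P f - exp (- (B\<^sup>2 / (4 * \<sigma>\<^sup>2))) * (gauss_kernel \<tau> f * P f)) \<le> gauss_kernel 1 f * ?k \<theta> f * P f" .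
    qed
    also have "\<dots> \<le> kernel_form (K \<theta>) s n x 0" by (rule R(2))
    finally show "m * (N / 4) * sqnorm n x \<le> kernel_form (K \<theta>) s n x 0" .
  qed
qed

section \<open>Dependence of covariance matrices on the parameter\<close>

lemma schur_test:
  assumes A: "sym_mat n A" and r: "\<And>i. i < n \<Longrightarrow> (\<Sum>j<n. \<bar>A $$ (i, j)\<bar>) \<le> \<rho>" and \<rho>: "0 \<le> \<rho>"
  shows "sqnorm n (matvec n A x) \<le> \<rho>\<^sup>2 * sqnorm n x"
proof -
  have "(matvec n A x i)\<^sup>2 \<le> \<rho> * (\<Sum>j<n. \<bar>A $$ (i, j)\<bar> * (x j)\<^sup>2)" if i: "i < n" for i
  proof -
    let ?r = "\<lambda>j. sqrt \<bar>A $$ (i, j)\<bar>"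
    have "\<bar>matvec n A x i\<bar> \<le> (\<Sum>j<n. \<bar>A $$ (i, j) * x j\<bar>)" unfolding matvec_def by (rule sum_abs)
    also have "\<dots> = (\<Sum>j<n. ?r j * (?r j * \<bar>x j\<bar>))" by (simp add: abs_mult flip: mult.assoc)
    finally have "(matvec n A x i)\<^sup>2 \<le> (\<Sum>j<n. ?r j * (?r j * \<bar>x j\<bar>))\<^sup>2"
      using power_mono[OF _ abs_ge_zero, of "matvec n A x i" _ 2] by simp
    also have "\<dots> \<le> (\<Sum>j<n. (?r j)\<^sup>2) * (\<Sum>j<n. (?r j * \<bar>x j\<bar>)\<^sup>2)" by (rule Cauchy_Schwarz_ineq_sum)
    also have "\<dots> = (\<Sum>j<n. \<bar>A $$ (i, j)\<bar>) * (\<Sum>j<n. \<bar>A $$ (i, j)\<bar> * (x j)\<^sup>2)"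
      by (simp add: power_mult_distrib)
    also have "\<dots> \<le> \<rho> * (\<Sum>j<n. \<bar>A $$ (i, j)\<bar> * (x j)\<^sup>2)"
      using r[OF i] by (intro mult_right_mono sum_nonneg) auto
    finally show ?thesis .
  qed
  then have "sqnorm n (matvec n A x) \<le> (\<Sum>i<n. \<rho> * (\<Sum>j<n. \<bar>A $$ (i, j)\<bar> * (x j)\<^sup>2))"
    unfolding sqnorm_def by (intro sum_mono) auto
  also have "\<dots> = \<rho> * (\<Sum>j<n. \<Sum>i<n. \<bar>A $$ (i, j)\<bar> * (x j)\<^sup>2)"
    unfolding sum_distrib_left by (rule sum.swap)
  also have "\<dots> = \<rho> * (\<Sum>j<n. (\<Sum>i<n. \<bar>A $$ (j, i)\<bar>) * (x j)\<^sup>2)"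
  proof -
    have "(\<Sum>i<n. \<bar>A $$ (i, j)\<bar> * (x j)\<^sup>2) = (\<Sum>i<n. \<bar>A $$ (j, i)\<bar>) * (x j)\<^sup>2" if "j < n" for j
      unfolding sum_distrib_right using A that by (intro sum.cong refl) (simp add: sym_mat_def)
    then show ?thesis by simp
  qed
  also have "\<dots> \<le> \<rho> * (\<Sum>j<n. \<rho> * (x j)\<^sup>2)"
    using r \<rho> by (intro mult_left_mono sum_mono mult_right_mono) auto
  finally show ?thesis by (simp add: sqnorm_def power2_eq_square mult.assoc flip: sum_distrib_left)
qed

lemma cov_matrix_entry: "i < n \<Longrightarrow> j < n \<Longrightarrow> cov_matrix k s n $$ (i, j) = k (s i - s j)"
  by (simp add: cov_matrix_def)

lemma sym_mat_cov_matrix: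
  assumes "stationary_covariance k" shows "sym_mat n (cov_matrix k s n)"
proof -
  have "k (s i - s j) = k (s j - s i)" for i j
    using stationary_covariance_even[OF assms, of "s i - s j"] by simp
  then show ?thesis by (auto simp: sym_mat_def cov_matrix_def)
qed

lemma quad_form_cov_matrix: "quad_form n (cov_matrix k s n) x = kernel_form k s n x 0"
  by (auto simp: quad_form_altdef kernel_form_def cov_matrix_entry mult_ac intro!: sum.cong)

lemma exp_decay_row_sum:
  assumes k: "\<And>h. \<bar>k h\<bar> \<le> C * exp (- c * infnorm h)" and S: "\<And>n x. (\<Sum>j<n. exp (- c * infnorm (x - s j))) \<le> S"
    and C: "0 \<le> C"
  shows "(\<Sum>j<(n::nat). \<bar>k (x - s j)\<bar>) \<le> C * S"
proof -
  have "(\<Sum>j<n. \<bar>k (x - s j)\<bar>) \<le> (\<Sum>j<n. C * exp (- c * infnorm (x - s j)))" by (intro sum_mono k)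
  also have "\<dots> = C * (\<Sum>j<n. exp (- c * infnorm (x - s j)))" by (simp only: sum_distrib_left)
  also have "\<dots> \<le> C * S" by (intro mult_left_mono S C)
  finally show ?thesis .
qed

text \<open>
  With \<open>v = S x\<close> and \<open>v' = S' x\<close> the difference of the forms is the pairing of \<open>v\<close> with \<open>(R' - R) v'\<close>.
\<close>

lemma inverse_quad_form_diff:
  assumes R: "sym_mat n R" "R * S = 1\<^sub>m n" "S \<in> carrier_mat n n" "\<And>x. b\<^sup>2 * sqnorm n (matvec n S x) \<le> sqnorm n x"
    and R': "sym_mat n R'" "R' * S' = 1\<^sub>m n" "S' \<in> carrier_mat n n" "\<And>x. b\<^sup>2 * sqnorm n (matvec n S' x) \<le> sqnorm n x"
    and D: "\<And>x. sqnorm n (\<lambda>i. matvec n R' x i - matvec n R x i) \<le> \<epsilon>\<^sup>2 * sqnorm n x"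
    and b: "0 < b" and \<epsilon>: "0 \<le> \<epsilon>"
  shows "\<bar>quad_form n S x - quad_form n S' x\<bar> \<le> \<epsilon> / b\<^sup>2 * sqnorm n x"
proof -
  define v where "v = matvec n S x"
  define v' where "v' = matvec n S' x"
  have Rc: "R \<in> carrier_mat n n" "R' \<in> carrier_mat n n" using R R' by (auto simp: sym_mat_def)
  have Rv: "matvec n R v i = x i" "matvec n R' v' i = x i" if "i < n" for i
    using that Rc R R' unfolding v_def v'_def by (simp_all flip: matvec_mult add: matvec_one)
  have "quad_form n S x - quad_form n S' x = (\<Sum>i<n. x i * v i) - (\<Sum>i<n. x i * v' i)"
    by (simp add: quad_form_def v_def v'_def)
  also have "\<dots> = (\<Sum>i<n. v i * matvec n R' v' i) - (\<Sum>i<n. matvec n R v i * v' i)"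
    by (simp add: Rv mult.commute)
  also have "\<dots> = (\<Sum>i<n. v i * (matvec n R' v' i - matvec n R v' i))"
    by (simp add: matvec_symmetric[OF R(1), symmetric] right_diff_distrib sum_subtractf)
  finally have "(quad_form n S x - quad_form n S' x)\<^sup>2 \<le>
      sqnorm n v * sqnorm n (\<lambda>i. matvec n R' v' i - matvec n R v' i)"
    using inner_square_le by simp
  also have "\<dots> \<le> (sqnorm n x / b\<^sup>2) * (\<epsilon>\<^sup>2 * (sqnorm n x / b\<^sup>2))"
  proof (intro mult_mono)
    show "sqnorm n v \<le> sqnorm n x / b\<^sup>2" using R(4)[of x] b by (simp add: v_def field_simps)
    have "sqnorm n (\<lambda>i. matvec n R' v' i - matvec n R v' i) \<le> \<epsilon>\<^sup>2 * sqnorm n v'" by (rule D)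
    also have "\<dots> \<le> \<epsilon>\<^sup>2 * (sqnorm n x / b\<^sup>2)"
      using R'(4)[of x] b by (intro mult_left_mono) (simp_all add: v'_def field_simps)
    finally show "sqnorm n (\<lambda>i. matvec n R' v' i - matvec n R v' i) \<le> \<epsilon>\<^sup>2 * (sqnorm n x / b\<^sup>2)" .
  qed (auto simp: sqnorm_nonneg)
  also have "\<dots> = (\<epsilon> / b\<^sup>2 * sqnorm n x)\<^sup>2" by (simp add: power2_eq_square)
  finally have "\<bar>quad_form n S x - quad_form n S' x\<bar>\<^sup>2 \<le> (\<epsilon> / b\<^sup>2 * sqnorm n x)\<^sup>2" by simp
  then show ?thesis
    by (rule power2_le_imp_le) (use \<epsilon> sqnorm_nonneg in auto)
qed

lemma partial_deriv_frechet:
  assumes "(g has_derivative g') (at \<theta>)"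
  shows "partial_deriv i g \<theta> = g' (axis i 1)"
proof -
  have "((\<lambda>t. g (\<theta> + t *\<^sub>R axis i 1)) has_derivative (\<lambda>t. g' (t *\<^sub>R axis i 1))) (at 0)"
    by (rule has_derivative_compose[where g = g and f = "\<lambda>t. \<theta> + t *\<^sub>R axis i 1"])
      (auto intro!: derivative_eq_intros simp: assms)
  moreover have "g' (t *\<^sub>R axis i 1) = g' (axis i 1) * t" for t
    using linear_scale[OF has_derivative_linear[OF assms]] by (simp add: mult.commute)
  ultimately have "((\<lambda>t. g (\<theta> + t *\<^sub>R axis i 1)) has_field_derivative g' (axis i 1)) (at 0)"
    by (simp add: has_field_derivative_def)
  then show ?thesis unfolding partial_deriv_def by (rule DERIV_imp_deriv)
qed

text \<open>
  Bounds on the partial derivatives give Lipschitz bounds on balls only, since segments have to stay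
  in the domain.
\<close>

lemma partial_deriv_bound_lipschitz:
  fixes g :: "real ^ 'p \<Rightarrow> real" and B :: real
  assumes U: "open U" "ball \<theta> e \<subseteq> U" and g: "g differentiable_on U"
    and B: "\<And>i \<eta>. \<eta> \<in> U \<Longrightarrow> \<bar>partial_deriv i g \<eta>\<bar> \<le> B" and \<theta>': "\<theta>' \<in> ball \<theta> e"
  shows "\<bar>g \<theta>' - g \<theta>\<bar> \<le> real CARD('p) * B * norm (\<theta>' - \<theta>)"
proof -
  have B0: "0 \<le> B"
  proof -
    have "\<theta>' \<in> U" using \<theta>' U(2) by auto
    from B[OF this] show ?thesis by (meson abs_ge_zero order_trans)
  qed
  let ?g' = "\<lambda>\<eta>. frechet_derivative g (at \<eta>)"
  have d: "(g has_derivative ?g' \<eta>) (at \<eta>)" if "\<eta> \<in> ball \<theta> e" for \<eta>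
  proof -
    have "\<eta> \<in> U" using that U(2) by auto
    then have "g differentiable at \<eta>" using g U(1) by (simp add: differentiable_on_eq_differentiable_at)
    then show ?thesis by (simp add: frechet_derivative_works[symmetric])
  qed
  have "norm (g \<theta>' - g \<theta>) \<le> real CARD('p) * B * norm (\<theta>' - \<theta>)"
  proof (rule differentiable_bound[OF convex_ball])
    fix \<eta> assume \<eta>: "\<eta> \<in> ball \<theta> e"
    show "(g has_derivative ?g' \<eta>) (at \<eta> within ball \<theta> e)"
      using d[OF \<eta>] by (rule has_derivative_at_withinI)
    have lin: "linear (?g' \<eta>)" using d[OF \<eta>] by (rule has_derivative_linear)
    show "onorm (?g' \<eta>) \<le> real CARD('p) * B"
    proof (rule onorm_bound)
      fix h :: "real ^ 'p"
      have "?g' \<eta> h = ?g' \<eta> (\<Sum>i\<in>UNIV. (h $ i) *\<^sub>R axis i 1)" by (simp only: basis_expansion scalar_mult_eq_scaleR[symmetric])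
      also have "\<dots> = (\<Sum>i\<in>UNIV. h $ i * partial_deriv i g \<eta>)"
        by (simp add: linear_sum[OF lin] linear_scale[OF lin] partial_deriv_frechet[OF d[OF \<eta>]])
      finally have "norm (?g' \<eta> h) \<le> (\<Sum>i\<in>UNIV. \<bar>h $ i * partial_deriv i g \<eta>\<bar>)" by (simp add: sum_abs)
      also have "\<dots> \<le> (\<Sum>i\<in>(UNIV :: 'p set). norm h * B)"
        unfolding abs_mult using B \<eta> U(2) B0 by (intro sum_mono mult_mono component_le_norm_cart) auto
      finally show "norm (?g' \<eta> h) \<le> real CARD('p) * B * norm h" by (simp add: mult_ac)
    qed (use B0 in simp)
  next
    show "\<theta>' \<in> ball \<theta> e" by fact
    have "0 \<le> dist \<theta> \<theta>'" by simp
    then have "0 < e" using \<theta>' by (auto simp only: mem_ball intro: le_less_trans)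
    then show "\<theta> \<in> ball \<theta> e" by simp
  qed
  then show ?thesis by simp
qed

text \<open>
  Compactness of \<open>\<Theta>\<close> provides balls of one common radius inside the neighbourhood on which the
  derivatives are controlled. Hence the Lipschitz bound for close parameters, connected in \<open>\<Theta>\<close> or not.
\<close>

lemma regular_family_lipschitz:
  fixes K :: "real ^ 'p \<Rightarrow> real ^ 'd \<Rightarrow> real"
  assumes "regular_family \<Theta> K" "compact \<Theta>"
  obtains \<eta> D C c where "0 < \<eta>" "0 < D" "0 < C" "0 < c"
    "\<And>\<theta> h. \<theta> \<in> \<Theta> \<Longrightarrow> \<bar>K \<theta> h\<bar> \<le> C * exp (- c * infnorm h)"
    "\<And>\<theta> \<theta>' h. \<theta> \<in> \<Theta> \<Longrightarrow> \<theta>' \<in> \<Theta> \<Longrightarrow> dist \<theta> \<theta>' < \<eta> \<Longrightarrow> \<bar>K \<theta>' h - K \<theta> h\<bar> \<le> D * dist \<theta> \<theta>'"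
proof -
  from assms(1) obtain U C c where U: "open U" "\<Theta> \<subseteq> U" and c: "0 < c"
    and diff: "\<And>h. times_cont_differentiable_on 3 (\<lambda>\<theta>. K \<theta> h) U"
    and dec: "\<And>h \<theta>. \<theta> \<in> \<Theta> \<Longrightarrow> \<bar>K \<theta> h\<bar> \<le> C * exp (- c * infnorm h)"
    and der: "\<And>h \<theta> is. \<theta> \<in> U \<Longrightarrow> length is \<in> {1, 2, 3} \<Longrightarrow>
       \<bar>iterated_partial is (\<lambda>\<theta>. K \<theta> h) \<theta>\<bar> \<le> C / (1 + infnorm h powr (real CARD('d) + c))"
    unfolding regular_family_def by blast
  obtain e where e: "0 < e" "(\<Union>\<theta>\<in>\<Theta>. ball \<theta> e) \<subseteq> U"
    using compact_subset_open_imp_ball_epsilon_subset[OF assms(2) U] by blast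
  let ?B = "\<bar>C\<bar> + 1"
  have pd: "\<bar>partial_deriv i (\<lambda>\<theta>. K \<theta> h) \<theta>\<bar> \<le> ?B" if "\<theta> \<in> U" for i h \<theta>
  proof -
    let ?w = "infnorm h powr (real CARD('d) + c)"
    have "\<bar>partial_deriv i (\<lambda>\<theta>. K \<theta> h) \<theta>\<bar> \<le> C / (1 + ?w)"
      using der[OF that, of "[i]" h] by (simp add: iterated_partial_def)
    also have "\<dots> \<le> \<bar>C\<bar> / 1" by (intro frac_le) auto
    finally show ?thesis by simp
  qed
  show ?thesis
  proof (rule that[of e "real CARD('p) * ?B" ?B c])
    show "\<bar>K \<theta> h\<bar> \<le> ?B * exp (- c * infnorm h)" if "\<theta> \<in> \<Theta>" for \<theta> h
      using dec[OF that, of h] by (rule order_trans) (intro mult_right_mono, auto)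
    fix \<theta> \<theta>' h assume \<theta>: "\<theta> \<in> \<Theta>" "\<theta>' \<in> \<Theta>" "dist \<theta> \<theta>' < e"
    have "(\<lambda>\<theta>. K \<theta> h) differentiable_on U"
      using diff[of h] by (simp add: numeral_3_eq_3)
    moreover have "ball \<theta> e \<subseteq> U" using \<theta>(1) e(2) by auto
    ultimately have "\<bar>K \<theta>' h - K \<theta> h\<bar> \<le> real CARD('p) * ?B * norm (\<theta>' - \<theta>)"
      using \<theta>(3) by (intro partial_deriv_bound_lipschitz[OF U(1)] pd) auto
    then show "\<bar>K \<theta>' h - K \<theta> h\<bar> \<le> real CARD('p) * ?B * dist \<theta> \<theta>'"
      by (simp add: dist_norm norm_minus_commute)
  qed (use e c in \<open>auto simp: add_nonneg_pos\<close>)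
qed

text \<open>
  The entries of the difference of two covariance matrices are bounded by \<open>D * dist \<theta> \<theta>'\<close> and by
  \<open>2 * C * exp (- c * r)\<close> at distance \<open>r\<close>. The geometric mean of the two bounds is small for close
  parameters and summable over separated points, as required by the row sum criterion.
\<close>

lemma covariance_modulus:
  fixes K :: "real ^ 'p \<Rightarrow> real ^ 'd \<Rightarrow> real" and s :: "nat \<Rightarrow> real ^ 'd"
  assumes rf: "regular_family \<Theta> K" and \<Theta>: "compact \<Theta>"
    and stat: "\<And>\<theta>. \<theta> \<in> \<Theta> \<Longrightarrow> stationary_covariance (K \<theta>)"
    and \<delta>: "0 < \<delta>" "\<And>i j. i \<noteq> j \<Longrightarrow> \<delta> \<le> infnorm (s i - s j)" and \<epsilon>: "0 < \<epsilon>"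
  obtains \<eta> where "0 < \<eta>"
    "\<And>\<theta> \<theta>' n x. \<theta> \<in> \<Theta> \<Longrightarrow> \<theta>' \<in> \<Theta> \<Longrightarrow> dist \<theta> \<theta>' < \<eta> \<Longrightarrow>
       sqnorm n (\<lambda>i. matvec n (cov_matrix (K \<theta>') s n) x i - matvec n (cov_matrix (K \<theta>) s n) x i) \<le> \<epsilon>\<^sup>2 * sqnorm n x"
proof -
  obtain \<eta>0 D C c where P: "0 < \<eta>0" "0 < D" "0 < C" "0 < c"
    and dec: "\<And>\<theta> h. \<theta> \<in> \<Theta> \<Longrightarrow> \<bar>K \<theta> h\<bar> \<le> C * exp (- c * infnorm h)"
    and lip: "\<And>\<theta> \<theta>' h. \<theta> \<in> \<Theta> \<Longrightarrow> \<theta>' \<in> \<Theta> \<Longrightarrow> dist \<theta> \<theta>' < \<eta>0 \<Longrightarrow> \<bar>K \<theta>' h - K \<theta> h\<bar> \<le> D * dist \<theta> \<theta>'"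
    by (rule regular_family_lipschitz[OF rf \<Theta>]) blast
  obtain S where S: "0 < S" "\<And>n x. (\<Sum>j<n. exp (- (c / 2) * infnorm (x - s j))) \<le> S"
    by (rule separated_exp_sum_bounded[OF \<delta>, where c = "c / 2"]) (use P in auto)
  define \<eta> where "\<eta> = min \<eta>0 ((\<epsilon> / S)\<^sup>2 / (2 * C * D))"
  show ?thesis
  proof (rule that[of \<eta>])
    show "0 < \<eta>" using P S \<epsilon> by (simp add: \<eta>_def)
    fix \<theta> \<theta>' n x assume \<theta>: "\<theta> \<in> \<Theta>" "\<theta>' \<in> \<Theta>" "dist \<theta> \<theta>' < \<eta>"
    have bound: "\<bar>K \<theta>' h - K \<theta> h\<bar> \<le> \<epsilon> / S * exp (- (c / 2) * infnorm h)" for h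
    proof -
      have 1: "\<bar>K \<theta>' h - K \<theta> h\<bar> \<le> 2 * C * exp (- c * infnorm h)" using dec[OF \<theta>(1), of h] dec[OF \<theta>(2), of h] by linarith
      have "\<bar>K \<theta>' h - K \<theta> h\<bar> \<le> D * dist \<theta> \<theta>'" using \<theta> by (intro lip) (auto simp: \<eta>_def)
      also have "\<dots> \<le> D * ((\<epsilon> / S)\<^sup>2 / (2 * C * D))" using \<theta>(3) P by (intro mult_left_mono) (auto simp: \<eta>_def)
      also have "\<dots> = (\<epsilon> / S)\<^sup>2 / (2 * C)" using P by simp
      finally have "\<bar>K \<theta>' h - K \<theta> h\<bar> * \<bar>K \<theta>' h - K \<theta> h\<bar> \<le> (\<epsilon> / S)\<^sup>2 / (2 * C) * (2 * C * exp (- c * infnorm h))"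
        using 1 P by (intro mult_mono) auto
      also have "\<dots> = (\<epsilon> / S * exp (- (c / 2) * infnorm h))\<^sup>2"
      proof -
        have "(exp (- (c / 2) * infnorm h))\<^sup>2 = exp (- c * infnorm h)"
          by (simp add: power2_eq_square flip: exp_add)
        then show ?thesis using P(3) unfolding power_mult_distrib by simp
      qed
      finally have "\<bar>K \<theta>' h - K \<theta> h\<bar>\<^sup>2 \<le> (\<epsilon> / S * exp (- (c / 2) * infnorm h))\<^sup>2"
        by (simp only: power2_eq_square)
      then show ?thesis by (rule power2_le_imp_le) (use \<epsilon> S in auto)
    qed
    let ?A = "cov_matrix (\<lambda>h. K \<theta>' h - K \<theta> h) s n"
    have symA: "sym_mat n ?A"
    proof -
      have "K \<theta>'' (s i - s j) = K \<theta>'' (s j - s i)" if "\<theta>'' \<in> \<Theta>" for \<theta>'' i j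
        using stationary_covariance_even[OF stat[OF that], of "s i - s j"] by simp
      then show ?thesis using \<theta> by (auto simp: sym_mat_def cov_matrix_def)
    qed
    have "sqnorm n (matvec n ?A x) \<le> \<epsilon>\<^sup>2 * sqnorm n x"
    proof (rule schur_test[OF symA])
      fix i assume i: "i < n"
      have "(\<Sum>j<n. \<bar>?A $$ (i, j)\<bar>) = (\<Sum>j<n. \<bar>K \<theta>' (s i - s j) - K \<theta> (s i - s j)\<bar>)"
        using i by (intro sum.cong refl) (simp add: cov_matrix_entry)
      also have "\<dots> \<le> \<epsilon> / S * S"
        using \<epsilon> S(1) by (intro exp_decay_row_sum[where c = "c / 2" and k = "\<lambda>h. K \<theta>' h - K \<theta> h"] bound S(2)) auto
      finally show "(\<Sum>j<n. \<bar>?A $$ (i, j)\<bar>) \<le> \<epsilon>" using S(1) by simp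
    qed (use \<epsilon> in simp)
    moreover have "sqnorm n (matvec n ?A x) =
       sqnorm n (\<lambda>i. matvec n (cov_matrix (K \<theta>') s n) x i - matvec n (cov_matrix (K \<theta>) s n) x i)"
      by (rule sqnorm_cong) (simp add: matvec_def cov_matrix_entry left_diff_distrib sum_subtractf)
    ultimately show "sqnorm n (\<lambda>i. matvec n (cov_matrix (K \<theta>') s n) x i - matvec n (cov_matrix (K \<theta>) s n) x i) \<le> \<epsilon>\<^sup>2 * sqnorm n x"
      by simp
  qed
qed

section \<open>Consistency of the maximum likelihood estimator\<close>

lemma asymptotically_identifiable_bound:
  assumes "asymptotically_identifiable \<Theta> K s \<theta>0" "0 < \<alpha>"
  obtains \<delta> N where "0 < \<delta>" "\<And>n \<theta>. N \<le> n \<Longrightarrow> \<theta> \<in> \<Theta> \<Longrightarrow> \<alpha> \<le> norm (\<theta> - \<theta>0) \<Longrightarrow>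
     \<delta> \<le> 1 / real n * (\<Sum>i<n. \<Sum>j<n. (K \<theta> (s i - s j) - K \<theta>0 (s i - s j))\<^sup>2)"
proof -
  let ?X = "\<lambda>n. INF \<theta>\<in>{\<theta> \<in> \<Theta>. \<alpha> \<le> norm (\<theta> - \<theta>0)}.
     ereal (1 / real n * (\<Sum>i<n. \<Sum>j<n. (K \<theta> (s i - s j) - K \<theta>0 (s i - s j))\<^sup>2))"
  have "0 < liminf ?X" using assms by (simp add: asymptotically_identifiable_def)
  then obtain y where y: "0 < y" "y < liminf ?X" using dense by blast
  then obtain \<delta> where \<delta>: "0 < ereal \<delta>" "ereal \<delta> < y" using ereal_dense2 by blast
  have "ereal \<delta> < liminf ?X" using \<delta>(2) y(2) by (rule less_trans)
  then have "\<forall>\<^sub>F n in sequentially. ereal \<delta> < ?X n" by (rule less_LiminfD)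
  then obtain N where N: "\<And>n. N \<le> n \<Longrightarrow> ereal \<delta> < ?X n" by (auto simp: eventually_sequentially)
  show ?thesis
  proof (rule that[of \<delta> N])
    show "0 < \<delta>" using \<delta>(1) by simp
    fix n \<theta> assume "N \<le> n" "\<theta> \<in> \<Theta>" "\<alpha> \<le> norm (\<theta> - \<theta>0)"
    then have "?X n \<le> ereal (1 / real n * (\<Sum>i<n. \<Sum>j<n. (K \<theta> (s i - s j) - K \<theta>0 (s i - s j))\<^sup>2))"
      by (intro INF_lower) simp
    with N[OF \<open>N \<le> n\<close>] have "ereal \<delta> \<le> ereal (1 / real n * (\<Sum>i<n. \<Sum>j<n. (K \<theta> (s i - s j) - K \<theta>0 (s i - s j))\<^sup>2))"
      by (meson less_imp_le order_trans)
    then show "\<delta> \<le> 1 / real n * (\<Sum>i<n. \<Sum>j<n. (K \<theta> (s i - s j) - K \<theta>0 (s i - s j))\<^sup>2)"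
      by (simp only: ereal_less_eq(3))
  qed
qed

lemma integral_product_of_process:
  fixes X :: "real ^ 'd \<Rightarrow> 'w \<Rightarrow> real"
  assumes "zero_mean_process M X" "has_stationary_covariance M X k"
  shows "integrable M (\<lambda>\<omega>. X a \<omega> * X b \<omega>)" "(\<integral>\<omega>. X a \<omega> * X b \<omega> \<partial>M) = k (a - b)"
proof -
  have [measurable]: "X a \<in> borel_measurable M" for a
    using assms(1) by (auto simp: zero_mean_process_def)
  show "integrable M (\<lambda>\<omega>. X a \<omega> * X b \<omega>)"
    using assms(2) by (intro integrable_mult_of_squares) (auto simp: has_stationary_covariance_def)
  show "(\<integral>\<omega>. X a \<omega> * X b \<omega> \<partial>M) = k (a - b)"
    using assms by (simp add: zero_mean_process_def has_stationary_covariance_def covariance_def)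
qed

text \<open>
  The points \<open>s i\<close> are distinct, so a combination of the \<open>Z (s i)\<close> is one over a finite set of points. Row
  sums of the covariances are bounded by exponential decay.
\<close>

lemma gaussian_process_sequence:
  fixes Z :: "real ^ 'd \<Rightarrow> 'w \<Rightarrow> real" and s :: "nat \<Rightarrow> real ^ 'd"
  assumes M: "prob_space M" and gp: "gaussian_process M Z" and zm: "zero_mean_process M Z"
    and cov: "has_stationary_covariance M Z k" and pos: "subexp_asymp_positive k"
    and \<delta>: "0 < \<delta>" "\<And>i j. i \<noteq> j \<Longrightarrow> \<delta> \<le> infnorm (s i - s j)"
  obtains \<Lambda> where "gaussian_sequence M (\<lambda>i. Z (s i)) (\<lambda>i j. k (s i - s j)) \<Lambda> (k 0)"
proof -
  interpret prob_space M by fact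
  obtain C c where c: "0 < c" "\<And>h. \<bar>k h\<bar> \<le> C * exp (- c * infnorm h)"
    and stat: "stationary_covariance k" using pos by (auto simp: subexp_asymp_positive_def)
  have C: "0 \<le> C" using c(2)[of 0] by (simp add: infnorm_0)
  obtain S where S: "0 < S" "\<And>n x. (\<Sum>j<n. exp (- c * infnorm (x - s j))) \<le> S"
    by (rule separated_exp_sum_bounded[OF \<delta> c(1)]) auto
  have inj: "inj s"
  proof (rule injI, rule ccontr)
    fix i j assume "s i = s j" "i \<noteq> j"
    then show False using \<delta>(2)[of i j] \<delta>(1) by (simp add: infnorm_0)
  qed
  have meas: "Z a \<in> borel_measurable M" and int: "integrable M (Z a)" and zero: "expectation (Z a) = 0" for a
    using zm by (auto simp: zero_mean_process_def)
  note ZZ = integral_product_of_process[OF zm cov]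
  have ev: "k (s i - s j) = k (s j - s i)" for i j
    using stationary_covariance_even[OF stat, of "s i - s j"] by simp
  have "gaussian_sequence M (\<lambda>i. Z (s i)) (\<lambda>i j. k (s i - s j)) (C * S + 1) (k 0)"
  proof
    fix n u
    let ?X = "\<lambda>\<omega>. frequency_sum n u (\<lambda>i. Z (s i) \<omega>)"
    have X: "?X \<omega> = (\<Sum>x\<in>s ` {..<n}. u (the_inv s x) * Z x \<omega>)" for \<omega>
      using inj by (simp add: frequency_sum_def sum.reindex inj_on_subset the_inv_f_f)
    have g: "gaussian_variable M ?X"
      unfolding X
      by (rule gp[unfolded gaussian_process_def, rule_format, of "s ` {..<n}" "\<lambda>x. u (the_inv s x)"]) simp
    have iX: "integrable M ?X" unfolding frequency_sum_def using int by simp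
    have eX: "expectation ?X = 0"
      unfolding frequency_sum_def using int zero by (simp add: Bochner_Integration.integral_sum)
    have X2: "(?X \<omega>)\<^sup>2 = (\<Sum>i<n. \<Sum>j<n. u i * u j * (Z (s i) \<omega> * Z (s j) \<omega>))" for \<omega>
      unfolding frequency_sum_def power2_eq_square sum_product by (simp add: mult_ac)
    have "expectation (\<lambda>\<omega>. (?X \<omega>)\<^sup>2) = (\<Sum>i<n. \<Sum>j<n. u i * u j * k (s i - s j))"
      unfolding X2 by (subst integral_double_sum) (intro integrable_mult_right ZZ(1), simp only: integral_mult_right_zero ZZ(2))
    with gaussian_variable_expectation_cis[OF g iX eX]
    show "expectation (\<lambda>\<omega>. cis (?X \<omega>)) = of_real (exp (- (\<Sum>i<n. \<Sum>j<n. u i * u j * k (s i - s j)) / 2))"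
      by simp
  next
    fix n :: nat and x :: "nat \<Rightarrow> real"
    have "\<bar>\<Sum>i<n. \<Sum>j<n. x i * x j * k (s i - s j)\<bar> \<le> (C * S + 1) * (\<Sum>i<n. (x i)\<^sup>2)"
    proof (rule row_sum_form_le)
      fix i assume "i \<in> {..<n}"
      show "(\<Sum>j<n. \<bar>k (s i - s j)\<bar>) \<le> C * S + 1"
        using exp_decay_row_sum[OF c(2) S(2) C, where n = n and x = "s i"] by simp
    qed (auto simp: ev)
    then show "(\<Sum>i<n. \<Sum>j<n. x i * x j * k (s i - s j)) \<le> (C * S + 1) * (\<Sum>i<n. (x i)\<^sup>2)" by simp
  next
    show "0 < C * S + 1" using C S(1) by (intro add_nonneg_pos) auto
  qed (use meas ZZ in auto)
  then show ?thesis by (rule that)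
qed

lemma scalar_prod_quad_form:
  assumes "A \<in> carrier_mat n n"
  shows "scalar_prod (Matrix.vec n y) (A *\<^sub>v Matrix.vec n y) = quad_form n A y"
  using assms by (simp add: scalar_prod_def quad_form_def matvec_def lessThan_atLeast0)

lemma compact_finite_net:
  fixes \<Theta> :: "'a::metric_space set"
  assumes "compact \<Theta>" "0 < \<eta>"
  obtains D where "finite D" "D \<subseteq> \<Theta>" "\<And>\<theta>. \<theta> \<in> \<Theta> \<Longrightarrow> \<exists>k\<in>D. dist \<theta> k < \<eta>"
proof -
  obtain D where "D \<subseteq> \<Theta>" "finite D" "\<Theta> \<subseteq> (\<Union>k\<in>D. ball k \<eta>)"
    by (rule compactE_image[OF assms(1), of \<Theta> "\<lambda>k. ball k \<eta>"]) (use assms(2) in auto)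
  then show ?thesis by (intro that[of D]) (auto simp: dist_commute subset_iff)
qed

theorem theorem3:
  fixes M :: "'w measure"
    and Z Y :: "real ^ 'd \<Rightarrow> 'w \<Rightarrow> real"
    and T :: "real \<Rightarrow> real"
    and kZ kY :: "real ^ 'd \<Rightarrow> real"
    and s :: "nat \<Rightarrow> real ^ 'd"
    and \<Theta> :: "(real ^ 'p) set"
    and K :: "real ^ 'p \<Rightarrow> real ^ 'd \<Rightarrow> real"
    and \<theta>0 :: "real ^ 'p"
    and \<theta>hat :: "nat \<Rightarrow> 'w \<Rightarrow> real ^ 'p"
  assumes "prob_space M"
    and "gaussian_process M Z" and "zero_mean_process M Z"
    and "has_stationary_covariance M Z kZ" and "subexp_asymp_positive kZ"
    and "subexp_nondecreasing T"
    and "\<And>x \<omega>. Y x \<omega> = T (Z x \<omega>)"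
    and "zero_mean_process M Y" and "has_stationary_covariance M Y kY"
    and "well_separated s"
    and "compact \<Theta>"
    and "\<And>\<theta>. \<theta> \<in> \<Theta> \<Longrightarrow> stationary_covariance (K \<theta>)"
    and "regular_family \<Theta> K"
    and "positive_spectrum \<Theta> K"
    and "\<theta>0 \<in> interior \<Theta>" and "kY = K \<theta>0"
    and "asymptotically_identifiable \<Theta> K s \<theta>0"
    and "\<And>n. 0 < n \<Longrightarrow> \<theta>hat n \<in> borel_measurable M"
    and "\<And>n \<omega>. 0 < n \<Longrightarrow> \<omega> \<in> space M \<Longrightarrow>
           is_arg_min (ml_criterion K s n (Matrix.vec n (\<lambda>i. Y (s i) \<omega>))) (\<lambda>\<theta>. \<theta> \<in> \<Theta>) (\<theta>hat n \<omega>)"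
  shows "tendsto_in_probability M \<theta>hat \<theta>0"
proof -
  interpret prob_space M by fact
  obtain \<delta> where \<delta>: "0 < \<delta>" "\<And>i j. i \<noteq> j \<Longrightarrow> \<delta> \<le> infnorm (s i - s j)"
    by (rule well_separated_distance[OF assms(10)]) blast
  obtain \<Lambda> where gs: "gaussian_sequence M (\<lambda>i. Z (s i)) (\<lambda>i j. kZ (s i - s j)) \<Lambda> (kZ 0)"
    by (rule gaussian_process_sequence[OF assms(1-5) \<delta>]) auto
  interpret G: gaussian_sequence M "\<lambda>i. Z (s i)" "\<lambda>i j. kZ (s i - s j)" \<Lambda> "kZ 0" by fact
  have \<theta>0: "\<theta>0 \<in> \<Theta>" using assms(15) interior_subset by blast
  have T: "continuous_on UNIV T" "mono T"
    using assms(6) by (auto simp: subexp_nondecreasing_def intro: C1_differentiable_imp_continuous_on)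
  have YT: "Y x = (\<lambda>\<omega>. T (Z x \<omega>))" for x using assms(7) by auto
  note YY = integral_product_of_process[OF assms(8,9), unfolded assms(16)]
  have T2: "integrable M (\<lambda>\<omega>. (T (Z (s i) \<omega>))\<^sup>2)" "expectation (\<lambda>\<omega>. (T (Z (s i) \<omega>))\<^sup>2) = K \<theta>0 0" for i
    using YY(1)[of "s i" "s i"] YY(2)[of "s i" "s i"] by (simp_all add: YT power2_eq_square)
  obtain b where b: "0 < b" "\<And>\<theta> n x. \<theta> \<in> \<Theta> \<Longrightarrow> b * sqnorm n x \<le> kernel_form (K \<theta>) s n x 0"
    by (rule kernel_form_uniform_lower_bound[OF \<delta> assms(11,12,14)]) auto
  obtain C c where Cc: "0 < C" "0 < c" "\<And>\<theta> h. \<theta> \<in> \<Theta> \<Longrightarrow> \<bar>K \<theta> h\<bar> \<le> C * exp (- c * infnorm h)"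
    by (rule regular_family_lipschitz[OF assms(13,11)]) auto
  obtain S where S: "0 < S" "\<And>n x. (\<Sum>j<n. exp (- c * infnorm (x - s j))) \<le> S"
    by (rule separated_exp_sum_bounded[OF \<delta> Cc(2)]) auto
  define L where "L = (C * S)\<^sup>2"
  have L: "0 < L" using Cc(1) S(1) by (simp add: L_def)
  define R where "R = (\<lambda>\<theta> n. cov_matrix (K \<theta>) s n)"
  define A where "A = (\<lambda>\<theta> n. the (mat_inverse (R \<theta> n)))"
  have Rsym: "sym_mat n (R \<theta> n)" if "\<theta> \<in> \<Theta>" for \<theta> n
    unfolding R_def by (rule sym_mat_cov_matrix[OF assms(12)[OF that]])
  have Rlow: "b * sqnorm n x \<le> quad_form n (R \<theta> n) x" if "\<theta> \<in> \<Theta>" for \<theta> n x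
    unfolding R_def quad_form_cov_matrix by (rule b(2)[OF that])
  have Rup: "sqnorm n (matvec n (R \<theta> n) x) \<le> L * sqnorm n x" if "\<theta> \<in> \<Theta>" for \<theta> n x
    unfolding L_def
  proof (rule schur_test[OF Rsym[OF that]])
    fix i assume i: "i < n"
    have "(\<Sum>j<n. \<bar>R \<theta> n $$ (i, j)\<bar>) = (\<Sum>j<n. \<bar>K \<theta> (s i - s j)\<bar>)"
      using i by (intro sum.cong refl) (simp add: R_def cov_matrix_entry)
    also have "\<dots> \<le> C * S" using Cc(1) by (intro exp_decay_row_sum[where c = c and k = "K \<theta>"] Cc(3) S(2) that) auto
    finally show "(\<Sum>j<n. \<bar>R \<theta> n $$ (i, j)\<bar>) \<le> C * S" .
  qed (use Cc(1) S(1) in auto)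
  have A: "mat_inverse (R \<theta> n) = Some (A \<theta> n)" "sym_mat n (A \<theta> n)" "R \<theta> n * A \<theta> n = 1\<^sub>m n" "A \<theta> n * R \<theta> n = 1\<^sub>m n"
    "\<And>x. b\<^sup>2 * sqnorm n (matvec n (A \<theta> n) x) \<le> sqnorm n x" if th: "\<theta> \<in> \<Theta>" for \<theta> n
  proof -
    obtain S where S: "mat_inverse (R \<theta> n) = Some S" "sym_mat n S" "R \<theta> n * S = 1\<^sub>m n" "S * R \<theta> n = 1\<^sub>m n"
      "\<And>x. b\<^sup>2 * sqnorm n (matvec n S x) \<le> sqnorm n x"
      by (rule spd_inverse[OF Rsym[OF th] b(1) Rlow[OF th]]) blast
    moreover have "A \<theta> n = S" using S(1) by (simp add: A_def)
    ultimately show "mat_inverse (R \<theta> n) = Some (A \<theta> n)" "sym_mat n (A \<theta> n)" "R \<theta> n * A \<theta> n = 1\<^sub>m n" "A \<theta> n * R \<theta> n = 1\<^sub>m n"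
    "\<And>x. b\<^sup>2 * sqnorm n (matvec n (A \<theta> n) x) \<le> sqnorm n x" by auto
  qed
  have Ac: "A \<theta> n \<in> carrier_mat n n" if "\<theta> \<in> \<Theta>" for \<theta> n using A(2)[OF that] by (simp add: sym_mat_def)
  have Rc: "R \<theta> n \<in> carrier_mat n n" for \<theta> n by (simp add: R_def cov_matrix_def)
  define y where "y = (\<lambda>\<omega> i. Y (s i) \<omega>)"
  define q where "q = (\<lambda>\<theta> n \<omega>. quad_form n (A \<theta> n) (y \<omega>))"
  define dev where "dev = (\<lambda>\<theta> n \<omega>. \<bar>q \<theta> n \<omega> - expectation (q \<theta> n)\<bar>)"
  have qint: "integrable M (q \<theta> n)" for \<theta> n
    unfolding q_def y_def by (intro quad_form_integrable(1) YY(1))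
  have Eq: "expectation (q \<theta> n) = mtrace (A \<theta> n * R \<theta>0 n)" if "\<theta> \<in> \<Theta>" for \<theta> n
  proof -
    have "expectation (q \<theta> n) = (\<Sum>i<n. \<Sum>j<n. A \<theta> n $$ (i, j) * K \<theta>0 (s i - s j))"
      unfolding q_def y_def using quad_form_integrable(2)[of n M "\<lambda>i. Y (s i)" "A \<theta> n"] YY by simp
    also have "\<dots> = (\<Sum>i<n. \<Sum>j<n. A \<theta> n $$ (i, j) * R \<theta>0 n $$ (j, i))"
    proof (intro sum.cong refl)
      fix i j assume "i \<in> {..<n}" "j \<in> {..<n}"
      then show "A \<theta> n $$ (i, j) * K \<theta>0 (s i - s j) = A \<theta> n $$ (i, j) * R \<theta>0 n $$ (j, i)"
        using stationary_covariance_even[OF assms(12)[OF \<theta>0], of "s i - s j"] by (simp add: R_def cov_matrix_entry)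
    qed
    also have "\<dots> = mtrace (A \<theta> n * R \<theta>0 n)"
    proof -
      have "dim_row (A \<theta> n * R \<theta>0 n) = n" using Ac[OF that, of n] by simp
      then show ?thesis
        unfolding mtrace_def using index_mult_sum[OF Ac[OF that] Rc] by simp
    qed
    finally show ?thesis .
  qed
  have ml: "ml_criterion K s n (Matrix.vec n (\<lambda>i. Y (s i) \<omega>)) \<theta> = 1 / real n * (ln (Determinant.det (R \<theta> n)) + q \<theta> n \<omega>)"
    if "\<theta> \<in> \<Theta>" for \<theta> n \<omega>
    using scalar_prod_quad_form[OF Ac[OF that, of n], of "\<lambda>i. Y (s i) \<omega>"]
    by (simp add: ml_criterion_def Let_def q_def y_def A_def R_def)
  \<comment> \<open>a parameter that beats \<open>\<theta>0\<close> forces a fluctuation as large as the divergence\<close>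
  have dev_ge: "divergence_const b L * (\<Sum>i<n. \<Sum>j<n. (K \<theta> (s i - s j) - K \<theta>0 (s i - s j))\<^sup>2) \<le> dev \<theta> n \<omega> + dev \<theta>0 n \<omega>"
    if n: "0 < n" and \<theta>: "\<theta> \<in> \<Theta>"
      and le: "ml_criterion K s n (Matrix.vec n (\<lambda>i. Y (s i) \<omega>)) \<theta> \<le> ml_criterion K s n (Matrix.vec n (\<lambda>i. Y (s i) \<omega>)) \<theta>0"
    for n \<theta> \<omega>
  proof -
    have "(\<Sum>i<n. \<Sum>j<n. (K \<theta> (s i - s j) - K \<theta>0 (s i - s j))\<^sup>2) = (\<Sum>i<n. \<Sum>j<n. (R \<theta> n $$ (i, j) - R \<theta>0 n $$ (i, j))\<^sup>2)"
      by (intro sum.cong refl) (simp add: R_def cov_matrix_entry)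
    then have 1: "divergence_const b L * (\<Sum>i<n. \<Sum>j<n. (K \<theta> (s i - s j) - K \<theta>0 (s i - s j))\<^sup>2)
      \<le> ln (Determinant.det (R \<theta> n)) - ln (Determinant.det (R \<theta>0 n)) + expectation (q \<theta> n) - real n"
      using gaussian_divergence_ge[OF Rsym[OF \<theta>] Rlow[OF \<theta>] Rup[OF \<theta>] Rsym[OF \<theta>0] Rlow[OF \<theta>0] Rup[OF \<theta>0] b(1) L A(1)[OF \<theta>]]
      by (simp add: Eq[OF \<theta>])
    have 2: "expectation (q \<theta>0 n) = real n"
      using A(4)[OF \<theta>0, of n] by (simp add: Eq[OF \<theta>0] mtrace_one)
    have "ln (Determinant.det (R \<theta> n)) + q \<theta> n \<omega> \<le> ln (Determinant.det (R \<theta>0 n)) + q \<theta>0 n \<omega>"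
      using le n by (simp add: ml[OF \<theta>] ml[OF \<theta>0] divide_le_cancel)
    then show ?thesis using 1 2 unfolding dev_def by linarith
  qed
  define V where "V = K \<theta>0 0"
  have V: "0 \<le> V" using T2(2)[of 0] unfolding V_def by (metis Bochner_Integration.integral_nonneg zero_le_power2)
  have yint: "integrable M (\<lambda>\<omega>. sqnorm n (y \<omega>))" "expectation (\<lambda>\<omega>. sqnorm n (y \<omega>)) = real n * V" for n
    unfolding sqnorm_def y_def YT using T2 by (simp_all add: Bochner_Integration.integral_sum V_def)
  show ?thesis
    unfolding tendsto_in_probability_def
  proof (intro allI impI)
    fix \<alpha> :: real assume \<alpha>: "0 < \<alpha>"
    obtain \<delta>0 N0 where id: "0 < \<delta>0" "\<And>n \<theta>. N0 \<le> n \<Longrightarrow> \<theta> \<in> \<Theta> \<Longrightarrow> \<alpha> \<le> norm (\<theta> - \<theta>0) \<Longrightarrow>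
       \<delta>0 \<le> 1 / real n * (\<Sum>i<n. \<Sum>j<n. (K \<theta> (s i - s j) - K \<theta>0 (s i - s j))\<^sup>2)"
      by (rule asymptotically_identifiable_bound[OF assms(17) \<alpha>]) blast
    define \<kappa> where "\<kappa> = divergence_const b L * \<delta>0"
    have \<kappa>: "0 < \<kappa>" using divergence_const_pos[OF b(1) L] id(1) by (simp add: \<kappa>_def)
    let ?E = "\<lambda>n. {\<omega> \<in> space M. \<alpha> < dist (\<theta>hat n \<omega>) \<theta>0}"
    show "(\<lambda>n. measure M (?E n)) \<longlonglongrightarrow> 0"
    proof (rule LIMSEQ_I)
      fix r :: real assume r: "0 < r"
      \<comment> \<open>relative accuracy of the net: moving \<open>\<theta>\<close> to the net changes a fluctuation by at most
        \<open>\<zeta>\<close> times \<open>\<parallel>y\<parallel>\<^sup>2 + n V\<close>, of mean \<open>2 \<zeta> n V\<close>\<close>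
      define \<zeta> where "\<zeta> = \<kappa> * r / (8 * (V + 1))"
      have \<zeta>: "0 < \<zeta>" using \<kappa> r V by (simp add: \<zeta>_def)
      have \<zeta>V: "2 * \<zeta> * V \<le> \<kappa> * r / 4"
      proof -
        have "2 * \<zeta> * V \<le> 2 * \<zeta> * (V + 1)" using \<zeta> by simp
        also have "\<dots> = \<kappa> * r / 4"
        proof -
          have "2 * (\<kappa> * r / (8 * d)) * d = \<kappa> * r / 4" if "0 < d" for d using that by simp
          from this[of "V + 1"] V show ?thesis by (simp add: \<zeta>_def del: distrib_left_numeral distrib_right_numeral)
        qed
        finally show ?thesis .
      qed
      obtain \<eta> where \<eta>: "0 < \<eta>" "\<And>\<theta> \<theta>' n x. \<theta> \<in> \<Theta> \<Longrightarrow> \<theta>' \<in> \<Theta> \<Longrightarrow> dist \<theta> \<theta>' < \<eta> \<Longrightarrow>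
         sqnorm n (\<lambda>i. matvec n (R \<theta>' n) x i - matvec n (R \<theta> n) x i) \<le> (\<zeta> * b\<^sup>2)\<^sup>2 * sqnorm n x"
        unfolding R_def
        by (rule covariance_modulus[OF assms(13,11,12) \<delta>, where \<epsilon> = "\<zeta> * b\<^sup>2"]) (use \<zeta> b(1) in auto)
      obtain D where D: "finite D" "D \<subseteq> \<Theta>" "\<And>\<theta>. \<theta> \<in> \<Theta> \<Longrightarrow> \<exists>k\<in>D. dist \<theta> k < \<eta>"
        by (rule compact_finite_net[OF assms(11) \<eta>(1)]) blast
      define e where "e = \<kappa> * r / (4 * (real (card D) + 1))"
      have e: "0 < e" using \<kappa> r by (simp add: e_def)
      obtain N1 where N1: "\<And>n B. N1 \<le> n \<Longrightarrow> sym_mat n B \<Longrightarrow>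
          (\<And>x. sqnorm n (matvec n B x) \<le> 1 / b\<^sup>2 * sqnorm n x) \<Longrightarrow>
          expectation (\<lambda>\<omega>. \<bar>quad_form n B (\<lambda>i. T (Z (s i) \<omega>)) - expectation (\<lambda>\<omega>. quad_form n B (\<lambda>i. T (Z (s i) \<omega>)))\<bar>) \<le> e * real n"
        by (rule G.quad_form_concentration[OF T T2(1) eq_refl[OF T2(2)] _ e, where C = "1 / b\<^sup>2"]) auto
      have Edev: "expectation (dev \<theta> n) \<le> e * real n" if "N1 \<le> n" "\<theta> \<in> \<Theta>" for \<theta> n
      proof -
        have "sqnorm n (matvec n (A \<theta> n) x) \<le> 1 / b\<^sup>2 * sqnorm n x" for x
          using A(5)[OF that(2), of n x] b(1) by (simp add: field_simps)
        from N1[OF that(1) A(2)[OF that(2)] this]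
        show ?thesis by (simp add: dev_def q_def y_def YT)
      qed
      \<comment> \<open>an integrable bound for the fluctuations at all parameters simultaneously\<close>
      define U where "U = (\<lambda>n \<omega>. (\<Sum>k\<in>D. dev k n \<omega>) + dev \<theta>0 n \<omega> + \<zeta> * (sqnorm n (y \<omega>) + real n * V))"
      have devint: "integrable M (dev \<theta> n)" for \<theta> n unfolding dev_def using qint by simp
      have Uint: "integrable M (U n)" for n
        unfolding U_def using devint yint(1) by simp
      have EU: "expectation (U n) \<le> real n * (\<kappa> * r / 2)" if n: "N1 \<le> n" for n
      proof -
        have "expectation (U n) = (\<Sum>k\<in>D. expectation (dev k n)) + expectation (dev \<theta>0 n) + \<zeta> * (real n * V + real n * V)"
          unfolding U_def using devint yint prob_space by (simp add: Bochner_Integration.integral_sum)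
        also have "\<dots> \<le> (\<Sum>k\<in>D. e * real n) + e * real n + \<zeta> * (real n * V + real n * V)"
          using D(2) n \<theta>0 by (intro add_mono sum_mono Edev order_refl) auto
        also have "\<dots> = real n * ((real (card D) + 1) * e + 2 * \<zeta> * V)" by (simp add: algebra_simps)
        also have "\<dots> \<le> real n * (\<kappa> * r / 4 + \<kappa> * r / 4)"
        proof (intro mult_left_mono add_mono \<zeta>V)
          have "d * (\<kappa> * r / (4 * d)) \<le> \<kappa> * r / 4" if "0 < d" for d using that by simp
          from this[of "real (card D) + 1"] show "(real (card D) + 1) * e \<le> \<kappa> * r / 4"
            unfolding e_def by linarith
        qed simp
        finally show ?thesis by simp
      qed
      \<comment> \<open>the fluctuation at \<open>\<theta>\<close> is controlled by that at a close point of the net\<close>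
      have dev_net: "dev \<theta> n \<omega> \<le> (\<Sum>k\<in>D. dev k n \<omega>) + \<zeta> * (sqnorm n (y \<omega>) + real n * V)"
        if \<theta>: "\<theta> \<in> \<Theta>" for \<theta> n \<omega>
      proof -
        obtain k where k: "k \<in> D" "dist \<theta> k < \<eta>" using D(3)[OF \<theta>] by blast
        then have k\<Theta>: "k \<in> \<Theta>" using D(2) by blast
        have qd: "\<bar>q \<theta> n \<omega> - q k n \<omega>\<bar> \<le> \<zeta> * sqnorm n (y \<omega>)" for \<omega>
        proof -
          \<comment> \<open>the factor \<open>b\<^sup>2\<close> cancels the one lost in passing to inverses\<close>
          have "\<bar>q \<theta> n \<omega> - q k n \<omega>\<bar> \<le> (\<zeta> * b\<^sup>2) / b\<^sup>2 * sqnorm n (y \<omega>)"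
            unfolding q_def
            by (rule inverse_quad_form_diff[OF Rsym[OF \<theta>] A(3)[OF \<theta>] Ac[OF \<theta>] A(5)[OF \<theta>]
                  Rsym[OF k\<Theta>] A(3)[OF k\<Theta>] Ac[OF k\<Theta>] A(5)[OF k\<Theta>] \<eta>(2)[OF \<theta> k\<Theta> k(2)] b(1)])
              (use \<zeta> in simp)
          then show ?thesis using b(1) by simp
        qed
        have "\<bar>expectation (q \<theta> n) - expectation (q k n)\<bar> \<le> expectation (\<lambda>\<omega>. \<bar>q \<theta> n \<omega> - q k n \<omega>\<bar>)"
          using integral_abs_bound[of M "\<lambda>\<omega>. q \<theta> n \<omega> - q k n \<omega>"] qint by simp
        also have "\<dots> \<le> expectation (\<lambda>\<omega>. \<zeta> * sqnorm n (y \<omega>))"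
          using qint yint(1) qd by (intro integral_mono) auto
        also have "\<dots> = \<zeta> * (real n * V)" by (simp add: yint(2))
        finally have "dev \<theta> n \<omega> \<le> dev k n \<omega> + \<zeta> * sqnorm n (y \<omega>) + \<zeta> * (real n * V)"
          using qd[of \<omega>] unfolding dev_def by linarith
        also have "dev k n \<omega> \<le> (\<Sum>k\<in>D. dev k n \<omega>)"
          using D(1) k(1) by (intro member_le_sum) (auto simp: dev_def)
        finally show ?thesis by (simp add: algebra_simps)
      qed
      have "norm (measure M (?E n) - 0) < r" if n: "max (max N0 N1) 1 \<le> n" for n
      proof -
        have n0: "0 < n" and nN: "N0 \<le> n" "N1 \<le> n" using n by auto
        have sub: "?E n \<subseteq> {\<omega> \<in> space M. real n * \<kappa> \<le> U n \<omega>}"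
        proof safe
          fix \<omega> assume \<omega>: "\<omega> \<in> space M" "\<alpha> < dist (\<theta>hat n \<omega>) \<theta>0"
          let ?t = "\<theta>hat n \<omega>"
          from assms(19)[OF n0 \<omega>(1)] have t: "?t \<in> \<Theta>"
            and le: "ml_criterion K s n (Matrix.vec n (\<lambda>i. Y (s i) \<omega>)) ?t \<le> ml_criterion K s n (Matrix.vec n (\<lambda>i. Y (s i) \<omega>)) \<theta>0"
            using \<theta>0 by (auto simp: is_arg_min_def not_less)
          have "\<delta>0 \<le> 1 / real n * (\<Sum>i<n. \<Sum>j<n. (K ?t (s i - s j) - K \<theta>0 (s i - s j))\<^sup>2)"
            using \<omega>(2) by (intro id(2)[OF nN(1) t]) (simp add: dist_norm)
          then have "real n * \<delta>0 \<le> (\<Sum>i<n. \<Sum>j<n. (K ?t (s i - s j) - K \<theta>0 (s i - s j))\<^sup>2)"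
            using n0 by (simp add: field_simps)
          then have "divergence_const b L * (real n * \<delta>0) \<le> dev ?t n \<omega> + dev \<theta>0 n \<omega>"
            using divergence_const_pos[OF b(1) L]
            by (intro order_trans[OF mult_left_mono dev_ge[OF n0 t le]]) auto
          also have "\<dots> \<le> U n \<omega>" using dev_net[OF t, of n \<omega>] by (simp add: U_def)
          finally show "real n * \<kappa> \<le> U n \<omega>" by (simp add: \<kappa>_def mult_ac)
        qed
        have U0: "0 \<le> U n \<omega>" for \<omega>
          unfolding U_def using \<zeta> V sqnorm_nonneg[of n "y \<omega>"]
          by (intro add_nonneg_nonneg sum_nonneg mult_nonneg_nonneg) (auto simp: dev_def)
        have Um: "{\<omega> \<in> space M. real n * \<kappa> \<le> U n \<omega>} \<in> sets M"
          using Uint[of n] by measurable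
        have "measure M (?E n) \<le> measure M {\<omega> \<in> space M. real n * \<kappa> \<le> U n \<omega>}"
          by (rule finite_measure_mono[OF sub Um])
        also have "\<dots> \<le> expectation (U n) / (real n * \<kappa>)"
          using U0 n0 \<kappa> by (intro integral_Markov_inequality_measure[OF Uint, where A = "{}"]) auto
        also have "\<dots> \<le> real n * (\<kappa> * r / 2) / (real n * \<kappa>)"
          using EU[OF nN(2)] n0 \<kappa> by (intro divide_right_mono) auto
        also have "\<dots> = r / 2" using n0 \<kappa> by simp
        also have "\<dots> < r" using r by simp
        finally show ?thesis by simp
      qed
      then show "\<exists>no. \<forall>n\<ge>no. norm (measure M (?E n) - 0) < r" by blast
    qed
  qed
qed

end
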